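(* Let $M$ and $M'$ be matroids on disjoint ground sets. Assume that $M$ has no coloops and that $M'$ has no loops. If the free product $M\mathbin{\Box} M'$ is extremal, then $M$ and $M'$ are extremal.
   Context: All matroids are on finite ground sets. For matroids $M,N$ on disjoint ground sets, the free product $M\mathbin{\Box}N$ is the matroid on $E(M)\cup E(N)$ whose independent sets are the sets $I\cup J$ where $I$ is independent in $M$, $J\subseteq E(N)$, and $|I\cup J|\le r(M)+r_N(J)$. For a matroid $M$ on $[n]$, $\mathcal{P}(M)\subset\mathbb{R}^n$ is the convex hull of the characteristic vectors of the bases of $M$. For $X\subseteq\mathbb{R}^n$ with indicator function $\bar{\mathbb{I}}(X)$, the symmetrized indicator function is $\mathbb{I}(X)(x_1,\ldots,x_n)=\frac{1}{n!}\sum_{\sigma\in S_n}\bar{\mathbb{I}}(X)(x_{\sigma(1)},\ldots,x_{\sigma(n)})$. $\mathbb{I}(\mathcal{P}(M))$ depends only on the isomorphism class of $M$, so it is defined for matroids on any $n$-element ground set and for unlabeled matroids (isomorphism classes). A cyclic flat of $M$ is a flat that is a (possibly empty) union of circuits; $M$ is nested if its cyclic flats form a chain under inclusion. Fix a linear order $N_1,\ldots,N_{\binom nr}$ of the unlabeled rank-$r$ nested matroids on $n$ elements. By a theorem of Derksen and Fink, for each rank-$r$ matroid $M$ on $n$ elements there is a unique integer vector $\boldsymbol{v}_M=(a_1,\ldots,a_{\binom nr})$ with $\mathbb{I}(\mathcal{P}(M))=\sum_i a_i\,\mathbb{I}(\mathcal{P}(N_i))$. The polytope $\Omega_{r,n}$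 is the convex hull of all vectors $\boldsymbol{v}_M$, $M$ ranging over rank-$r$ matroids on $n$ elements. $M$ is extremal if $\boldsymbol{v}_M$ is a vertex of $\Omega_{r,n}$. *)

theory Defs
  imports
    "HOL-Analysis.Analysis"
    "HOL-Combinatorics.Permutations"
    "HOL-Library.Function_Algebras"
begin

text \<open>
  The dimension of the ambient space varies, so the space of real vectors with coordinates indexed
  by \<open>S \<subseteq> 'a\<close> is rendered as the set of functions \<open>'a \<Rightarrow> real\<close> vanishing outside \<open>S\<close>. Pointwise
  scaling makes \<open>'a \<Rightarrow> real\<close> a real vector space, which gives access to \<open>convex hull\<close> and
  \<open>extreme_point_of\<close>.
\<close>

instantiation "fun" :: (type, real_vector) real_vector
begin

definition scaleR_fun :: "real \<Rightarrow> ('a \<Rightarrow> 'b) \<Rightarrow> 'a \<Rightarrow> 'b" where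
  "scaleR_fun c f = (\<lambda>x. c *\<^sub>R f x)"

instance
  by standard
    (simp_all add: scaleR_fun_def fun_eq_iff plus_fun_def scaleR_add_right scaleR_add_left)

end

definition coord_space :: "nat \<Rightarrow> (nat \<Rightarrow> real) set" where
  "coord_space n = {x. \<forall>i. i \<notin> {1..n} \<longrightarrow> x i = 0}"


subsection \<open>Matroids\<close>

record 'a matroid =
  ground :: "'a set"
  indeps :: "'a set set"

definition is_matroid :: "'a matroid \<Rightarrow> bool" where
  "is_matroid M \<longleftrightarrow>
     finite (ground M) \<and>
     (\<forall>I \<in> indeps M. I \<subseteq> ground M) \<and>
     {} \<in> indeps M \<and>
     (\<forall>I \<in> indeps M. \<forall>J. J \<subseteq> I \<longrightarrow> J \<in> indeps M) \<and>
     (\<forall>I \<in> indeps M. \<forall>J \<in> indeps M. card I < card J \<longrightarrow>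
        (\<exists>e \<in> J - I. insert e I \<in> indeps M))"

definition bases :: "'a matroid \<Rightarrow> 'a set set" where
  "bases M = {B \<in> indeps M. \<forall>I \<in> indeps M. B \<subseteq> I \<longrightarrow> I = B}"

definition rank_of :: "'a matroid \<Rightarrow> 'a set \<Rightarrow> nat" where
  "rank_of M X = Max {card I |I. I \<in> indeps M \<and> I \<subseteq> X}"

definition rank :: "'a matroid \<Rightarrow> nat" where
  "rank M = rank_of M (ground M)"

definition circuits :: "'a matroid \<Rightarrow> 'a set set" where
  "circuits M = {C. C \<subseteq> ground M \<and> C \<notin> indeps M \<and> (\<forall>D. D \<subset> C \<longrightarrow> D \<in> indeps M)}"

definition flats :: "'a matroid \<Rightarrow> 'a set set" where
  "flats M = {F. F \<subseteq> ground M \<and> (\<forall>e \<in> ground M - F. rank_of M F < rank_of M (insert e F))}"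

definition cyclic_flats :: "'a matroid \<Rightarrow> 'a set set" where
  "cyclic_flats M = {F \<in> flats M. \<exists>\<C> \<subseteq> circuits M. F = \<Union>\<C>}"

definition nested :: "'a matroid \<Rightarrow> bool" where
  "nested M \<longleftrightarrow> (\<forall>F \<in> cyclic_flats M. \<forall>G \<in> cyclic_flats M. F \<subseteq> G \<or> G \<subseteq> F)"

definition is_loop :: "'a matroid \<Rightarrow> 'a \<Rightarrow> bool" where
  "is_loop M e \<longleftrightarrow> {e} \<in> circuits M"

definition is_coloop :: "'a matroid \<Rightarrow> 'a \<Rightarrow> bool" where
  "is_coloop M e \<longleftrightarrow> e \<in> ground M \<and> (\<forall>B \<in> bases M. e \<in> B)"

definition isomorphic :: "'a matroid \<Rightarrow> 'b matroid \<Rightarrow> bool" where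
  "isomorphic M N \<longleftrightarrow>
     (\<exists>f. bij_betw f (ground M) (ground N) \<and>
          (\<forall>X \<subseteq> ground M. X \<in> indeps M \<longleftrightarrow> f ` X \<in> indeps N))"

definition free_product :: "'a matroid \<Rightarrow> 'a matroid \<Rightarrow> 'a matroid" where
  "free_product M N =
     \<lparr>ground = ground M \<union> ground N,
      indeps = {I \<union> J |I J. I \<in> indeps M \<and> J \<subseteq> ground N \<and>
                            card (I \<union> J) \<le> rank M + rank_of N J}\<rparr>"

definition matroids_on :: "'a set \<Rightarrow> nat \<Rightarrow> 'a matroid set" where
  "matroids_on E r = {M. is_matroid M \<and> ground M = E \<and> rank M = r}"


subsection \<open>Symmetrized indicator functions of matroid polytopes\<close>

definition base_polytope :: "'a matroid \<Rightarrow> ('a \<Rightarrow> real) set" where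
  "base_polytope M = convex hull (indicat_real ` bases M)"

definition sym_indicator :: "nat \<Rightarrow> (nat \<Rightarrow> real) set \<Rightarrow> (nat \<Rightarrow> real) \<Rightarrow> real" where
  "sym_indicator n X x =
     1 / fact n * (\<Sum>\<sigma> | \<sigma> permutes {1..n}. indicat_real X (\<lambda>i. x (\<sigma> i)))"

text \<open>
  \<open>sym_indicator n (base_polytope M)\<close> is the same for isomorphic matroids on \<open>{1..n}\<close>, so for a
  matroid on an arbitrary \<open>n\<close>-element set any isomorphic copy on \<open>{1..n}\<close> can be used.
\<close>

definition labelled_copy :: "'a matroid \<Rightarrow> nat matroid" where
  "labelled_copy M =
     (SOME L. is_matroid L \<and> ground L = {1..card (ground M)} \<and> isomorphic M L)"

definition polytope_indicator :: "'a matroid \<Rightarrow> (nat \<Rightarrow> real) \<Rightarrow> real" where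
  "polytope_indicator M = sym_indicator (card (ground M)) (base_polytope (labelled_copy M))"


subsection \<open>Coordinates with respect to nested matroids and extremality\<close>

text \<open>
  \<open>N r n\<close> lists the unlabeled rank-\<open>r\<close> nested matroids on \<open>n\<close> elements: each isomorphism class is
  represented by exactly one of the matroids \<open>N r n 1, \<dots>, N r n (n choose r)\<close> on \<open>{1..n}\<close>.
\<close>

definition nested_enumeration :: "(nat \<Rightarrow> nat \<Rightarrow> nat \<Rightarrow> nat matroid) \<Rightarrow> bool" where
  "nested_enumeration N \<longleftrightarrow>
     (\<forall>r n. (\<forall>i \<in> {1..n choose r}. N r n i \<in> matroids_on {1..n} r \<and> nested (N r n i)) \<and>
            (\<forall>K \<in> matroids_on {1..n} r. nested K \<longrightarrow>
               (\<exists>!i. i \<in> {1..n choose r} \<and> isomorphic K (N r n i))))"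

definition nested_coords :: "(nat \<Rightarrow> nat \<Rightarrow> nat \<Rightarrow> nat matroid) \<Rightarrow> 'a matroid \<Rightarrow> nat \<Rightarrow> real" where
  "nested_coords N M =
     (let n = card (ground M); r = rank M in
      THE a. a \<in> coord_space (n choose r) \<and> (\<forall>i. a i \<in> \<int>) \<and>
             (\<forall>x \<in> coord_space n.
                polytope_indicator M x =
                  (\<Sum>i = 1..n choose r. a i * polytope_indicator (N r n i) x)))"

definition Omega :: "(nat \<Rightarrow> nat \<Rightarrow> nat \<Rightarrow> nat matroid) \<Rightarrow> nat \<Rightarrow> nat \<Rightarrow> (nat \<Rightarrow> real) set" where
  "Omega N r n = convex hull (nested_coords N ` matroids_on {1..n} r)"

definition extremal :: "(nat \<Rightarrow> nat \<Rightarrow> nat \<Rightarrow> nat matroid) \<Rightarrow> 'a matroid \<Rightarrow> bool" where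
  "extremal N M \<longleftrightarrow>
     nested_coords N M extreme_point_of Omega N (rank M) (card (ground M))"

end

theory Submission
  imports Defs "HOL-Combinatorics.Multiset_Permutations"
begin

text \<open>
  The coordinate vector of a free product is the tensor product of the coordinate vectors of its
  factors, and tensoring with a fixed nonzero vector is linear and injective. If the vector of one
  factor were a proper convex combination of two other points of its polytope, then tensoring with the vector of the other
  factor would write the vector of the free product as a proper convex combination of two points of
  the larger polytope. So extremality of the free product descends to both factors.

  To make sense of the tensor product, nested matroids are indexed by words: a subset \<open>A\<close> of
  \<open>{1..n}\<close> of size \<open>r\<close> defines the Schubert matroid \<open>schubert {1..n} A\<close>, in which the independent sets
  \<open>I\<close> are those with \<open>card (I \<inter> {..j}) \<le> card (A \<inter> {..j})\<close> for all \<open>j\<close>. These matroids are nested, and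
  distinct words give nonisomorphic matroids; as there are \<open>n choose r\<close> words, they represent all the
  classes in the enumeration (\<open>bij_betw_schubert_index\<close>). The free product of two of them belongs to
  the concatenated word (\<open>free_product_schubert\<close>).

  The tensor formula \<open>nested_coords_free_product\<close> rests on an invariant that is visibly bilinear: the
  multiset of rank sequences along all orderings of the ground set, here the functional
  \<open>flag_sum\<close>. In an ordering of the disjoint union, the rank sequence of the free product is
  computed from the rank sequences of the two factors and the way in which their orderings are
  merged (\<open>flag_sum_free_product\<close>). Flag sums of Schubert matroids are linearly independent by
  triangularity (\<open>schubert_flag_sums_independent\<close>). Finally, every linear relation between symmetrized
  indicators of polytopes also holds between flag sums (\<open>flag_sum_relation\<close>): cutting a polytope
  with lower bounds along a chain of sets leaves a nonempty set exactly if the ranks along the chain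
  are large enough, and nonemptiness of compact convex sets is a linear functional of their
  indicators (\<open>compact_convex_relation\<close>).

  That a coordinate vector exists at all, with integer entries, is a chain expansion of the
  indicator of the polytope (\<open>base_polytope_in_int_span\<close>): the system of rank inequalities on all
  subsets is an alternating sum over chains of the systems restricted to the chain, and each of these
  describes the polytope of a nested matroid. The description of polytopes by inequalities comes from
  the usual uncrossing argument (\<open>feasible_in_convex_hull\<close>).
\<close>

section \<open>Rank in matroids\<close>

lemma matroid_finite: "is_matroid M \<Longrightarrow> finite (ground M)"
  by (simp add: is_matroid_def)

lemma indep_subset_ground: "is_matroid M \<Longrightarrow> I \<in> indeps M \<Longrightarrow> I \<subseteq> ground M"
  by (simp add: is_matroid_def)

lemma indep_finite: "is_matroid M \<Longrightarrow> I \<in> indeps M \<Longrightarrow> finite I"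
  by (meson finite_subset indep_subset_ground matroid_finite)

lemma indep_empty: "is_matroid M \<Longrightarrow> {} \<in> indeps M"
  by (simp add: is_matroid_def)

lemma indep_subset: "is_matroid M \<Longrightarrow> I \<in> indeps M \<Longrightarrow> J \<subseteq> I \<Longrightarrow> J \<in> indeps M"
  unfolding is_matroid_def by blast

lemma indep_exchange:
  "is_matroid M \<Longrightarrow> I \<in> indeps M \<Longrightarrow> J \<in> indeps M \<Longrightarrow> card I < card J \<Longrightarrow>
    \<exists>e \<in> J - I. insert e I \<in> indeps M"
  unfolding is_matroid_def by blast

lemma finite_indep_cards:
  assumes "is_matroid M"
  shows "finite {card I |I. I \<in> indeps M \<and> I \<subseteq> X}"
proof -
  have "{card I |I. I \<in> indeps M \<and> I \<subseteq> X} \<subseteq> card ` Pow (ground M)"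
    using indep_subset_ground[OF assms] by auto
  then show ?thesis
    using matroid_finite[OF assms] finite_surj by blast
qed

lemma rank_of_ge:
  assumes "is_matroid M" "I \<in> indeps M" "I \<subseteq> X"
  shows "card I \<le> rank_of M X"
  unfolding rank_of_def using assms finite_indep_cards[OF assms(1)] by (intro Max_ge) auto

lemma rank_of_obtain:
  assumes "is_matroid M"
  obtains I where "I \<in> indeps M" "I \<subseteq> X" "card I = rank_of M X"
proof -
  have "rank_of M X \<in> {card I |I. I \<in> indeps M \<and> I \<subseteq> X}"
    unfolding rank_of_def using finite_indep_cards[OF assms] indep_empty[OF assms]
    by (intro Max_in) auto
  then show ?thesis using that by auto
qed

lemma rank_of_le:
  assumes "is_matroid M" "\<And>I. I \<in> indeps M \<Longrightarrow> I \<subseteq> X \<Longrightarrow> card I \<le> k"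
  shows "rank_of M X \<le> k"
  using assms by (metis rank_of_obtain)

lemma rank_of_mono: "is_matroid M \<Longrightarrow> X \<subseteq> Y \<Longrightarrow> rank_of M X \<le> rank_of M Y"
  by (meson rank_of_ge rank_of_le subset_trans)

lemma rank_of_le_card: "is_matroid M \<Longrightarrow> finite X \<Longrightarrow> rank_of M X \<le> card X"
  by (simp add: card_mono rank_of_le)

lemma rank_of_indep: "is_matroid M \<Longrightarrow> I \<in> indeps M \<Longrightarrow> rank_of M I = card I"
  by (meson antisym indep_finite order_refl rank_of_ge rank_of_le_card)

lemma indep_iff_card_le_rank:
  assumes "is_matroid M" "finite X"
  shows "X \<in> indeps M \<longleftrightarrow> card X \<le> rank_of M X"
  by (metis assms card_subset_eq dual_order.antisym order_refl rank_of_indep rank_of_le_card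
      rank_of_obtain)

lemma indep_extend:
  assumes M: "is_matroid M" and "I \<in> indeps M" "I \<subseteq> X"
  obtains J where "J \<in> indeps M" "I \<subseteq> J" "J \<subseteq> X" "card J = rank_of M X"
proof -
  let ?S = "{J. J \<in> indeps M \<and> I \<subseteq> J \<and> J \<subseteq> X}"
  have "finite ?S"
    using indep_subset_ground[OF M] matroid_finite[OF M]
    by (intro finite_subset[of ?S "Pow (ground M)"]) auto
  moreover have "I \<in> ?S" using assms by auto
  ultimately have "Max (card ` ?S) \<in> card ` ?S" by (intro Max_in) auto
  then obtain J where J: "J \<in> ?S" "card J = Max (card ` ?S)" by auto
  then have max: "\<forall>K\<in>?S. card K \<le> card J" using \<open>finite ?S\<close> by auto
  obtain K where K: "K \<in> indeps M" "K \<subseteq> X" "card K = rank_of M X"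
    using rank_of_obtain[OF M] .
  have "\<not> card J < card K"
  proof
    assume "card J < card K"
    then obtain e where e: "e \<in> K - J" "insert e J \<in> indeps M"
      using indep_exchange[OF M] J K by blast
    then have "insert e J \<in> ?S" using J K by auto
    then have "card (insert e J) \<le> card J" using max by blast
    then show False using e indep_finite[OF M, of J] J by auto
  qed
  moreover have "card J \<le> rank_of M X" using J(1) rank_of_ge[OF M, of J X] by blast
  ultimately show ?thesis using that[of J] J(1) K(3) by auto
qed

text \<open>Grow a maximum independent subset of the intersection to one of the union and count its
  elements in each of the two sets.\<close>

lemma rank_of_submodular:
  assumes M: "is_matroid M"
  shows "rank_of M (X \<inter> Y) + rank_of M (X \<union> Y) \<le> rank_of M X + rank_of M Y"
proof -
  obtain I where I: "I \<in> indeps M" "I \<subseteq> X \<inter> Y" "card I = rank_of M (X \<inter> Y)"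
    using rank_of_obtain[OF M] .
  obtain J where J: "J \<in> indeps M" "I \<subseteq> J" "J \<subseteq> X \<union> Y" "card J = rank_of M (X \<union> Y)"
    using indep_extend[OF M I(1), of "X \<union> Y"] I(2) by auto
  have fin: "finite J" using indep_finite[OF M J(1)] .
  have "card (J \<inter> X) \<le> rank_of M X" "card (J \<inter> Y) \<le> rank_of M Y"
    by (meson M J(1) indep_subset inf_le1 inf_le2 rank_of_ge)+
  moreover have "card (J \<inter> X) + card (J \<inter> Y) = card J + card (J \<inter> X \<inter> Y)"
  proof -
    have "(J \<inter> X) \<union> (J \<inter> Y) = J" "(J \<inter> X) \<inter> (J \<inter> Y) = J \<inter> X \<inter> Y" using J(3) by auto
    then show ?thesis using card_Un_Int[of "J \<inter> X" "J \<inter> Y"] fin by simp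
  qed
  moreover have "card I \<le> card (J \<inter> X \<inter> Y)"
    using I(2) J(2) fin by (intro card_mono) auto
  ultimately show ?thesis using I(3) J(4) by linarith
qed

lemma rank_of_Un_eq:
  assumes M: "is_matroid M" and "\<And>f. f \<in> Y \<Longrightarrow> rank_of M (insert f X) = rank_of M X"
  shows "rank_of M (X \<union> Y) = rank_of M X"
proof -
  obtain I where I: "I \<in> indeps M" "I \<subseteq> X" "card I = rank_of M X"
    using rank_of_obtain[OF M] .
  obtain J where J: "J \<in> indeps M" "I \<subseteq> J" "J \<subseteq> X \<union> Y" "card J = rank_of M (X \<union> Y)"
    using indep_extend[OF M I(1), of "X \<union> Y"] I(2) by auto
  have "J \<subseteq> I"
  proof
    fix f assume f: "f \<in> J"
    show "f \<in> I"
    proof (rule ccontr)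
      assume "f \<notin> I"
      have fI: "insert f I \<in> indeps M" using indep_subset[OF M J(1)] f J(2) by blast
      have "card (insert f I) \<le> rank_of M (insert f X)"
        using rank_of_ge[OF M fI] I(2) by blast
      also have "\<dots> = rank_of M X"
        using f J(3) assms(2)[of f] by (cases "f \<in> X") (auto simp: insert_absorb)
      finally show False using \<open>f \<notin> I\<close> I indep_finite[OF M I(1)] by simp
    qed
  qed
  then show ?thesis using J I by auto
qed

lemma bases_iff:
  assumes M: "is_matroid M"
  shows "B \<in> bases M \<longleftrightarrow> B \<in> indeps M \<and> card B = rank M"
proof
  assume B: "B \<in> bases M"
  then have "B \<in> indeps M" by (simp add: bases_def)
  moreover obtain J where "J \<in> indeps M" "B \<subseteq> J" "card J = rank M"
    using indep_extend[OF M \<open>B \<in> indeps M\<close>] indep_subset_ground[OF M \<open>B \<in> indeps M\<close>]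
    unfolding rank_def by metis
  ultimately show "B \<in> indeps M \<and> card B = rank M" using B by (auto simp: bases_def)
next
  assume B: "B \<in> indeps M \<and> card B = rank M"
  show "B \<in> bases M"
    unfolding bases_def
  proof (intro CollectI conjI ballI impI)
    show "B \<in> indeps M" using B by simp
    fix I assume I: "I \<in> indeps M" "B \<subseteq> I"
    have "card I \<le> card B" using B I rank_of_ge[OF M I(1)] indep_subset_ground[OF M I(1)]
      unfolding rank_def by simp
    then show "I = B" using I indep_finite[OF M I(1)] card_seteq by blast
  qed
qed

section \<open>Isomorphism of matroids\<close>

definition relabel :: "('a \<Rightarrow> 'b) \<Rightarrow> 'a matroid \<Rightarrow> 'b matroid" where
  "relabel g M = \<lparr>ground = g ` ground M, indeps = (`) g ` indeps M\<rparr>"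

lemma relabel_sel [simp]:
  "ground (relabel g M) = g ` ground M" "indeps (relabel g M) = (`) g ` indeps M"
  by (simp_all add: relabel_def)

lemma is_matroid_relabel:
  assumes M: "is_matroid M" and g: "inj_on g (ground M)"
  shows "is_matroid (relabel g M)"
  unfolding is_matroid_def
proof (intro conjI ballI allI impI)
  show "finite (ground (relabel g M))" using matroid_finite[OF M] by simp
  show "I \<subseteq> ground (relabel g M)" if "I \<in> indeps (relabel g M)" for I
    using that indep_subset_ground[OF M] by auto
  show "{} \<in> indeps (relabel g M)" using indep_empty[OF M] by force
  show "J \<in> indeps (relabel g M)" if IJ: "I \<in> indeps (relabel g M)" "J \<subseteq> I" for I J
  proof -
    obtain I0 where I0: "I0 \<in> indeps M" "I = g ` I0" using IJ by auto
    then obtain J0 where "J0 \<subseteq> I0" "J = g ` J0" using IJ(2) by (meson subset_imageE)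
    then show ?thesis using indep_subset[OF M I0(1)] by simp
  qed
  show "\<exists>e\<in>J - I. insert e I \<in> indeps (relabel g M)"
    if IJ: "I \<in> indeps (relabel g M)" "J \<in> indeps (relabel g M)" "card I < card J" for I J
  proof -
    obtain I0 J0 where 0: "I0 \<in> indeps M" "I = g ` I0" "J0 \<in> indeps M" "J = g ` J0"
      using IJ by auto
    note sub = indep_subset_ground[OF M 0(1)] indep_subset_ground[OF M 0(3)]
    have "card I0 < card J0"
      using IJ(3) 0 card_image[OF inj_on_subset[OF g sub(1)]] card_image[OF inj_on_subset[OF g sub(2)]]
      by simp
    then obtain e where e: "e \<in> J0 - I0" "insert e I0 \<in> indeps M"
      using indep_exchange[OF M] 0 by blast
    then have "g e \<in> J - I" using 0 sub g by (auto simp: inj_on_def)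
    moreover have "insert (g e) I \<in> indeps (relabel g M)" 
      using e(2) 0(2) by (auto intro!: image_eqI[of _ _ "insert e I0"])
    ultimately show ?thesis by blast
  qed
qed

lemma isomorphic_relabel:
  assumes M: "is_matroid M" and g: "inj_on g (ground M)"
  shows "isomorphic M (relabel g M)"
  unfolding isomorphic_def
proof (intro exI[of _ g] conjI allI impI)
  show "bij_betw g (ground M) (ground (relabel g M))" using g by (simp add: bij_betw_def)
  fix X assume X: "X \<subseteq> ground M"
  show "X \<in> indeps M \<longleftrightarrow> g ` X \<in> indeps (relabel g M)"
  proof
    assume "g ` X \<in> indeps (relabel g M)"
    then obtain Y where "Y \<in> indeps M" "g ` X = g ` Y" by auto
    then show "X \<in> indeps M"
      using inj_on_image_eq_iff[OF g X] indep_subset_ground[OF M] by metis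
  qed auto
qed

lemma isomorphic_eq_relabel:
  assumes M: "is_matroid M" and L: "is_matroid L" and iso: "isomorphic M L"
  obtains g where "inj_on g (ground M)" "L = relabel g M"
proof -
  obtain g where g: "bij_betw g (ground M) (ground L)"
    and I: "\<And>X. X \<subseteq> ground M \<Longrightarrow> X \<in> indeps M \<longleftrightarrow> g ` X \<in> indeps L"
    using iso by (auto simp: isomorphic_def)
  have "indeps L = (`) g ` indeps M"
  proof (intro equalityI subsetI)
    fix Y assume Y: "Y \<in> indeps L"
    have "Y \<subseteq> g ` ground M"
      using indep_subset_ground[OF L Y] g by (simp add: bij_betw_def)
    then obtain X where X: "X \<subseteq> ground M" "Y = g ` X" by (meson subset_imageE)
    then show "Y \<in> (`) g ` indeps M" using I Y by auto
  next
    fix Y assume "Y \<in> (`) g ` indeps M"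
    then show "Y \<in> indeps L" using I indep_subset_ground[OF M] by auto
  qed
  then have "L = relabel g M" using g by (cases L) (simp add: relabel_def bij_betw_def)
  then show ?thesis using that g by (auto simp: bij_betw_def)
qed

lemma relabel_relabel: "relabel h (relabel g M) = relabel (h \<circ> g) M"
  by (simp add: relabel_def image_comp image_image)

lemma isomorphic_trans:
  assumes "is_matroid A" "is_matroid B" "is_matroid C" "isomorphic A B" "isomorphic B C"
  shows "isomorphic A C"
proof -
  obtain g where g: "inj_on g (ground A)" "B = relabel g A"
    using isomorphic_eq_relabel assms by blast
  obtain h where h: "inj_on h (ground B)" "C = relabel h B"
    using isomorphic_eq_relabel assms by blast
  have "inj_on (h \<circ> g) (ground A)" using g h by (auto intro: comp_inj_on)
  then show ?thesis
    using isomorphic_relabel[OF assms(1), of "h \<circ> g"] g h by (simp add: relabel_relabel)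
qed

lemma relabel_cong:
  assumes "is_matroid M" "\<And>x. x \<in> ground M \<Longrightarrow> g x = h x"
  shows "relabel g M = relabel h M"
proof -
  have "g ` I = h ` I" if "I \<in> indeps M" for I
    using indep_subset_ground[OF assms(1) that] assms(2) by (intro image_cong) auto
  then show ?thesis using assms(2) by (simp add: relabel_def)
qed

lemma isomorphic_sym:
  assumes A: "is_matroid A" and B: "is_matroid B" and iso: "isomorphic A B"
  shows "isomorphic B A"
proof -
  obtain g where g: "inj_on g (ground A)" "B = relabel g A"
    using isomorphic_eq_relabel assms by blast
  let ?h = "inv_into (ground A) g"
  have "relabel ?h B = relabel id A"
    unfolding g(2) relabel_relabel by (rule relabel_cong[OF A]) (simp add: g(1))
  also have "\<dots> = A" by (simp add: relabel_def)
  finally have "A = relabel ?h B" by simp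
  moreover have "inj_on ?h (ground B)" using g by (simp add: inj_on_inv_into)
  ultimately show ?thesis using isomorphic_relabel[OF B] by metis
qed

lemma rank_of_relabel:
  assumes M: "is_matroid M" and g: "inj_on g (ground M)" and X: "X \<subseteq> ground M"
  shows "rank_of (relabel g M) (g ` X) = rank_of M X"
proof (rule antisym)
  note M' = is_matroid_relabel[OF M g]
  show "rank_of (relabel g M) (g ` X) \<le> rank_of M X"
  proof (rule rank_of_le[OF M'])
    fix I assume I: "I \<in> indeps (relabel g M)" "I \<subseteq> g ` X"
    obtain J where J: "J \<in> indeps M" "I = g ` J" using I by auto
    have "J \<subseteq> X" using I(2) J indep_subset_ground[OF M J(1)] X inj_on_image_subset_iff[OF g] by metis
    then show "card I \<le> rank_of M X"
      using J rank_of_ge[OF M J(1)] indep_finite[OF M J(1)] card_image_le le_trans by metis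
  qed
  show "rank_of M X \<le> rank_of (relabel g M) (g ` X)"
  proof (rule rank_of_le[OF M])
    fix I assume I: "I \<in> indeps M" "I \<subseteq> X"
    have "card I = card (g ` I)"
      using card_image[OF inj_on_subset[OF g indep_subset_ground[OF M I(1)]]] by simp
    also have "\<dots> \<le> rank_of (relabel g M) (g ` X)" using I by (intro rank_of_ge[OF M']) auto
    finally show "card I \<le> rank_of (relabel g M) (g ` X)" .
  qed
qed

lemma rank_relabel:
  assumes "is_matroid M" "inj_on g (ground M)"
  shows "rank (relabel g M) = rank M"
  using rank_of_relabel[OF assms order_refl] by (simp add: rank_def)

lemma bases_relabel:
  assumes "is_matroid M" "inj_on g (ground M)"
  shows "bases (relabel g M) = (`) g ` bases M"
proof -
  have "card (g ` I) = card I" if "I \<in> indeps M" for I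
    using card_image[OF inj_on_subset[OF assms(2) indep_subset_ground[OF assms(1) that]]] .
  then show ?thesis
    by (auto simp: bases_iff[OF is_matroid_relabel[OF assms]] bases_iff[OF assms(1)]
        rank_relabel[OF assms])
qed

lemma labelled_copy:
  assumes M: "is_matroid M"
  shows "is_matroid (labelled_copy M)" "ground (labelled_copy M) = {1..card (ground M)}"
    "isomorphic M (labelled_copy M)"
proof -
  obtain g where g: "bij_betw g (ground M) {1..card (ground M)}"
    using ex_bij_betw_finite_nat[OF matroid_finite[OF M]]
    by (metis One_nat_def atLeastLessThanSuc_atLeastAtMost bij_betw_iff_card card_atLeastAtMost
        diff_Suc_1 finite_atLeastAtMost matroid_finite[OF M])
  then have "\<exists>L. is_matroid L \<and> ground L = {1..card (ground M)} \<and> isomorphic M L"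
    using is_matroid_relabel[OF M] isomorphic_relabel[OF M]
    by (intro exI[of _ "relabel g M"]) (auto simp: bij_betw_def)
  from someI_ex[OF this] show "is_matroid (labelled_copy M)"
    "ground (labelled_copy M) = {1..card (ground M)}" "isomorphic M (labelled_copy M)"
    by (simp_all add: labelled_copy_def)
qed

lemma isomorphic_rank_card:
  assumes "is_matroid M" "is_matroid L" "isomorphic M L"
  shows "rank L = rank M" "card (ground L) = card (ground M)"
proof -
  obtain g where g: "inj_on g (ground M)" "L = relabel g M"
    using isomorphic_eq_relabel assms by blast
  show "rank L = rank M" using rank_relabel[OF assms(1)] g by simp
  show "card (ground L) = card (ground M)" using g by (simp add: card_image)
qed

section \<open>Free products\<close>

lemma free_product_sel:
  "ground (free_product M M') = ground M \<union> ground M'"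
  "indeps (free_product M M') = {I \<union> J |I J. I \<in> indeps M \<and> J \<subseteq> ground M' \<and>
                            card (I \<union> J) \<le> rank M + rank_of M' J}"
  by (simp_all add: free_product_def)

context
  fixes M M' :: "'a matroid"
  assumes M: "is_matroid M" and M': "is_matroid M'" and dis: "ground M \<inter> ground M' = {}"
begin

lemma free_product_indep_iff:
  "K \<in> indeps (free_product M M') \<longleftrightarrow>
     K \<subseteq> ground M \<union> ground M' \<and> K \<inter> ground M \<in> indeps M \<and>
     card (K \<inter> ground M) + card (K \<inter> ground M') \<le> rank M + rank_of M' (K \<inter> ground M')"
  (is "?L \<longleftrightarrow> ?R")
proof
  assume ?L
  then obtain I J where IJ: "K = I \<union> J" "I \<in> indeps M" "J \<subseteq> ground M'"
    "card (I \<union> J) \<le> rank M + rank_of M' J" by (auto simp: free_product_sel)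
  have I: "I \<subseteq> ground M" using indep_subset_ground[OF M IJ(2)] .
  then have eq: "K \<inter> ground M = I" "K \<inter> ground M' = J" using IJ dis by auto
  have "card (I \<union> J) = card I + card J"
    using I IJ(3) dis matroid_finite[OF M] matroid_finite[OF M']
    by (intro card_Un_disjoint) (auto intro: finite_subset)
  then show ?R using IJ I eq by auto
next
  assume R: ?R
  let ?I = "K \<inter> ground M" and ?J = "K \<inter> ground M'"
  have "card (?I \<union> ?J) = card ?I + card ?J"
    using dis matroid_finite[OF M] matroid_finite[OF M'] by (intro card_Un_disjoint) auto
  moreover have "K = ?I \<union> ?J" using R by auto
  ultimately show ?L
    unfolding free_product_sel using R
    by (intro CollectI exI[of _ ?I] exI[of _ ?J] conjI) (assumption | simp)+
qed

lemma card_split: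
  assumes "K \<subseteq> ground M \<union> ground M'"
  shows "card K = card (K \<inter> ground M) + card (K \<inter> ground M')"
proof -
  have "K = (K \<inter> ground M) \<union> (K \<inter> ground M')" using assms by auto
  then show ?thesis
    using dis matroid_finite[OF M] matroid_finite[OF M']
    by (metis (no_types, lifting) card_Un_disjoint finite_Int inf_assoc inf_bot_right inf_commute)
qed

lemma free_product_indep_bound:
  assumes "K \<in> indeps (free_product M M')" "K \<subseteq> Z"
  shows "card K \<le> min (rank_of M (Z \<inter> ground M) + card (Z \<inter> ground M'))
                       (rank M + rank_of M' (Z \<inter> ground M'))"
proof -
  note K = assms(1)[unfolded free_product_indep_iff]
  have "card (K \<inter> ground M) \<le> rank_of M (Z \<inter> ground M)"
    using K assms(2) by (intro rank_of_ge[OF M]) auto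
  moreover have "card (K \<inter> ground M') \<le> card (Z \<inter> ground M')"
    using assms(2) matroid_finite[OF M'] by (intro card_mono) auto
  moreover have "rank_of M' (K \<inter> ground M') \<le> rank_of M' (Z \<inter> ground M')"
    using assms(2) by (intro rank_of_mono[OF M']) auto
  ultimately show ?thesis using K card_split[of K] by simp
qed

text \<open>A maximal independent subset of a set \<open>Z\<close> attains one of the two upper bounds: either the
  cardinality constraint has slack, and then neither part of \<open>Z\<close> leaves room for another element,
  or it is tight, and then the second part already spans.\<close>

lemma free_product_maximal:
  assumes K: "K \<in> indeps (free_product M M')" "K \<subseteq> Z" and Z: "Z \<subseteq> ground M \<union> ground M'"
    and max: "\<And>e. e \<in> Z - K \<Longrightarrow> insert e K \<notin> indeps (free_product M M')"
  shows "card K = min (rank_of M (Z \<inter> ground M) + card (Z \<inter> ground M'))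
                       (rank M + rank_of M' (Z \<inter> ground M'))"
proof -
  let ?E = "ground M" and ?E' = "ground M'"
  note Ki = K(1)[unfolded free_product_indep_iff]
  note bound = free_product_indep_bound[OF K]
  note cK = card_split[of K, OF conjunct1[OF Ki]]
  note fin = matroid_finite[OF M] matroid_finite[OF M']
  have ins: "insert e K \<inter> ?E = insert e (K \<inter> ?E)" "insert e K \<inter> ?E' = K \<inter> ?E'" if "e \<in> ?E" for e
    using that dis by auto
  have ins': "insert e K \<inter> ?E = K \<inter> ?E" "insert e K \<inter> ?E' = insert e (K \<inter> ?E')" if "e \<in> ?E'" for e
    using that dis by auto
  show ?thesis
  proof (cases "card K < rank M + rank_of M' (K \<inter> ?E')")
    case True
    have "card (K \<inter> ?E) = rank_of M (Z \<inter> ?E)"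
    proof -
      obtain J where J: "J \<in> indeps M" "K \<inter> ?E \<subseteq> J" "J \<subseteq> Z \<inter> ?E" "card J = rank_of M (Z \<inter> ?E)"
        using indep_extend[OF M, of "K \<inter> ?E" "Z \<inter> ?E"] Ki K(2) by blast
      have "J \<subseteq> K \<inter> ?E"
      proof (rule ccontr)
        assume "\<not> J \<subseteq> K \<inter> ?E"
        then obtain e where e: "e \<in> J" "e \<notin> K \<inter> ?E" by auto
        then have eE: "e \<in> ?E" "e \<in> Z - K" using J by auto
        have "insert e (K \<inter> ?E) \<in> indeps M" using e J indep_subset[OF M J(1)] by blast
        then have "insert e K \<in> indeps (free_product M M')"
          unfolding free_product_indep_iff using ins[OF eE(1)] Ki eE True cK e fin
          by auto
        then show False using max eE by blast
      qed
      then have "J = K \<inter> ?E" using J(2) by blast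
      then show ?thesis using J(4) by simp
    qed
    moreover have "Z \<inter> ?E' \<subseteq> K"
    proof
      fix e assume e: "e \<in> Z \<inter> ?E'"
      show "e \<in> K"
      proof (rule ccontr)
        assume "e \<notin> K"
        moreover have "rank_of M' (K \<inter> ?E') \<le> rank_of M' (insert e (K \<inter> ?E'))"
          by (rule rank_of_mono[OF M']) auto
        ultimately have "insert e K \<in> indeps (free_product M M')"
          unfolding free_product_indep_iff using ins'[of e] Ki e True cK fin by auto
        then show False using max e \<open>e \<notin> K\<close> by blast
      qed
    qed
    then have "Z \<inter> ?E' = K \<inter> ?E'" using K(2) by auto
    ultimately show ?thesis using bound cK by simp
  next
    case False
    have "rank_of M' (K \<inter> ?E' \<union> Z \<inter> ?E') = rank_of M' (K \<inter> ?E')"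
    proof (rule rank_of_Un_eq[OF M'], rule ccontr)
      fix f assume f: "f \<in> Z \<inter> ?E'"
        and ne: "rank_of M' (insert f (K \<inter> ?E')) \<noteq> rank_of M' (K \<inter> ?E')"
      have fK: "f \<notin> K" using ne f by (auto simp: insert_absorb)
      have "rank_of M' (K \<inter> ?E') \<le> rank_of M' (insert f (K \<inter> ?E'))"
        by (rule rank_of_mono[OF M']) auto
      then have "insert f K \<in> indeps (free_product M M')"
        unfolding free_product_indep_iff using ins'[of f] Ki f ne fin fK by auto
      then show False using max f fK by blast
    qed
    moreover have "K \<inter> ?E' \<union> Z \<inter> ?E' = Z \<inter> ?E'" using K(2) by auto
    ultimately show ?thesis using False bound by simp
  qed
qed

lemma is_matroid_free_product: "is_matroid (free_product M M')"
  unfolding is_matroid_def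
proof (intro conjI ballI allI impI)
  note fin = matroid_finite[OF M] matroid_finite[OF M']
  show "finite (ground (free_product M M'))" using fin by (simp add: free_product_sel)
  show "I \<subseteq> ground (free_product M M')" if "I \<in> indeps (free_product M M')" for I
    using that free_product_indep_iff by (simp add: free_product_sel(1))
  show "{} \<in> indeps (free_product M M')" using indep_empty[OF M] by (simp add: free_product_indep_iff)
  show "L \<in> indeps (free_product M M')" if K: "K \<in> indeps (free_product M M')" "L \<subseteq> K" for K L
  proof -
    note Ki = K(1)[unfolded free_product_indep_iff]
    have "L \<inter> ground M \<in> indeps M" using indep_subset[OF M] Ki K(2) by blast
    moreover have "card (L \<inter> ground M) \<le> card (K \<inter> ground M)"
      using K(2) fin by (intro card_mono) auto
    moreover have "card (L \<inter> ground M') + rank_of M' (K \<inter> ground M')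
        \<le> card (K \<inter> ground M') + rank_of M' (L \<inter> ground M')"
    proof -
      have eq: "K \<inter> ground M' = (L \<inter> ground M') \<union> ((K - L) \<inter> ground M')" using K(2) by auto
      have "rank_of M' (K \<inter> ground M') \<le> rank_of M' (L \<inter> ground M') + rank_of M' ((K - L) \<inter> ground M')"
        using rank_of_submodular[OF M', of "L \<inter> ground M'" "(K - L) \<inter> ground M'"] eq by simp
      also have "\<dots> \<le> rank_of M' (L \<inter> ground M') + card ((K - L) \<inter> ground M')"
        using rank_of_le_card[OF M', of "(K - L) \<inter> ground M'"] fin by simp
      finally have "rank_of M' (K \<inter> ground M') \<le> rank_of M' (L \<inter> ground M') + card ((K - L) \<inter> ground M')" .
      moreover have "card (K \<inter> ground M') = card (L \<inter> ground M') + card ((K - L) \<inter> ground M')"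
        by (subst eq, rule card_Un_disjoint) (use fin in auto)
      ultimately show ?thesis by simp
    qed
    ultimately show ?thesis unfolding free_product_indep_iff using Ki K(2) by auto
  qed
  show "\<exists>e\<in>L - K. insert e K \<in> indeps (free_product M M')"
    if KL: "K \<in> indeps (free_product M M')" "L \<in> indeps (free_product M M')" "card K < card L" for K L
  proof (rule ccontr)
    assume no: "\<not> ?thesis"
    have "K \<union> L \<subseteq> ground M \<union> ground M'"
      using KL(1,2) unfolding free_product_indep_iff by simp
    moreover have "insert e K \<notin> indeps (free_product M M')" if "e \<in> (K \<union> L) - K" for e
      using no that by blast
    ultimately have "card K = min (rank_of M ((K \<union> L) \<inter> ground M) + card ((K \<union> L) \<inter> ground M'))
        (rank M + rank_of M' ((K \<union> L) \<inter> ground M'))"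
      using free_product_maximal[OF KL(1) Un_upper1] by metis
    then have "card L \<le> card K"
      using free_product_indep_bound[OF KL(2), of "K \<union> L"] by simp
    then show False using KL by simp
  qed
qed

lemma rank_of_free_product:
  assumes Z: "Z \<subseteq> ground M \<union> ground M'"
  shows "rank_of (free_product M M') Z =
    min (rank_of M (Z \<inter> ground M) + card (Z \<inter> ground M')) (rank M + rank_of M' (Z \<inter> ground M'))"
proof -
  note P = is_matroid_free_product
  obtain K where K: "K \<in> indeps (free_product M M')" "K \<subseteq> Z" "card K = rank_of (free_product M M') Z"
    using rank_of_obtain[OF P] .
  have "insert e K \<notin> indeps (free_product M M')" if "e \<in> Z - K" for e
  proof
    assume i: "insert e K \<in> indeps (free_product M M')"
    have "card (insert e K) \<le> card K" using rank_of_ge[OF P i, of Z] K that by auto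
    then show False using that indep_finite[OF P K(1)] by simp
  qed
  then show ?thesis using free_product_maximal[OF K(1,2) Z] K(3) by simp
qed

lemma rank_free_product: "rank (free_product M M') = rank M + rank M'"
proof -
  have "ground (free_product M M') \<inter> ground M = ground M"
    "ground (free_product M M') \<inter> ground M' = ground M'"
    by (auto simp: free_product_sel)
  then show ?thesis
    using rank_of_free_product[of "ground (free_product M M')"]
      rank_of_le_card[OF M' matroid_finite[OF M']]
    unfolding rank_def by (simp add: free_product_sel(1))
qed

lemma card_free_product: "card (ground (free_product M M')) = card (ground M) + card (ground M')"
  using card_Un_disjoint[OF matroid_finite[OF M] matroid_finite[OF M'] dis]
  by (simp add: free_product_sel)

end

section \<open>Chain matroids\<close>

text \<open>A nested matroid is determined by upper bounds on the members of a chain of sets. The bounds are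
  arbitrary numbers, so that the Schubert matroids and the matroids obtained from a chain in
  another matroid are both instances.\<close>

definition chain_matroid :: "'a set \<Rightarrow> 'a set set \<Rightarrow> ('a set \<Rightarrow> nat) \<Rightarrow> 'a matroid" where
  "chain_matroid E \<C> f =
     \<lparr>ground = E, indeps = {I. I \<subseteq> E \<and> (\<forall>Z\<in>\<C>. card (I \<inter> Z) \<le> f Z)}\<rparr>"

lemma chain_matroid_sel [simp]:
  "ground (chain_matroid E \<C> f) = E"
  "indeps (chain_matroid E \<C> f) = {I. I \<subseteq> E \<and> (\<forall>Z\<in>\<C>. card (I \<inter> Z) \<le> f Z)}"
  by (simp_all add: chain_matroid_def)

lemma finite_chain_maximal:
  assumes "finite \<S>" "\<S> \<noteq> {}" "chain\<^sub>\<subseteq> \<S>"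
  shows "\<Union>\<S> \<in> \<S>"
  using assms
proof (induction rule: finite_ne_induct)
  case (insert Z \<S>)
  then have "chain\<^sub>\<subseteq> \<S>" by (auto simp: chain_subset_def)
  then have "\<Union>\<S> \<in> \<S>" using insert.IH by simp
  then have "Z \<subseteq> \<Union>\<S> \<or> \<Union>\<S> \<subseteq> Z" using insert.prems by (auto simp: chain_subset_def)
  then show ?case using \<open>\<Union>\<S> \<in> \<S>\<close>
    by (metis Union_insert insertCI sup.absorb1 sup.absorb2)
qed auto

context
  fixes E :: "'a set" and \<C> :: "'a set set" and f :: "'a set \<Rightarrow> nat"
  assumes finE: "finite E" and CE: "\<C> \<subseteq> Pow E" and chain: "chain\<^sub>\<subseteq> \<C>"
begin

text \<open>For the exchange property, let \<open>Z\<close> be the largest set of the chain whose bound is attained by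
  the smaller set \<open>I\<close>. Outside \<open>Z\<close> the larger set \<open>J\<close> still has more elements than \<open>I\<close>, and adding
  any of them only affects bounds with slack.\<close>

lemma is_matroid_chain_matroid: "is_matroid (chain_matroid E \<C> f)"
  unfolding is_matroid_def
proof (intro conjI ballI allI impI)
  show "finite (ground (chain_matroid E \<C> f))" using finE by simp
  show "{} \<in> indeps (chain_matroid E \<C> f)" by simp
  show "I \<subseteq> ground (chain_matroid E \<C> f)" if "I \<in> indeps (chain_matroid E \<C> f)" for I
    using that by simp
  show "J \<in> indeps (chain_matroid E \<C> f)" if "I \<in> indeps (chain_matroid E \<C> f)" "J \<subseteq> I" for I J
  proof -
    have "card (J \<inter> Z) \<le> card (I \<inter> Z)" for Z
      using that finE finite_subset[of I E] by (intro card_mono) auto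
    then show ?thesis
      using that unfolding chain_matroid_sel by (blast intro: order_trans)
  qed
  show "\<exists>e\<in>J - I. insert e I \<in> indeps (chain_matroid E \<C> f)"
    if I: "I \<in> indeps (chain_matroid E \<C> f)" and J: "J \<in> indeps (chain_matroid E \<C> f)"
      and less: "card I < card J" for I J
  proof -
    have fin: "finite I" "finite J" using I J finE finite_subset by auto
    let ?T = "{Z \<in> \<C>. card (I \<inter> Z) = f Z}"
    have "finite ?T" by (rule finite_subset[of _ "Pow E"]) (use CE finE in auto)
    moreover have "chain\<^sub>\<subseteq> ?T" using chain by (auto simp: chain_subset_def)
    ultimately have T: "?T \<noteq> {} \<Longrightarrow> \<Union>?T \<in> ?T"
      using finite_chain_maximal by (metis (no_types, lifting))
    have "card (J \<inter> \<Union>?T) \<le> card (I \<inter> \<Union>?T)"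
    proof (cases "?T = {}")
      case False
      then show ?thesis using T J by fastforce
    next
      case True
      then show ?thesis by (simp only: True Union_empty) simp
    qed
    moreover have "card I = card (I \<inter> \<Union>?T) + card (I - \<Union>?T)"
      "card J = card (J \<inter> \<Union>?T) + card (J - \<Union>?T)"
      using card_Int_Diff fin by blast+
    ultimately have "card (I - \<Union>?T) < card (J - \<Union>?T)" using less by linarith
    then obtain e where e: "e \<in> J - \<Union>?T" "e \<notin> I - \<Union>?T"
      using fin by (meson card_mono finite_Diff leD subsetI)
    have "insert e I \<in> indeps (chain_matroid E \<C> f)"
      unfolding chain_matroid_sel
    proof (intro CollectI conjI ballI)
      show "insert e I \<subseteq> E" using e I J by auto
      fix Z assume Z: "Z \<in> \<C>"
      show "card (insert e I \<inter> Z) \<le> f Z"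
      proof (cases "e \<in> Z")
        case True
        then have "card (I \<inter> Z) \<noteq> f Z" using e Z by auto
        then have "card (I \<inter> Z) < f Z" using I Z by (simp add: order_less_le)
        then show ?thesis using True e fin by auto
      qed (use I Z in auto)
    qed
    then show ?thesis using e by auto
  qed
qed

text \<open>A circuit lies in a member \<open>Z\<close> of the chain and has one element more than the bound of \<open>Z\<close>
  allows, so each of its bases spans \<open>Z\<close> and a flat containing the circuit contains \<open>Z\<close>. A cyclic
  flat is therefore a union of members of the chain, that is empty or itself a member.\<close>

lemma chain_matroid_circuit_in_flat:
  assumes C: "C \<in> circuits (chain_matroid E \<C> f)"
    and F: "F \<in> flats (chain_matroid E \<C> f)" "C \<subseteq> F"
  obtains Z where "Z \<in> \<C>" "C \<subseteq> Z" "Z \<subseteq> F"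
proof -
  let ?M = "chain_matroid E \<C> f"
  note M = is_matroid_chain_matroid
  have CE': "C \<subseteq> E" "C \<notin> indeps ?M" and sub: "\<And>D. D \<subset> C \<Longrightarrow> D \<in> indeps ?M"
    using C by (auto simp: circuits_def)
  have finC: "finite C" using CE' finE finite_subset by auto
  obtain Z where Z: "Z \<in> \<C>" "f Z < card (C \<inter> Z)" using CE' by (auto simp: not_le)
  have CZ: "C \<subseteq> Z"
  proof (rule ccontr)
    assume "\<not> C \<subseteq> Z"
    then have "C \<inter> Z \<in> indeps ?M" using sub[of "C \<inter> Z"] by auto
    then have "card (C \<inter> Z \<inter> Z) \<le> f Z" using Z(1) by auto
    then show False using Z(2) by (simp add: Int_assoc)
  qed
  then have cC: "f Z < card C" using Z(2) by (simp add: Int_absorb2)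
  have "Z \<subseteq> F"
  proof
    fix g assume g: "g \<in> Z"
    show "g \<in> F"
    proof (rule ccontr)
      assume gF: "g \<notin> F"
      obtain c where c: "c \<in> C" using cC by fastforce
      have I0: "C - {c} \<in> indeps ?M" "C - {c} \<subseteq> F" using sub[of "C - {c}"] c F by auto
      obtain I where I: "I \<in> indeps ?M" "C - {c} \<subseteq> I" "I \<subseteq> F" "card I = rank_of ?M F"
        using indep_extend[OF M I0] .
      have "g \<in> E" using g Z CE by auto
      then have "card I < rank_of ?M (insert g F)"
        using F(1) gF I(4) by (auto simp: flats_def)
      then obtain J where J: "J \<in> indeps ?M" "J \<subseteq> insert g F" "card J = rank_of ?M (insert g F)"
        using rank_of_obtain[OF M] by metis
      then obtain h where h: "h \<in> J - I" "insert h I \<in> indeps ?M"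
        using indep_exchange[OF M I(1) J(1)] \<open>card I < rank_of ?M (insert g F)\<close> by auto
      have "h = g"
      proof (rule ccontr)
        assume "h \<noteq> g"
        then have "insert h I \<subseteq> F" using h J I by auto
        then have "card (insert h I) \<le> card I" using rank_of_ge[OF M h(2)] I(4) by simp
        then show False using h indep_finite[OF M I(1)] by simp
      qed
      then have "insert g (C - {c}) \<in> indeps ?M"
        using indep_subset[OF M h(2), of "insert g (C - {c})"] I(2) by blast
      then have "card (insert g (C - {c}) \<inter> Z) \<le> f Z" using Z(1) by auto
      moreover have "insert g (C - {c}) \<inter> Z = insert g (C - {c})" using g CZ by auto
      moreover have "card (insert g (C - {c})) = card C"
        using gF F(2) c finC by (metis Diff_iff card.remove card_insert_disjoint finite_Diff subset_iff)
      ultimately show False using cC by simp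
    qed
  qed
  then show ?thesis using that Z CZ by blast
qed

lemma nested_chain_matroid: "nested (chain_matroid E \<C> f)"
proof -
  let ?M = "chain_matroid E \<C> f"
  have cf: "F \<in> insert {} \<C>" if F: "F \<in> cyclic_flats ?M" for F
  proof -
    obtain \<D> where D: "F \<in> flats ?M" "\<D> \<subseteq> circuits ?M" "F = \<Union>\<D>"
      using F unfolding cyclic_flats_def by blast
    let ?Z = "{Z \<in> \<C>. Z \<subseteq> F}"
    have "F \<subseteq> \<Union>?Z"
    proof
      fix x assume "x \<in> F"
      then obtain C where C: "C \<in> \<D>" "x \<in> C" using D by auto
      then obtain Z where "Z \<in> \<C>" "C \<subseteq> Z" "Z \<subseteq> F"
        using chain_matroid_circuit_in_flat[of C F] D by blast
      then show "x \<in> \<Union>?Z" using C by auto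
    qed
    then have F: "F = \<Union>?Z" by auto
    have "finite ?Z" by (rule finite_subset[of _ "Pow E"]) (use CE finE in auto)
    moreover have "chain\<^sub>\<subseteq> ?Z" using chain by (auto simp: chain_subset_def)
    ultimately have "?Z \<noteq> {} \<Longrightarrow> \<Union>?Z \<in> ?Z"
      using finite_chain_maximal by (metis (no_types, lifting))
    then show ?thesis using F by (cases "?Z = {}") auto
  qed
  show ?thesis
    unfolding nested_def
  proof (intro ballI)
    fix F G assume "F \<in> cyclic_flats ?M" "G \<in> cyclic_flats ?M"
    then have "F \<in> insert {} \<C>" "G \<in> insert {} \<C>" using cf by auto
    then show "F \<subseteq> G \<or> G \<subseteq> F" using chain by (auto simp: chain_subset_def)
  qed
qed

lemma rank_chain_matroid_le:
  assumes "E \<in> \<C>"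
  shows "rank (chain_matroid E \<C> f) \<le> f E"
  unfolding rank_def
proof (rule rank_of_le[OF is_matroid_chain_matroid])
  fix I assume "I \<in> indeps (chain_matroid E \<C> f)"
  then have "card (I \<inter> E) \<le> f E" "I \<subseteq> E" using assms by auto
  then show "card I \<le> f E" by (simp add: Int_absorb2)
qed

end

section \<open>Schubert matroids\<close>

text \<open>The set \<open>A \<subseteq> E\<close> encodes a word in two letters, one for each element of \<open>E\<close> in increasing order;
  the rank of an initial segment counts the occurrences of the first letter.\<close>

definition schubert :: "nat set \<Rightarrow> nat set \<Rightarrow> nat matroid" where
  "schubert E A = chain_matroid E (range (\<lambda>j. E \<inter> {..j})) (\<lambda>Z. card (A \<inter> Z))"

lemma schubert_ground [simp]: "ground (schubert E A) = E"
  by (simp add: schubert_def)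

lemma schubert_indeps:
  assumes "A \<subseteq> E"
  shows "I \<in> indeps (schubert E A) \<longleftrightarrow> I \<subseteq> E \<and> (\<forall>j. card (I \<inter> {..j}) \<le> card (A \<inter> {..j}))"
proof -
  have "I \<inter> (E \<inter> {..j}) = I \<inter> {..j}" if "I \<subseteq> E" for I j using that by auto
  then show ?thesis using assms by (auto simp: schubert_def)
qed

lemma schubert_chain: "chain\<^sub>\<subseteq> (range (\<lambda>j::nat. E \<inter> {..j}))"
proof -
  have "E \<inter> {..i} \<subseteq> E \<inter> {..j} \<or> E \<inter> {..j} \<subseteq> E \<inter> {..i}" for i j :: nat
    by (cases "i \<le> j") auto
  then show ?thesis unfolding chain_subset_def by blast
qed

lemma is_matroid_schubert: "finite E \<Longrightarrow> is_matroid (schubert E A)"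
  unfolding schubert_def by (rule is_matroid_chain_matroid[OF _ _ schubert_chain]) auto

lemma nested_schubert: "finite E \<Longrightarrow> nested (schubert E A)"
  unfolding schubert_def by (rule nested_chain_matroid[OF _ _ schubert_chain]) auto

lemma rank_of_schubert_initial:
  assumes "finite E" "A \<subseteq> E"
  shows "rank_of (schubert E A) (E \<inter> {..j}) = card (A \<inter> {..j})"
proof (rule antisym)
  note M = is_matroid_schubert[OF assms(1), of A]
  show "rank_of (schubert E A) (E \<inter> {..j}) \<le> card (A \<inter> {..j})"
  proof (rule rank_of_le[OF M])
    fix I assume I: "I \<in> indeps (schubert E A)" "I \<subseteq> E \<inter> {..j}"
    then have "card (I \<inter> {..j}) \<le> card (A \<inter> {..j})" "I \<inter> {..j} = I"
      using schubert_indeps[OF assms(2)] by auto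
    then show "card I \<le> card (A \<inter> {..j})" by simp
  qed
  have "card (A \<inter> {..j} \<inter> {..i}) \<le> card (A \<inter> {..i})" for i
    using assms finite_subset by (intro card_mono) auto
  then show "card (A \<inter> {..j}) \<le> rank_of (schubert E A) (E \<inter> {..j})"
    using assms by (intro rank_of_ge[OF M]) (auto simp: schubert_indeps)
qed

lemma rank_schubert:
  assumes "finite E" "A \<subseteq> E"
  shows "rank (schubert E A) = card A"
proof -
  obtain j where "E \<subseteq> {..j}" using assms(1) finite_nat_set_iff_bounded_le by auto
  then have "E \<inter> {..j} = E" "A \<inter> {..j} = A" using assms by auto
  then show ?thesis using rank_of_schubert_initial[OF assms, of j] by (simp add: rank_def)
qed

text \<open>Initial segments have the smallest rank among the sets of their size: the elements of a
  \<open>j\<close>-element set dominate \<open>1, \<dots>, j\<close>, and the ones in the positions of \<open>A\<close> are independent.\<close>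

lemma schubert_indep_of_size:
  fixes X :: "nat set"
  assumes "finite X" "X \<subseteq> {1..}" "finite A"
  shows "\<exists>I\<subseteq>X. card I = card (A \<inter> {1..card X}) \<and> (\<forall>i. card (I \<inter> {..i}) \<le> card (A \<inter> {..i}))"
  using assms
proof (induction "card X" arbitrary: X)
  case 0
  then show ?case by auto
next
  case (Suc j)
  let ?m = "Max X"
  have ne: "X \<noteq> {}" using Suc by auto
  then have m: "?m \<in> X" using Suc by simp
  then have cX: "card (X - {?m}) = j" using Suc by simp
  obtain I where I: "I \<subseteq> X - {?m}" "card I = card (A \<inter> {1..j})"
    "\<And>i. card (I \<inter> {..i}) \<le> card (A \<inter> {..i})"
  proof -
    have "finite (X - {?m})" "X - {?m} \<subseteq> {1..}" using Suc.prems by auto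
    from Suc.hyps(1)[OF cX[symmetric] this Suc.prems(3)] show ?thesis
      using that unfolding cX by blast
  qed
  have finI: "finite I" using finite_subset[OF I(1)] Suc.prems(1) by blast
  have eq: "A \<inter> {1..Suc j} = (if Suc j \<in> A then insert (Suc j) (A \<inter> {1..j}) else A \<inter> {1..j})"
    by (auto simp: le_Suc_eq)
  show ?case
  proof (cases "Suc j \<in> A")
    case False
    then have "card I = card (A \<inter> {1..card X})" using I(2) eq Suc.hyps(2) by simp
    then show ?thesis using I(1,3) by blast
  next
    case True
    have c: "card (insert ?m I) = card (A \<inter> {1..Suc j})"
      using True eq I finI \<open>finite A\<close> by (auto simp: card_insert_if)
    have "X \<subseteq> {1..?m}" using Suc by auto
    then have "Suc j \<le> ?m" using card_mono[of "{1..?m}" X] Suc(2) by simp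
    have "card (insert ?m I \<inter> {..i}) \<le> card (A \<inter> {..i})" for i
    proof (cases "?m \<le> i")
      case True
      have "card (insert ?m I \<inter> {..i}) \<le> card (insert ?m I)" using finI by (intro card_mono) auto
      also have "\<dots> \<le> card (A \<inter> {..i})"
        unfolding c using True \<open>Suc j \<le> ?m\<close> \<open>finite A\<close> by (intro card_mono) auto
      finally show ?thesis .
    next
      case False
      then show ?thesis using I(3)[of i] by simp
    qed
    moreover have "insert ?m I \<subseteq> X" using I(1) m by auto
    ultimately show ?thesis using c Suc.hyps(2) by metis
  qed
qed

lemma rank_of_schubert_ge:
  assumes "A \<subseteq> {1..n}" "X \<subseteq> {1..n}"
  shows "card (A \<inter> {1..card X}) \<le> rank_of (schubert {1..n} A) X"
proof -
  have "finite X" "finite A" using assms finite_subset by blast+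
  then obtain I where I: "I \<subseteq> X" "card I = card (A \<inter> {1..card X})"
    "\<And>i. card (I \<inter> {..i}) \<le> card (A \<inter> {..i})"
    using schubert_indep_of_size[of X A] assms(2) by fastforce
  then have "I \<in> indeps (schubert {1..n} A)" using assms by (auto simp: schubert_indeps)
  then show ?thesis
    using rank_of_ge[OF is_matroid_schubert, of "{1..n}" I A X] I by simp
qed

text \<open>If the bounds on the right hold, then an independent set is left after the removal of the \<open>m\<close>
  smallest elements of \<open>J\<close>.\<close>

lemma schubert_card_le_rank_iff:
  assumes E: "finite E" and A: "A \<subseteq> E" and J: "J \<subseteq> E"
  shows "card J \<le> m + rank_of (schubert E A) J \<longleftrightarrow> (\<forall>j. card (J \<inter> {..j}) \<le> m + card (A \<inter> {..j}))"
proof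
  note M = is_matroid_schubert[OF E, of A]
  have finJ: "finite J" using E J finite_subset by auto
  assume le: "card J \<le> m + rank_of (schubert E A) J"
  obtain I where I: "I \<in> indeps (schubert E A)" "I \<subseteq> J" "card I = rank_of (schubert E A) J"
    using rank_of_obtain[OF M] .
  have finI: "finite I" using I(2) finJ finite_subset by auto
  show "\<forall>j. card (J \<inter> {..j}) \<le> m + card (A \<inter> {..j})"
  proof
    fix j
    have "J \<inter> {..j} \<subseteq> (J - I) \<union> (I \<inter> {..j})" by auto
    then have "card (J \<inter> {..j}) \<le> card ((J - I) \<union> (I \<inter> {..j}))"
      using finJ finI by (intro card_mono) auto
    also have "\<dots> \<le> card (J - I) + card (I \<inter> {..j})" by (rule card_Un_le)
    also have "card (J - I) \<le> m" using le I finI by (simp add: card_Diff_subset)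
    also have "card (I \<inter> {..j}) \<le> card (A \<inter> {..j})" using I(1) A by (simp add: schubert_indeps)
    finally show "card (J \<inter> {..j}) \<le> m + card (A \<inter> {..j})" by simp
  qed
next
  note M = is_matroid_schubert[OF E, of A]
  show "card J \<le> m + rank_of (schubert E A) J"
    if "\<forall>j. card (J \<inter> {..j}) \<le> m + card (A \<inter> {..j})"
    using that J
  proof (induction m arbitrary: J)
    case 0
    then have "J \<in> indeps (schubert E A)" using A by (simp add: schubert_indeps)
    then show ?case using rank_of_indep[OF M] by simp
  next
    case (Suc m)
    show ?case
    proof (cases "J = {}")
      case False
      have finJ: "finite J" using E Suc finite_subset by auto
      let ?e = "Min J"
      have e: "?e \<in> J" using False finJ by simp
      have "card ((J - {?e}) \<inter> {..j}) \<le> m + card (A \<inter> {..j})" for j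
      proof (cases "?e \<le> j")
        case True
        then have "(J - {?e}) \<inter> {..j} = (J \<inter> {..j}) - {?e}" "?e \<in> J \<inter> {..j}" using e by auto
        then have "card ((J - {?e}) \<inter> {..j}) = card (J \<inter> {..j}) - 1"
          using finJ by (simp add: card_Diff_singleton)
        moreover have "card (J \<inter> {..j}) \<le> Suc m + card (A \<inter> {..j})" using Suc.prems by blast
        ultimately show ?thesis by simp
      next
        case False
        then have "J \<inter> {..j} = {}" using Min_le[OF finJ] by fastforce
        then have "(J - {?e}) \<inter> {..j} = {}" by blast
        then show ?thesis by simp
      qed
      then have "card (J - {?e}) \<le> m + rank_of (schubert E A) (J - {?e})"
        using Suc by (intro Suc.IH) auto
      also have "rank_of (schubert E A) (J - {?e}) \<le> rank_of (schubert E A) J"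
        by (intro rank_of_mono[OF M]) auto
      finally show ?thesis using e finJ by (simp add: card_Diff_singleton)
    qed simp
  qed
qed

text \<open>A subset \<open>J\<close> of the second part can be added to an independent set \<open>I\<close> of the first part exactly if
  deleting at most \<open>card A - card I\<close> elements makes \<open>J\<close> independent. The bounds that express this are
  those of the concatenated word.\<close>

lemma free_product_schubert:
  assumes fin: "finite E" "finite E'" and A: "A \<subseteq> E" "A' \<subseteq> E'"
    and less: "\<And>x y. x \<in> E \<Longrightarrow> y \<in> E' \<Longrightarrow> x < y"
  shows "free_product (schubert E A) (schubert E' A') = schubert (E \<union> E') (A \<union> A')"
proof -
  have dis: "E \<inter> E' = {}" using less by blast
  note M = is_matroid_schubert[OF fin(1), of A] and M' = is_matroid_schubert[OF fin(2), of A']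
  have finA: "finite A" "finite A'" using A fin finite_subset by auto
  have "K \<in> indeps (free_product (schubert E A) (schubert E' A')) \<longleftrightarrow>
        K \<in> indeps (schubert (E \<union> E') (A \<union> A'))" for K
  proof (cases "K \<subseteq> E \<union> E'")
    case True
    let ?I = "K \<inter> E" and ?J = "K \<inter> E'"
    have finK: "finite K" using True fin finite_subset by auto
    have I: "?I \<in> indeps (schubert E A) \<longleftrightarrow> (\<forall>j. card (?I \<inter> {..j}) \<le> card (A \<inter> {..j}))"
      using A by (simp add: schubert_indeps)
    have split: "card (K \<inter> {..j}) = card (?I \<inter> {..j}) + card (?J \<inter> {..j})" for j
    proof -
      have "K \<inter> {..j} = (?I \<inter> {..j}) \<union> (?J \<inter> {..j})" using True by auto
      then show ?thesis using finK dis card_Un_disjoint[of "?I \<inter> {..j}" "?J \<inter> {..j}"] by auto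
    qed
    have splitA: "card ((A \<union> A') \<inter> {..j}) = card (A \<inter> {..j}) + card (A' \<inter> {..j})" for j
    proof -
      have "(A \<union> A') \<inter> {..j} = (A \<inter> {..j}) \<union> (A' \<inter> {..j})" by auto
      then show ?thesis using finA dis A card_Un_disjoint[of "A \<inter> {..j}" "A' \<inter> {..j}"] by auto
    qed
    have "rank (schubert E A) = card A" using rank_schubert fin A by simp
    then have "K \<in> indeps (free_product (schubert E A) (schubert E' A')) \<longleftrightarrow>
        (\<forall>j. card (?I \<inter> {..j}) \<le> card (A \<inter> {..j})) \<and>
        card ?I + card ?J \<le> card A + rank_of (schubert E' A') ?J" (is "_ \<longleftrightarrow> ?P \<and> ?Q")
      using free_product_indep_iff[OF M M', of K] dis True I by simp
    moreover have "?P \<and> ?Q \<longleftrightarrow> ?P \<and> (\<forall>j. card ?I + card (?J \<inter> {..j}) \<le> card A + card (A' \<inter> {..j}))"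
    proof (rule conj_cong[OF refl])
      assume P: ?P
      obtain j where "E \<subseteq> {..j}" using fin(1) finite_nat_set_iff_bounded_le by auto
      then have "?I \<inter> {..j} = ?I" "A \<inter> {..j} = A" using A by auto
      then have le: "card ?I \<le> card A" using P by metis
      have "?Q \<longleftrightarrow> card ?J \<le> (card A - card ?I) + rank_of (schubert E' A') ?J" using le by linarith
      also have "\<dots> \<longleftrightarrow> (\<forall>j. card (?J \<inter> {..j}) \<le> (card A - card ?I) + card (A' \<inter> {..j}))"
        using fin A by (intro schubert_card_le_rank_iff) auto
      also have "\<dots> \<longleftrightarrow> (\<forall>j. card ?I + card (?J \<inter> {..j}) \<le> card A + card (A' \<inter> {..j}))"
        using le by (intro all_cong1) linarith
      finally show "?Q \<longleftrightarrow> (\<forall>j. card ?I + card (?J \<inter> {..j}) \<le> card A + card (A' \<inter> {..j}))" .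
    qed
    \<comment> \<open>An element of \<open>E'\<close> or \<open>A'\<close> that is at most \<open>j\<close> forces \<open>E \<subseteq> {..j}\<close>, so at each \<open>j\<close> either
      the second summands vanish or the first ones have reached their full values.\<close>
    moreover have "\<dots> \<longleftrightarrow> (\<forall>j. card (?I \<inter> {..j}) + card (?J \<inter> {..j}) \<le> card (A \<inter> {..j}) + card (A' \<inter> {..j}))"
      (is "_ \<and> ?R \<longleftrightarrow> ?S")
    proof (intro iffI conjI)
      assume PR: "?P \<and> ?R"
      show ?S
      proof
        fix j
        show "card (?I \<inter> {..j}) + card (?J \<inter> {..j}) \<le> card (A \<inter> {..j}) + card (A' \<inter> {..j})"
        proof (cases "?J \<inter> {..j} = {}")
          case True
          have "card (?I \<inter> {..j}) \<le> card (A \<inter> {..j})" using PR by blast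
          then show ?thesis using True by simp
        next
          case False
          then have "E \<subseteq> {..j}" using less by force
          then have "?I \<inter> {..j} = ?I" "A \<inter> {..j} = A" using A by auto
          then show ?thesis using PR by metis
        qed
      qed
    next
      assume S: ?S
      show P: ?P
      proof
        fix j
        show "card (?I \<inter> {..j}) \<le> card (A \<inter> {..j})"
        proof (cases "E = {}")
          case False
          define i where "i = min j (Max E)"
          have "?I \<inter> {..i} = ?I \<inter> {..j}" "A \<inter> {..i} = A \<inter> {..j}"
            using A Max_ge[OF fin(1)] unfolding i_def by auto
          moreover have "A' \<inter> {..i} = {}"
            using less[of "Max E"] Max_in[OF fin(1) False] A unfolding i_def by fastforce
          moreover have "card (?I \<inter> {..i}) + card (?J \<inter> {..i}) \<le> card (A \<inter> {..i}) + card (A' \<inter> {..i})"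
            using S by blast
          ultimately show ?thesis by simp
        qed simp
      qed
      obtain b where b: "E \<subseteq> {..b}" using fin(1) finite_nat_set_iff_bounded_le by auto
      then have "?I \<inter> {..b} = ?I" "A \<inter> {..b} = A" using A by auto
      then have le: "card ?I \<le> card A" using P by metis
      show ?R
      proof
        fix j
        show "card ?I + card (?J \<inter> {..j}) \<le> card A + card (A' \<inter> {..j})"
        proof (cases "?J \<inter> {..j} = {}")
          case False
          then have "E \<subseteq> {..j}" using less by force
          then have "?I \<inter> {..j} = ?I" "A \<inter> {..j} = A" using A by auto
          then show ?thesis using S by metis
        next
          case True
          then show ?thesis using le by simp
        qed
      qed
    qed
    moreover have "\<dots> \<longleftrightarrow> K \<in> indeps (schubert (E \<union> E') (A \<union> A'))"
      using True A by (subst schubert_indeps) (auto simp: split splitA)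
    ultimately show ?thesis by simp
  next
    case False
    moreover have "A \<union> A' \<subseteq> E \<union> E'" using A by auto
    ultimately show ?thesis
      using free_product_indep_iff[OF M M', of K] dis by (simp add: schubert_indeps)
  qed
  then show ?thesis
    by (intro matroid.equality) (auto simp: free_product_sel(1))
qed

section \<open>Matroid polytopes by inequalities\<close>

text \<open>The polytope of a matroid and the polytope of a chain matroid are both given by submodular bounds,
  the former on all sets and the latter on a chain. Both are covered by bounds on a family of sets
  that is closed under union and intersection.\<close>

definition fractional :: "'a set \<Rightarrow> ('a \<Rightarrow> real) \<Rightarrow> 'a set" where
  "fractional E x = {e \<in> E. 0 < x e \<and> x e < 1}"

definition feasible :: "'a set \<Rightarrow> 'a set set \<Rightarrow> ('a set \<Rightarrow> nat) \<Rightarrow> ('a \<Rightarrow> real) \<Rightarrow> bool" where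
  "feasible E \<F> f x \<longleftrightarrow> (\<forall>e. 0 \<le> x e \<and> x e \<le> 1) \<and> (\<forall>e. e \<notin> E \<longrightarrow> x e = 0) \<and>
     (\<forall>Z\<in>\<F>. sum x Z \<le> f Z) \<and> sum x E = f E"

definition slack_sets :: "'a set set \<Rightarrow> ('a set \<Rightarrow> nat) \<Rightarrow> ('a \<Rightarrow> real) \<Rightarrow> 'a set set" where
  "slack_sets \<F> f x = {Z \<in> \<F>. sum x Z < f Z}"

definition defect :: "'a set \<Rightarrow> 'a set set \<Rightarrow> ('a set \<Rightarrow> nat) \<Rightarrow> ('a \<Rightarrow> real) \<Rightarrow> nat" where
  "defect E \<F> f x = card (slack_sets \<F> f x) + card (fractional E x)"

context
  fixes E :: "'a set" and \<F> :: "'a set set" and f :: "'a set \<Rightarrow> nat"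
  assumes finE: "finite E" and FE: "\<F> \<subseteq> Pow E" and EF: "E \<in> \<F>"
    and closed: "\<And>X Y. X \<in> \<F> \<Longrightarrow> Y \<in> \<F> \<Longrightarrow> X \<inter> Y \<in> \<F> \<and> X \<union> Y \<in> \<F>"
    and submod: "\<And>X Y. X \<in> \<F> \<Longrightarrow> Y \<in> \<F> \<Longrightarrow> f (X \<inter> Y) + f (X \<union> Y) \<le> f X + f Y"
begin

lemma finite_family: "finite \<F>" "Z \<in> \<F> \<Longrightarrow> finite Z"
  using FE finE by (auto intro: finite_subset)

text \<open>Submodularity leaves no slack at the intersection of two tight sets.\<close>

lemma tight_Int:
  assumes x: "feasible E \<F> f x" and Z: "Z \<in> \<F>" "sum x Z = f Z" "W \<in> \<F>" "sum x W = f W"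
  shows "Z \<inter> W \<in> \<F>" "sum x (Z \<inter> W) = f (Z \<inter> W)"
proof -
  show "Z \<inter> W \<in> \<F>" using closed Z by blast
  have "sum x (Z \<union> W) + sum x (Z \<inter> W) = sum x Z + sum x W"
    using sum.union_inter finite_family Z by blast
  moreover have "sum x (Z \<union> W) \<le> f (Z \<union> W)" "sum x (Z \<inter> W) \<le> f (Z \<inter> W)"
    using x closed Z by (auto simp: feasible_def)
  moreover have "real (f (Z \<inter> W)) + real (f (Z \<union> W)) \<le> real (f Z) + real (f W)"
    using submod[OF Z(1,3)] by linarith
  ultimately show "sum x (Z \<inter> W) = f (Z \<inter> W)" using Z by linarith
qed

lemma sum_transfer:
  assumes "finite Z" "e \<noteq> g"
  shows "sum (x(e := x e + t, g := x g - t)) Z =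
    sum x Z + (if e \<in> Z then t else 0) - (if g \<in> Z then t else (0::real))"
proof -
  have "sum (x(e := x e + t, g := x g - t)) Z =
      (\<Sum>i\<in>Z. x i + (if i = e then t else 0) - (if i = g then t else 0))"
    using assms(2) by (intro sum.cong) auto
  then show ?thesis using assms(1) by (simp add: sum.distrib sum_subtractf sum.delta)
qed

text \<open>Weight moves from \<open>g\<close> to \<open>e\<close> until a further constraint becomes tight.\<close>

lemma transfer_weight:
  assumes x: "feasible E \<F> f x" and eg: "e \<in> fractional E x" "g \<in> fractional E x" "e \<noteq> g"
    and sep: "\<And>Z. Z \<in> \<F> \<Longrightarrow> sum x Z = f Z \<Longrightarrow> e \<in> Z \<longleftrightarrow> g \<in> Z"
  obtains t where "t > 0" "feasible E \<F> f (x(e := x e + t, g := x g - t))"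
    "defect E \<F> f (x(e := x e + t, g := x g - t)) < defect E \<F> f x"
proof -
  let ?D = "{Z \<in> \<F>. e \<in> Z \<and> g \<notin> Z}"
  let ?T = "insert (1 - x e) (insert (x g) ((\<lambda>Z. f Z - sum x Z) ` ?D))"
  define t where "t = Min ?T"
  define y where "y = x(e := x e + t, g := x g - t)"
  have finT: "finite ?T" using finite_family by simp
  have tT: "t \<in> ?T" unfolding t_def by (rule Min_in[OF finT]) simp
  have tle: "s \<in> ?T \<Longrightarrow> t \<le> s" for s unfolding t_def by (rule Min_le[OF finT])
  have "s > 0" if "s \<in> ?T" for s
  proof -
    have "sum x Z < f Z" if "Z \<in> ?D" for Z
    proof -
      have "sum x Z \<noteq> f Z" using sep[of Z] that by auto
      moreover have "sum x Z \<le> f Z" using x that by (auto simp: feasible_def)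
      ultimately show ?thesis by simp
    qed
    then show ?thesis using that eg by (auto simp: fractional_def)
  qed
  then have t0: "t > 0" using tT by blast
  have t1: "t \<le> 1 - x e" "t \<le> x g" using tle by auto
  have sy: "sum y Z = sum x Z + (if e \<in> Z then t else 0) - (if g \<in> Z then t else 0)" if "Z \<in> \<F>" for Z
    unfolding y_def using sum_transfer[OF _ eg(3)] finite_family that by blast
  have egE: "e \<in> E" "g \<in> E" using eg by (auto simp: fractional_def)
  have feas: "feasible E \<F> f y"
    unfolding feasible_def
  proof (intro conjI allI ballI impI)
    show "0 \<le> y i" "y i \<le> 1" for i
      using x t0 t1 eg unfolding feasible_def y_def fractional_def by auto
    show "y i = 0" if "i \<notin> E" for i using that egE x by (auto simp: y_def feasible_def)
    show "sum y E = f E" using sy[OF EF] egE x by (simp add: feasible_def)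
    fix Z assume Z: "Z \<in> \<F>"
    have "sum x Z \<le> f Z" using x Z by (simp add: feasible_def)
    moreover have "t \<le> f Z - sum x Z" if "e \<in> Z" "g \<notin> Z" using tle Z that by auto
    ultimately show "sum y Z \<le> f Z" using sy[OF Z] t0 by (auto split: if_splits)
  qed
  have sub1: "slack_sets \<F> f y \<subseteq> slack_sets \<F> f x"
  proof
    fix Z assume Z: "Z \<in> slack_sets \<F> f y"
    then have ZF: "Z \<in> \<F>" "sum y Z < f Z" by (auto simp: slack_sets_def)
    have "sum x Z \<noteq> f Z"
    proof
      assume "sum x Z = f Z"
      then have "sum y Z = f Z" using sep[OF ZF(1)] sy[OF ZF(1)] by simp
      then show False using ZF by simp
    qed
    moreover have "sum x Z \<le> f Z" using x ZF by (simp add: feasible_def)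
    ultimately show "Z \<in> slack_sets \<F> f x" using ZF by (simp add: slack_sets_def)
  qed
  have sub2: "fractional E y \<subseteq> fractional E x"
    using eg t0 t1 by (auto simp: fractional_def y_def split: if_splits)
  have fin: "finite (slack_sets \<F> f x)" "finite (fractional E x)"
    using finite_family finE by (auto simp: slack_sets_def fractional_def)
  have "slack_sets \<F> f y \<subset> slack_sets \<F> f x \<or> fractional E y \<subset> fractional E x"
  proof -
    consider "t = 1 - x e" | "t = x g" | Z where "Z \<in> ?D" "t = f Z - sum x Z" using tT by auto
    then show ?thesis
    proof cases
      case 1
      then have "e \<notin> fractional E y" using eg by (simp add: y_def fractional_def)
      then show ?thesis using sub2 eg by blast
    next
      case 2
      then have "g \<notin> fractional E y" by (simp add: y_def fractional_def)
      then show ?thesis using sub2 eg by blast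
    next
      case 3
      then have "Z \<notin> slack_sets \<F> f y" "Z \<in> slack_sets \<F> f x"
        using sy[of Z] t0 by (auto simp: slack_sets_def)
      then show ?thesis using sub1 by blast
    qed
  qed
  then have "defect E \<F> f y < defect E \<F> f x"
    unfolding defect_def
    using psubset_card_mono[OF fin(1)] psubset_card_mono[OF fin(2)]
      card_mono[OF fin(1) sub1] card_mono[OF fin(2) sub2]
    by (meson add_le_less_mono add_less_le_mono)
  then show ?thesis using that t0 feas unfolding y_def by blast
qed

lemma sum_integral_of_not_fractional:
  assumes x: "\<And>e. 0 \<le> x e \<and> x e \<le> 1" and "Z \<subseteq> E" "Z \<inter> fractional E x = {}"
  shows "sum x Z = card {e \<in> Z. x e = 1}"
proof -
  have "finite Z" using finite_subset[OF assms(2) finE] .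
  have "x e = (if x e = 1 then 1 else 0)" if "e \<in> Z" for e
  proof -
    have "e \<in> E" "e \<notin> fractional E x" using that assms by auto
    then have "x e = 0 \<or> x e = 1" using x[of e] by (auto simp: fractional_def)
    then show ?thesis by auto
  qed
  then have "sum x Z = (\<Sum>e\<in>Z. if x e = 1 then 1 else 0)" by (intro sum.cong) auto
  also have "\<dots> = card {e \<in> Z. x e = 1}" using \<open>finite Z\<close> by (simp add: sum.If_cases Int_def)
  finally show ?thesis .
qed

text \<open>Take a smallest tight set meeting the fractional coordinates. It contains two of them, and no
  tight set separates these two, so the point lies between two feasible points with more tight
  constraints or more integral coordinates.\<close>

lemma feasible_in_convex_hull:
  assumes "feasible E \<F> f x"
  shows "x \<in> convex hull (indicat_real ` {B. B \<subseteq> E \<and> (\<forall>Z\<in>\<F>. card (B \<inter> Z) \<le> f Z) \<and> card B = f E})"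
    (is "x \<in> convex hull ?V")
  using assms
proof (induction "defect E \<F> f x" arbitrary: x rule: less_induct)
  case less
  note x = less.prems
  have x01: "0 \<le> x e \<and> x e \<le> 1" for e using x by (simp add: feasible_def)
  show ?case
  proof (cases "fractional E x = {}")
    case True
    let ?B = "{e \<in> E. x e = 1}"
    have "x e = indicat_real ?B e" for e
    proof (cases "e \<in> E")
      case True
      then have "e \<notin> fractional E x" using \<open>fractional E x = {}\<close> by blast
      then have "x e = 0 \<or> x e = 1" using True x01[of e] by (auto simp: fractional_def)
      then show ?thesis using True by auto
    qed (use x in \<open>simp add: feasible_def\<close>)
    then have xB: "x = indicat_real ?B" by (rule ext)
    have "card (?B \<inter> Z) \<le> f Z" if "Z \<in> \<F>" for Z
    proof -
      have "Z \<subseteq> E" using that FE by auto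
      then have "{e \<in> Z. x e = 1} = ?B \<inter> Z" by auto
      then have "sum x Z = card (?B \<inter> Z)"
        using sum_integral_of_not_fractional[of x Z] x01 True \<open>Z \<subseteq> E\<close> by simp
      moreover have "sum x Z \<le> f Z" using x that by (simp add: feasible_def)
      ultimately show ?thesis by linarith
    qed
    moreover have "card ?B = f E"
      using sum_integral_of_not_fractional[of x E] x01 True x by (simp add: feasible_def)
    ultimately have "x \<in> ?V" using xB by blast
    then show ?thesis by (rule hull_inc)
  next
    case False
    let ?T = "{Z \<in> \<F>. sum x Z = f Z \<and> Z \<inter> fractional E x \<noteq> {}}"
    have "E \<in> ?T" using EF False x by (auto simp: feasible_def fractional_def)
    then obtain T where T: "T \<in> ?T" and min: "\<And>Z. Z \<in> ?T \<Longrightarrow> card T \<le> card Z"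
      using ex_has_least_nat[of "\<lambda>Z. Z \<in> ?T" E card] by blast
    obtain e where e: "e \<in> T" "e \<in> fractional E x" using T by auto
    have TE: "T \<subseteq> E" using T FE by auto
    have finT: "finite T" using finite_family T by blast
    \<comment> \<open>The sum over \<open>T\<close> is an integer, so \<open>e\<close> cannot be its only fractional coordinate.\<close>
    obtain g where g: "g \<in> T" "g \<in> fractional E x" "g \<noteq> e"
    proof (rule ccontr)
      assume "\<not> thesis"
      then have no: "(T - {e}) \<inter> fractional E x = {}" using that by auto
      have "sum x T = x e + sum x (T - {e})" using e finT by (simp add: sum.remove)
      also have "sum x (T - {e}) = card {i \<in> T - {e}. x i = 1}"
        using sum_integral_of_not_fractional[of x "T - {e}"] x01 TE no by auto
      finally have "real (f T) = x e + card {i \<in> T - {e}. x i = 1}" using T by simp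
      then have "x e = real_of_int (int (f T) - int (card {i \<in> T - {e}. x i = 1}))" by simp
      moreover have "0 < x e" "x e < 1" using e by (auto simp: fractional_def)
      ultimately show False by (metis of_int_0_less_iff of_int_less_1_iff int_one_le_iff_zero_less not_less)
    qed
    have sep: "e \<in> Z \<longleftrightarrow> g \<in> Z" if Z: "Z \<in> \<F>" "sum x Z = f Z" for Z
    proof (rule ccontr)
      assume ne: "(e \<in> Z) \<noteq> (g \<in> Z)"
      then have "T \<inter> Z \<in> ?T" using tight_Int[OF x, of T Z] T Z e g by blast
      then have "card T \<le> card (T \<inter> Z)" by (rule min)
      then have "T \<subseteq> Z" using finT by (metis card_seteq inf.cobounded1 inf.absorb_iff1)
      then show False using ne e g by auto
    qed
    obtain s where s: "s > 0" "feasible E \<F> f (x(e := x e + s, g := x g - s))"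
      "defect E \<F> f (x(e := x e + s, g := x g - s)) < defect E \<F> f x"
      using transfer_weight[OF x e(2) g(2) _ sep] g(3) by metis
    obtain t where t: "t > 0" "feasible E \<F> f (x(g := x g + t, e := x e - t))"
      "defect E \<F> f (x(g := x g + t, e := x e - t)) < defect E \<F> f x"
      using transfer_weight[OF x g(2) e(2) g(3)] sep by metis
    let ?y = "x(e := x e + s, g := x g - s)" and ?z = "x(g := x g + t, e := x e - t)"
    have yz: "?y \<in> convex hull ?V" "?z \<in> convex hull ?V"
      using less.hyps[OF s(3,2)] less.hyps[OF t(3,2)] by auto
    have st: "s + t \<noteq> 0" "t / (s + t) + s / (s + t) = 1" "0 \<le> t / (s + t)" "0 \<le> s / (s + t)"
      using s(1) t(1) by (auto simp: add.commute simp flip: add_divide_distrib)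
    have "(t / (s + t)) *\<^sub>R ?y + (s / (s + t)) *\<^sub>R ?z \<in> convex hull ?V"
      by (rule convexD[OF convex_convex_hull yz st(3,4,2)])
    moreover have "(t / (s + t)) *\<^sub>R ?y + (s / (s + t)) *\<^sub>R ?z = x"
    proof
      fix i
      have a: "t / (s + t) * c + s / (s + t) * c = c" for c
        using st(2) by (metis distrib_right mult_1)
      have b: "t / (s + t) * s = s / (s + t) * t" by simp
      consider "i = e" | "i = g" | "i \<noteq> e" "i \<noteq> g" by auto
      then show "((t / (s + t)) *\<^sub>R ?y + (s / (s + t)) *\<^sub>R ?z) i = x i"
        using g(3) a[of "x i"] b
        by cases (simp_all add: scaleR_fun_def distrib_left right_diff_distrib add_divide_distrib
            diff_divide_distrib mult.commute[of s t])
    qed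
    ultimately show ?thesis by simp
  qed
qed

end


lemma convex_feasible: "convex {x. feasible E \<F> f x}"
proof (rule convexI)
  fix x y :: "'a \<Rightarrow> real" and u v :: real
  assume xy: "x \<in> {x. feasible E \<F> f x}" "y \<in> {x. feasible E \<F> f x}" and uv: "0 \<le> u" "0 \<le> v" "u + v = 1"
  let ?z = "u *\<^sub>R x + v *\<^sub>R y"
  have z: "?z i = u * x i + v * y i" for i by (simp add: scaleR_fun_def)
  have sz: "sum ?z Z = u * sum x Z + v * sum y Z" for Z
    unfolding z by (simp add: sum.distrib sum_distrib_left)
  have le: "u * a + v * b \<le> c" if "a \<le> c" "b \<le> c" for a b c :: real
    using convex_bound_le[OF that uv] .
  show "?z \<in> {x. feasible E \<F> f x}"
    using xy uv le unfolding mem_Collect_eq feasible_def sz z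
    by (auto simp flip: distrib_right)
qed

lemma convex_hull_eq_feasible:
  assumes "finite E" "\<F> \<subseteq> Pow E" "E \<in> \<F>"
    and "\<And>X Y. X \<in> \<F> \<Longrightarrow> Y \<in> \<F> \<Longrightarrow> X \<inter> Y \<in> \<F> \<and> X \<union> Y \<in> \<F>"
    and "\<And>X Y. X \<in> \<F> \<Longrightarrow> Y \<in> \<F> \<Longrightarrow> f (X \<inter> Y) + f (X \<union> Y) \<le> f X + f Y"
  shows "convex hull (indicat_real ` {B. B \<subseteq> E \<and> (\<forall>Z\<in>\<F>. card (B \<inter> Z) \<le> f Z) \<and> card B = f E}) =
    {x. feasible E \<F> f x}" (is "convex hull (indicat_real ` ?V) = _")
proof (intro equalityI hull_minimal convex_feasible subsetI)
  fix x :: "'a \<Rightarrow> real" assume "x \<in> {x. feasible E \<F> f x}"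
  then show "x \<in> convex hull (indicat_real ` ?V)"
    using feasible_in_convex_hull[OF assms] by blast
next
  fix x assume "x \<in> indicat_real ` ?V"
  then obtain B where B: "x = indicat_real B" "B \<subseteq> E" "\<forall>Z\<in>\<F>. card (B \<inter> Z) \<le> f Z" "card B = f E"
    by auto
  have s: "sum (indicat_real B) Z = card (B \<inter> Z)" if "Z \<subseteq> E" for Z
    using finite_subset[OF that assms(1)] by (simp add: indicator_def of_bool_def sum.If_cases Int_commute)
  have "sum (indicat_real B) Z = card (B \<inter> Z)" if "Z \<in> \<F>" for Z
    using s that assms(2) by auto
  moreover have "sum (indicat_real B) E = f E" using s[of E] B by (simp add: Int_absorb2)
  ultimately show "x \<in> {x. feasible E \<F> f x}"
    using B unfolding feasible_def by (auto simp: indicator_def)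
qed

section \<open>Expansion of the polytope indicator along chains\<close>

text \<open>Integer combinations of functions. The span is generated one summand at a time because the proofs
  below only transport membership along additive operations; the coefficients are recovered at the
  very end.\<close>

inductive_set int_span :: "('b \<Rightarrow> real) set \<Rightarrow> ('b \<Rightarrow> real) set" for B where
  int_span_zero: "(\<lambda>_. 0) \<in> int_span B"
| int_span_plus: "g \<in> int_span B \<Longrightarrow> b \<in> B \<Longrightarrow> (\<lambda>x. g x + b x) \<in> int_span B"
| int_span_minus: "g \<in> int_span B \<Longrightarrow> b \<in> B \<Longrightarrow> (\<lambda>x. g x - b x) \<in> int_span B"

lemma int_span_add:
  assumes "h \<in> int_span B" "g \<in> int_span B"
  shows "(\<lambda>x. g x + h x) \<in> int_span B"
  using assms
proof (induction rule: int_span.induct)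
  case (int_span_plus h b)
  then show ?case using int_span.int_span_plus[of "\<lambda>x. g x + h x" B b] by (simp add: add.assoc)
next
  case (int_span_minus h b)
  then show ?case using int_span.int_span_minus[of "\<lambda>x. g x + h x" B b] by (simp add: add_diff_eq)
qed simp

lemma int_span_uminus:
  assumes "g \<in> int_span B"
  shows "(\<lambda>x. - g x) \<in> int_span B"
  using assms
proof (induction rule: int_span.induct)
  case (int_span_plus h b)
  then show ?case using int_span.int_span_minus[of "\<lambda>x. - h x" B b] by simp
next
  case (int_span_minus h b)
  then show ?case using int_span.int_span_plus[of "\<lambda>x. - h x" B b] by (simp add: add.commute)
qed (simp add: int_span_zero)

lemma int_span_base: "b \<in> B \<Longrightarrow> b \<in> int_span B"
  using int_span.int_span_plus[OF int_span_zero] by simp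

lemma int_span_sum:
  assumes "finite S" "\<And>i. i \<in> S \<Longrightarrow> g i \<in> int_span B"
  shows "(\<lambda>x. \<Sum>i\<in>S. g i x) \<in> int_span B"
  using assms
proof (induction rule: finite_induct)
  case (insert i S)
  then show ?case using int_span_add[of "\<lambda>x. \<Sum>i\<in>S. g i x" B "g i"] by simp
qed (simp add: int_span_zero)

lemma int_span_mult:
  assumes "g \<in> int_span B" "\<And>b. b \<in> B \<Longrightarrow> (\<lambda>x. c x * b x) \<in> int_span B'"
  shows "(\<lambda>x. c x * g x) \<in> int_span B'"
  using assms(1)
proof (induction rule: int_span.induct)
  case (int_span_plus h b)
  then show ?case using int_span_add[OF assms(2)[OF int_span_plus(2)] int_span_plus.IH]
    by (simp add: distrib_left)
next
  case (int_span_minus h b)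
  then show ?case
    using int_span_add[OF int_span_uminus[OF assms(2)[OF int_span_minus(2)]] int_span_minus.IH]
    by (simp add: right_diff_distrib)
qed (simp add: int_span_zero)

text \<open>Toggling the apex \<open>e\<close> reverses the sign: cones have reduced Euler characteristic zero.\<close>

lemma alternating_sum_cone:
  fixes P :: "'a set \<Rightarrow> bool"
  assumes "finite X" "e \<in> X" and P: "\<And>Y. Y \<subseteq> X - {e} \<Longrightarrow> P (insert e Y) \<longleftrightarrow> P Y"
  shows "(\<Sum>Y\<in>Pow X. (-1) ^ card Y * of_bool (P Y)) = (0::real)"
proof -
  let ?X = "X - {e}"
  let ?g = "\<lambda>Y. (-1) ^ card Y * of_bool (P Y) :: real"
  have X: "Pow X = Pow ?X \<union> insert e ` Pow ?X"
    using Pow_insert[of e ?X] insert_Diff[OF assms(2)] by simp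
  have inj: "inj_on (insert e) (Pow ?X)" by (auto simp: inj_on_def)
  have "?g (insert e Y) = - ?g Y" if "Y \<in> Pow ?X" for Y
  proof -
    have "finite Y" "e \<notin> Y" using that assms(1) finite_subset by auto
    then show ?thesis using P[of Y] that by simp
  qed
  then have "sum ?g (insert e ` Pow ?X) = (\<Sum>Y\<in>Pow ?X. - ?g Y)"
    using sum.reindex[OF inj, of ?g] by simp
  moreover have "sum ?g (Pow X) = sum ?g (Pow ?X) + sum ?g (insert e ` Pow ?X)"
    unfolding X using assms(1) by (intro sum.union_disjoint) auto
  ultimately show ?thesis by (simp add: sum_negf)
qed

text \<open>Up to sign, this is the indicator of the polyhedron defined by the rank inequalities of all subsets
  of \<open>X\<close>. For fixed \<open>x\<close> and \<open>X\<close> in the poset of all sets \<open>Y\<close> with \<open>x(Y) \<le> r(Y)\<close>, it is the Moebius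
  function of that poset from the empty set to \<open>X\<close>, and unfolding its recursion produces chains.\<close>

definition signed_indep :: "('a set \<Rightarrow> nat) \<Rightarrow> 'a set \<Rightarrow> ('a \<Rightarrow> real) \<Rightarrow> real" where
  "signed_indep r X x = (-1) ^ card X * of_bool (\<forall>Y\<subseteq>X. sum x Y \<le> r Y)"

definition chain_indicator :: "('a set \<Rightarrow> nat) \<Rightarrow> 'a set set \<Rightarrow> ('a \<Rightarrow> real) \<Rightarrow> real" where
  "chain_indicator r \<C> x = of_bool (\<forall>Z\<in>\<C>. sum x Z \<le> r Z)"

text \<open>Only the case where \<open>X\<close> satisfies its bound but some subset does not is of interest. Let \<open>B \<subseteq> X\<close>
  minimize \<open>r - x\<close> and take \<open>e \<in> X - B\<close>. If a set \<open>W\<close> violates its bound, then so does \<open>W \<inter> B\<close> by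
  submodularity. Hence adding \<open>e\<close> to \<open>Y\<close> creates no violating subset that is not already contained in
  \<open>Y\<close>, so the sets without violating subsets form a cone with apex \<open>e\<close>.\<close>

lemma signed_indep_recursion:
  fixes r :: "'a set \<Rightarrow> nat"
    and x :: "'a \<Rightarrow> real"
  assumes fin: "finite X" and ne: "X \<noteq> {}"
    and submod: "\<And>Y Z. r (Y \<inter> Z) + r (Y \<union> Z) \<le> r Y + r Z"
  shows "signed_indep r X x = - of_bool (sum x X \<le> r X) * (\<Sum>Y\<in>Pow X - {X}. signed_indep r Y x)"
proof -
  let ?good = "\<lambda>Y. sum x Y \<le> r Y"
  let ?P = "\<lambda>Y. \<forall>W\<subseteq>Y. ?good W"
  have split: "(\<Sum>Y\<in>Pow X. signed_indep r Y x) = signed_indep r X x + (\<Sum>Y\<in>Pow X - {X}. signed_indep r Y x)"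
    using fin by (intro sum.remove) auto
  have zero: "(\<Sum>Y\<in>Pow X. signed_indep r Y x) = 0" if "?good X"
  proof (cases "?P X")
    case True
    obtain e where "e \<in> X" using ne by auto
    have "?P Y" if "Y \<subseteq> X" for Y using True that by auto
    then have "?P (insert e Y) \<longleftrightarrow> ?P Y" if "Y \<subseteq> X - {e}" for Y
      using that \<open>e \<in> X\<close> by (metis Diff_subset insert_subset subset_trans)
    then show ?thesis
      using alternating_sum_cone[OF fin \<open>e \<in> X\<close>, of ?P] by (simp add: signed_indep_def)
  next
    case False
    let ?f = "\<lambda>Y. r Y - sum x Y"
    have "Min (?f ` Pow X) \<in> ?f ` Pow X" using fin by (intro Min_in) auto
    then obtain B where B: "B \<subseteq> X" "?f B = Min (?f ` Pow X)" by auto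
    then have min: "?f B \<le> ?f Y" if "Y \<subseteq> X" for Y using that fin by simp
    obtain W where "W \<subseteq> X" "\<not> ?good W" using False by auto
    then have "?f B < 0" using min[of W] by simp
    then have "B \<noteq> X" using \<open>?good X\<close> by auto
    then obtain e where e: "e \<in> X" "e \<notin> B" using B by auto
    have "?P (insert e Y) \<longleftrightarrow> ?P Y" if Y: "Y \<subseteq> X - {e}" for Y
    proof
      assume PY: "?P Y"
      show "?P (insert e Y)"
      proof (intro allI impI)
        fix W assume W: "W \<subseteq> insert e Y"
        then have WX: "W \<subseteq> X" using Y e by auto
        have "W \<inter> B \<subseteq> Y" using W e by auto
        then have "0 \<le> ?f (W \<inter> B)" using PY by simp
        moreover have "?f (W \<inter> B) + ?f (W \<union> B) \<le> ?f W + ?f B"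
        proof -
          have "sum x (W \<union> B) + sum x (W \<inter> B) = sum x W + sum x B"
            using sum.union_inter[of W B x] finite_subset[OF WX fin] finite_subset[OF B(1) fin] by simp
          moreover have "real (r (W \<inter> B)) + real (r (W \<union> B)) \<le> real (r W) + real (r B)"
            using submod[of W B] by linarith
          ultimately show ?thesis by linarith
        qed
        moreover have "?f B \<le> ?f (W \<union> B)" using min WX B(1) by simp
        ultimately show "?good W" by linarith
      qed
    qed auto
    then show ?thesis
      using alternating_sum_cone[OF fin e(1), of ?P] by (simp add: signed_indep_def)
  qed
  show ?thesis
  proof (cases "?good X")
    case True
    then show ?thesis using zero split by simp
  next
    case False
    then have "\<not> ?P X" by auto
    then show ?thesis using False by (simp add: signed_indep_def)
  qed
qed

text \<open>By the recursion, \<open>X\<close> is put on top of the chains that occur for its proper subsets.\<close>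

lemma signed_indep_in_int_span:
  fixes r :: "'a set \<Rightarrow> nat"
  assumes "finite X" and submod: "\<And>Y Z. r (Y \<inter> Z) + r (Y \<union> Z) \<le> r Y + r Z"
  shows "signed_indep r X \<in> int_span (chain_indicator r ` {\<C>. \<C> \<subseteq> Pow X \<and> chain\<^sub>\<subseteq> \<C> \<and> X \<in> \<C>})"
  using assms(1)
proof (induction rule: finite_psubset_induct)
  case (psubset X)
  let ?B = "\<lambda>X. chain_indicator r ` {\<C>. \<C> \<subseteq> Pow X \<and> chain\<^sub>\<subseteq> \<C> \<and> X \<in> \<C>}"
  show ?case
  proof (cases "X = {}")
    case True
    then have "signed_indep r X = chain_indicator r {X}"
      by (auto simp: signed_indep_def chain_indicator_def)
    moreover have "chain_indicator r {X} \<in> ?B X" by (auto simp: chain_subset_def)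
    ultimately show ?thesis using int_span_base by metis
  next
    case False
    have "(\<lambda>x :: 'a \<Rightarrow> real. of_bool (sum x X \<le> r X) * signed_indep r Y x) \<in> int_span (?B X)"
      if Y: "Y \<in> Pow X - {X}" for Y
    proof (rule int_span_mult)
      show "signed_indep r Y \<in> int_span (?B Y)" using Y by (intro psubset.IH) auto
      fix b assume "b \<in> ?B Y"
      then obtain \<C> where C: "b = chain_indicator r \<C>" "\<C> \<subseteq> Pow Y" "chain\<^sub>\<subseteq> \<C>" by auto
      have "(\<lambda>x :: 'a \<Rightarrow> real. of_bool (sum x X \<le> r X) * b x) = chain_indicator r (insert X \<C>)"
        unfolding C(1) by (simp add: chain_indicator_def fun_eq_iff flip: of_bool_conj)
      moreover have "chain\<^sub>\<subseteq> (insert X \<C>)" using C Y unfolding chain_subset_def by blast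
      moreover have "insert X \<C> \<subseteq> Pow X" using C Y by auto
      ultimately show "(\<lambda>x :: 'a \<Rightarrow> real. of_bool (sum x X \<le> r X) * b x) \<in> int_span (?B X)"
        by (intro int_span_base) auto
    qed
    then have "(\<lambda>x. \<Sum>Y\<in>Pow X - {X}. of_bool (sum x X \<le> r X) * signed_indep r Y x) \<in> int_span (?B X)"
      using psubset.hyps by (intro int_span_sum) auto
    then have "(\<lambda>x. - (\<Sum>Y\<in>Pow X - {X}. of_bool (sum x X \<le> r X) * signed_indep r Y x)) \<in> int_span (?B X)"
      by (rule int_span_uminus)
    moreover have "signed_indep r X x =
        - (\<Sum>Y\<in>Pow X - {X}. of_bool (sum x X \<le> r X) * signed_indep r Y x)" for x
      using signed_indep_recursion[OF psubset.hyps False submod, of x]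
      unfolding sum_distrib_left[symmetric] by simp
    ultimately show ?thesis by presburger
  qed
qed

definition hypersimplex :: "'a set \<Rightarrow> nat \<Rightarrow> ('a \<Rightarrow> real) set" where
  "hypersimplex E r = {x. (\<forall>e. 0 \<le> x e \<and> x e \<le> 1) \<and> (\<forall>e. e \<notin> E \<longrightarrow> x e = 0) \<and> sum x E = r}"

lemma base_polytope_eq:
  assumes M: "is_matroid M"
  shows "base_polytope M = hypersimplex (ground M) (rank M) \<inter> {x. \<forall>Z\<subseteq>ground M. sum x Z \<le> rank_of M Z}"
proof -
  let ?E = "ground M"
  have "B \<in> bases M \<longleftrightarrow> B \<subseteq> ?E \<and> (\<forall>Z\<in>Pow ?E. card (B \<inter> Z) \<le> rank_of M Z) \<and> card B = rank_of M ?E"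
    (is "_ \<longleftrightarrow> ?R B") for B
  proof
    assume "B \<in> bases M"
    then have B: "B \<in> indeps M" "card B = rank_of M ?E" using bases_iff[OF M] by (auto simp: rank_def)
    have "B \<inter> Z \<in> indeps M" for Z using indep_subset[OF M B(1)] by blast
    then show "?R B"
      using B indep_subset_ground[OF M B(1)] rank_of_ge[OF M] by auto
  next
    assume B: "?R B"
    then have "card (B \<inter> B) \<le> rank_of M B" by blast
    then show "B \<in> bases M"
      using B indep_iff_card_le_rank[OF M finite_subset[OF _ matroid_finite[OF M]]]
      by (simp add: bases_iff[OF M] rank_def)
  qed
  then have "bases M = {B. B \<subseteq> ?E \<and> (\<forall>Z\<in>Pow ?E. card (B \<inter> Z) \<le> rank_of M Z) \<and> card B = rank_of M ?E}"
    by blast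
  then have "base_polytope M = {x. feasible ?E (Pow ?E) (rank_of M) x}"
    unfolding base_polytope_def
    using convex_hull_eq_feasible[of ?E "Pow ?E" "rank_of M"] matroid_finite[OF M] rank_of_submodular[OF M]
    by auto
  then show ?thesis by (auto simp: feasible_def hypersimplex_def rank_def)
qed

lemma base_polytope_chain_matroid:
  assumes fin: "finite E" and C: "\<C> \<subseteq> Pow E" "chain\<^sub>\<subseteq> \<C>" "E \<in> \<C>"
    and rk: "rank (chain_matroid E \<C> f) = f E"
  shows "base_polytope (chain_matroid E \<C> f) = hypersimplex E (f E) \<inter> {x. \<forall>Z\<in>\<C>. sum x Z \<le> f Z}"
proof -
  have "bases (chain_matroid E \<C> f) = {B. B \<subseteq> E \<and> (\<forall>Z\<in>\<C>. card (B \<inter> Z) \<le> f Z) \<and> card B = f E}"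
    using bases_iff[OF is_matroid_chain_matroid[OF fin C(1,2)], of _ f] rk by auto
  moreover have "convex hull (indicat_real ` \<dots>) = {x. feasible E \<C> f x}"
  proof (rule convex_hull_eq_feasible[OF fin C(1,3)])
    fix X Y assume "X \<in> \<C>" "Y \<in> \<C>"
    then have "X \<subseteq> Y \<or> Y \<subseteq> X" using C(2) by (auto simp: chain_subset_def)
    then have "X \<inter> Y = X \<and> X \<union> Y = Y \<or> X \<inter> Y = Y \<and> X \<union> Y = X" by blast
    then show "X \<inter> Y \<in> \<C> \<and> X \<union> Y \<in> \<C>" "f (X \<inter> Y) + f (X \<union> Y) \<le> f X + f Y"
      using \<open>X \<in> \<C>\<close> \<open>Y \<in> \<C>\<close> by auto
  qed
  ultimately show ?thesis by (auto simp: base_polytope_def feasible_def hypersimplex_def)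
qed

text \<open>This is the expansion of Derksen and Fink of a matroid polytope into polytopes of nested matroids,
  with integer coefficients and before symmetrization. Restricted to the hypersimplex, a product of
  bounds along a chain of sets is the indicator of the polytope of the corresponding chain matroid,
  whose rank is not smaller than that of \<open>M\<close> because every independent set of \<open>M\<close> satisfies the
  bounds.\<close>

lemma base_polytope_in_int_span:
  assumes M: "is_matroid M"
  shows "indicat_real (base_polytope M) \<in>
    int_span ((\<lambda>S. indicat_real (base_polytope S)) ` {S \<in> matroids_on (ground M) (rank M). nested S})"
    (is "_ \<in> int_span ?N")
proof -
  let ?E = "ground M" and ?r = "rank_of M"
  let ?\<Delta> = "hypersimplex ?E (rank M)"
  note fin = matroid_finite[OF M]
  let ?B = "chain_indicator ?r ` {\<C>. \<C> \<subseteq> Pow ?E \<and> chain\<^sub>\<subseteq> \<C> \<and> ?E \<in> \<C>}"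
  have "(\<lambda>x. indicat_real ?\<Delta> x * signed_indep ?r ?E x) \<in> int_span ?N"
  proof (rule int_span_mult)
    show "signed_indep ?r ?E \<in> int_span ?B"
      using signed_indep_in_int_span[OF fin] rank_of_submodular[OF M] by blast
    fix b assume "b \<in> ?B"
    then obtain \<C> where C: "b = chain_indicator ?r \<C>" "\<C> \<subseteq> Pow ?E" "chain\<^sub>\<subseteq> \<C>" "?E \<in> \<C>" by auto
    let ?S = "chain_matroid ?E \<C> ?r"
    note S = is_matroid_chain_matroid[OF fin C(2,3), of ?r]
    have rk: "rank ?S = ?r ?E"
    proof (rule antisym)
      show "rank ?S \<le> ?r ?E" by (rule rank_chain_matroid_le[OF fin C(2,3,4)])
      obtain I where I: "I \<in> indeps M" "I \<subseteq> ?E" "card I = ?r ?E" using rank_of_obtain[OF M] .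
      have "card (I \<inter> Z) \<le> ?r Z" for Z
        using indep_subset[OF M I(1), of "I \<inter> Z"] by (intro rank_of_ge[OF M]) auto
      then have "I \<in> indeps ?S" using I by simp
      then have "card I \<le> rank_of ?S ?E" using I by (intro rank_of_ge[OF S])
      then show "?r ?E \<le> rank ?S" using I by (simp add: rank_def)
    qed
    then have "base_polytope ?S = ?\<Delta> \<inter> {x. \<forall>Z\<in>\<C>. sum x Z \<le> ?r Z}"
      using base_polytope_chain_matroid[OF fin C(2,3,4), of ?r] by (simp add: rank_def)
    then have "(\<lambda>x. indicat_real ?\<Delta> x * b x) = indicat_real (base_polytope ?S)"
      unfolding C(1) by (auto simp: chain_indicator_def indicator_def)
    moreover have "?S \<in> {S \<in> matroids_on ?E (rank M). nested S}"
      using S rk nested_chain_matroid[OF fin C(2,3)] by (simp add: matroids_on_def rank_def)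
    ultimately show "(\<lambda>x. indicat_real ?\<Delta> x * b x) \<in> int_span ?N"
      using int_span_base by (metis (mono_tags, lifting) imageI)
  qed
  then have pm: "(\<lambda>x. (-1) ^ card ?E * indicat_real (base_polytope M) x) \<in> int_span ?N"
    unfolding base_polytope_eq[OF M]
    by (rule back_subst[of "\<lambda>g. g \<in> int_span ?N"])
      (auto simp: signed_indep_def indicator_def)
  show ?thesis
  proof (cases "even (card ?E)")
    case True
    then show ?thesis using pm by simp
  next
    case False
    then show ?thesis using int_span_uminus[OF pm] by simp
  qed
qed

section \<open>Linear relations between indicators of compact convex sets\<close>

text \<open>A step function that vanishes identically has no jump from the right: at every \<open>x\<close> the coefficients
  of the intervals ending at \<open>x\<close> cancel.\<close>

lemma interval_relation:
  fixes a l u :: "'i \<Rightarrow> real"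
  assumes fin: "finite I" and lu: "\<And>i. i \<in> I \<Longrightarrow> l i \<le> u i"
    and rel: "\<And>t. (\<Sum>i\<in>I. a i * of_bool (t \<in> {l i..u i})) = 0"
  shows "sum a I = 0"
proof -
  have "(\<Sum>i | i \<in> I \<and> u i = x. a i) = 0" for x
  proof -
    let ?Q = "{p \<in> l ` I \<union> u ` I. x < p}"
    \<comment> \<open>Just to the right of \<open>x\<close>, before the next endpoint, exactly the intervals ending at \<open>x\<close> have
      disappeared.\<close>
    obtain y where y: "x < y" "\<And>p. p \<in> ?Q \<Longrightarrow> y < p"
    proof (cases "?Q = {}")
      case True
      show ?thesis by (rule that[of "x + 1"]) (simp, use True in blast)
    next
      case False
      have finQ: "finite ?Q" using fin by simp
      then have "Min ?Q \<in> ?Q" using False by (rule Min_in)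
      then have lt: "x < Min ?Q" by simp
      then obtain y where y: "x < y" "y < Min ?Q" using dense by blast
      show ?thesis
      proof (rule that[OF y(1)])
        fix p assume "p \<in> ?Q"
        then have "Min ?Q \<le> p" using Min_le[OF finQ] by blast
        then show "y < p" using y(2) by (rule less_le_trans[rotated])
      qed
    qed
    have "of_bool (x \<in> {l i..u i}) - of_bool (y \<in> {l i..u i}) = (of_bool (u i = x) :: real)"
      if i: "i \<in> I" for i
    proof -
      have "l i \<le> x \<or> y < l i" using y(2)[of "l i"] i by fastforce
      moreover have "u i \<le> x \<or> y < u i" using y(2)[of "u i"] i by fastforce
      ultimately show ?thesis using lu[OF i] y(1) by auto
    qed
    then have "a i * of_bool (x \<in> {l i..u i}) - a i * of_bool (y \<in> {l i..u i}) = a i * of_bool (u i = x)"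
      if "i \<in> I" for i
      using that by (metis right_diff_distrib)
    then have "(\<Sum>i\<in>I. a i * of_bool (u i = x)) =
        (\<Sum>i\<in>I. a i * of_bool (x \<in> {l i..u i})) - (\<Sum>i\<in>I. a i * of_bool (y \<in> {l i..u i}))"
      unfolding sum_subtractf[symmetric] by (intro sum.cong) auto
    also have "\<dots> = 0" using rel by simp
    finally have "(\<Sum>i\<in>I. a i * of_bool (u i = x)) = 0" .
    then show ?thesis using fin by (simp add: of_bool_def if_distrib sum.If_cases Int_def cong: if_cong)
  qed
  then show ?thesis using sum.group[OF fin finite_imageI[OF fin] subset_refl, of a u]
    by (metis (no_types, lifting) sum.neutral)
qed

text \<open>The linear functional that maps the indicator of every nonempty compact convex set to 1, the Euler
  characteristic, is well defined. One coordinate at a time is projected out: along a line every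
  set is a compact interval, so that the one-dimensional case applies.\<close>

lemma compact_convex_relation:
  fixes K :: "'i \<Rightarrow> ('a \<Rightarrow> real) set" and a :: "'i \<Rightarrow> real"
  assumes fin: "finite I" and K: "\<And>i. i \<in> I \<Longrightarrow> compact (K i)" "\<And>i. i \<in> I \<Longrightarrow> convex (K i)"
    and rel: "\<And>x. (\<Sum>i\<in>I. a i * of_bool (x \<in> K i)) = 0" and S: "finite S"
  shows "(\<Sum>i\<in>I. a i * of_bool (\<exists>y\<in>K i. \<forall>j. j \<notin> S \<longrightarrow> y j = x j)) = 0"
  using S
proof (induction S arbitrary: x rule: finite_induct)
  case empty
  have "(\<exists>y\<in>K i. \<forall>j. j \<notin> {} \<longrightarrow> y j = x j) \<longleftrightarrow> x \<in> K i" for i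
    by (auto simp flip: fun_eq_iff)
  then show ?case using rel[of x] by presburger
next
  case (insert k S)
  define D where "D = {y :: 'a \<Rightarrow> real. \<forall>j. j \<notin> insert k S \<longrightarrow> y j = x j}"
  define T where "T i = (\<lambda>y. y k) ` (K i \<inter> D)" for i
  have mem: "t \<in> T i \<longleftrightarrow> (\<exists>y\<in>K i. \<forall>j. j \<notin> S \<longrightarrow> y j = (x(k := t)) j)" for t i
    using insert.hyps unfolding T_def D_def by (auto simp: image_iff)
  have "closed D"
  proof -
    have "closed {y :: 'a \<Rightarrow> real. y j = x j}" for j
      by (intro closed_Collect_eq continuous_on_product_coordinates continuous_on_const)
    moreover have "D = (\<Inter>j\<in>- insert k S. {y. y j = x j})" by (auto simp: D_def)
    ultimately show ?thesis by (auto intro: closed_INT)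
  qed
  have "\<exists>l u. T i = {l..u}" if i: "i \<in> I" for i
  proof -
    have "compact (T i)"
      unfolding T_def
    proof (rule compact_continuous_image)
      show "continuous_on (K i \<inter> D) (\<lambda>y. y k)"
        by (rule continuous_on_subset[OF continuous_on_product_coordinates]) simp
      show "compact (K i \<inter> D)" using K(1)[OF i] \<open>closed D\<close> by (rule compact_Int_closed)
    qed
    moreover have "convex (T i)"
    proof (rule convexI)
      fix s t u v :: real
      assume st: "s \<in> T i" "t \<in> T i" and uv: "0 \<le> u" "0 \<le> v" "u + v = 1"
      obtain y z where y: "y \<in> K i" "y \<in> D" "s = y k" and z: "z \<in> K i" "z \<in> D" "t = z k"
        using st by (auto simp: T_def)
      let ?w = "u *\<^sub>R y + v *\<^sub>R z"
      have "?w \<in> K i" using convexD[OF K(2)[OF i] y(1) z(1) uv] .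
      moreover have "?w \<in> D"
        using y(2) z(2) uv(3) by (auto simp: D_def scaleR_fun_def simp flip: distrib_right)
      moreover have "?w k = u *\<^sub>R s + v *\<^sub>R t" using y z by (simp add: scaleR_fun_def)
      ultimately show "u *\<^sub>R s + v *\<^sub>R t \<in> T i" unfolding T_def by (metis IntI imageI)
    qed
    ultimately show ?thesis using connected_compact_interval_1 convex_connected by blast
  qed
  then obtain l u where lu: "\<And>i. i \<in> I \<Longrightarrow> T i = {l i..u i}" by metis
  let ?J = "{i \<in> I. T i \<noteq> {}}"
  have "sum a ?J = 0"
  proof (rule interval_relation)
    show "finite ?J" using fin by simp
    show "l i \<le> u i" if "i \<in> ?J" for i using lu[of i] that by auto
    fix t
    have "(\<Sum>i\<in>?J. a i * of_bool (t \<in> {l i..u i})) = (\<Sum>i\<in>I. a i * of_bool (t \<in> T i))"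
      using fin lu by (intro sum.mono_neutral_cong_left) auto
    also have "\<dots> = 0" unfolding mem by (rule insert.IH)
    finally show "(\<Sum>i\<in>?J. a i * of_bool (t \<in> {l i..u i})) = 0" .
  qed
  have "(\<exists>y\<in>K i. \<forall>j. j \<notin> insert k S \<longrightarrow> y j = x j) \<longleftrightarrow> T i \<noteq> {}" for i
    by (auto simp: T_def D_def)
  then have "(\<Sum>i\<in>I. a i * of_bool (\<exists>y\<in>K i. \<forall>j. j \<notin> insert k S \<longrightarrow> y j = x j)) =
      (\<Sum>i\<in>I. a i * of_bool (T i \<noteq> {}))" by presburger
  also have "\<dots> = sum a ?J"
    using fin by (simp add: of_bool_def if_distrib sum.If_cases Int_def cong: if_cong)
  finally show ?case using \<open>sum a ?J = 0\<close> by simp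
qed

text \<open>The ambient function space carries the product topology and no norm, hence the induction on the
  number of points.\<close>

lemma compact_convex_hull_finite:
  fixes V :: "('a \<Rightarrow> real) set"
  assumes "finite V"
  shows "compact (convex hull V)"
  using assms
proof (induction rule: finite_induct)
  case (insert a V)
  show ?case
  proof (cases "V = {}")
    case False
    let ?f = "\<lambda>p i. (1 - fst p) * a i + fst p * snd p i"
    have "convex hull (insert a V) = ?f ` ({0..1} \<times> (convex hull V))"
    proof (intro equalityI subsetI)
      fix x assume "x \<in> convex hull (insert a V)"
      then obtain u v b where x: "0 \<le> u" "0 \<le> v" "u + v = 1" "b \<in> convex hull V" "x = u *\<^sub>R a + v *\<^sub>R b"
        unfolding convex_hull_insert[OF False] by auto
      then have "u = 1 - v" by linarith
      then have "x = ?f (v, b)" unfolding x(5) by (auto simp: scaleR_fun_def)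
      moreover have "v \<le> 1" using x by linarith
      ultimately show "x \<in> ?f ` ({0..1} \<times> (convex hull V))" using x by (intro image_eqI[of _ _ "(v, b)"]) auto
    next
      fix x assume "x \<in> ?f ` ({0..1} \<times> (convex hull V))"
      then obtain v b where x: "0 \<le> v" "v \<le> 1" "b \<in> convex hull V" "x = ?f (v, b)" by auto
      then have "x = (1 - v) *\<^sub>R a + v *\<^sub>R b" by (auto simp: scaleR_fun_def)
      then show "x \<in> convex hull (insert a V)"
        unfolding convex_hull_insert[OF False] using x
        by (intro CollectI exI[of _ "1 - v"] exI[of _ v] exI[of _ b] conjI) auto
    qed
    moreover have "compact (?f ` ({0..1} \<times> (convex hull V)))"
    proof (intro compact_continuous_image compact_Times insert.IH compact_Icc)
      have "continuous_on ({0..1} \<times> (convex hull V)) (\<lambda>p. snd p i)" for i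
        by (rule continuous_on_product_then_coordinatewise) (intro continuous_intros)
      then show "continuous_on ({0..1} \<times> (convex hull V)) ?f"
        by (intro continuous_on_coordinatewise_then_product continuous_intros)
    qed
    ultimately show ?thesis by simp
  qed simp
qed simp

section \<open>From symmetrized indicators to rank sequences\<close>

text \<open>The greedy basis: maximum independent sets are extended along the chain.\<close>

lemma basis_along_chain:
  fixes X :: "nat \<Rightarrow> 'a set"
  assumes M: "is_matroid M" and X: "\<And>i j. i \<le> j \<Longrightarrow> j \<le> n \<Longrightarrow> X i \<subseteq> X j" and "X n = ground M"
  obtains B where "B \<in> bases M" "\<And>j. j \<le> n \<Longrightarrow> card (B \<inter> X j) = rank_of M (X j)"
proof -
  have "\<exists>I\<in>indeps M. I \<subseteq> X k \<and> (\<forall>j\<le>k. card (I \<inter> X j) = rank_of M (X j))" if "k \<le> n" for k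
    using that
  proof (induction k)
    case 0
    obtain I where "I \<in> indeps M" "I \<subseteq> X 0" "card I = rank_of M (X 0)" using rank_of_obtain[OF M] .
    then show ?case by (intro bexI[of _ I]) (auto simp: Int_absorb2)
  next
    case (Suc k)
    then obtain I where I: "I \<in> indeps M" "I \<subseteq> X k" "\<forall>j\<le>k. card (I \<inter> X j) = rank_of M (X j)" by auto
    moreover have "X k \<subseteq> X (Suc k)" using X Suc by simp
    ultimately obtain J where J: "J \<in> indeps M" "I \<subseteq> J" "J \<subseteq> X (Suc k)" "card J = rank_of M (X (Suc k))"
      using indep_extend[OF M I(1), of "X (Suc k)"] by blast
    have "card (J \<inter> X j) = rank_of M (X j)" if j: "j \<le> Suc k" for j
    proof (cases "j = Suc k")
      case True
      then show ?thesis using J by (simp add: Int_absorb2)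
    next
      case False
      have "card (J \<inter> X j) \<le> rank_of M (X j)"
        using indep_subset[OF M J(1), of "J \<inter> X j"] by (intro rank_of_ge[OF M]) auto
      moreover have "card (I \<inter> X j) \<le> card (J \<inter> X j)"
        using J(2) indep_finite[OF M J(1)] by (intro card_mono) auto
      ultimately show ?thesis using I(3) j False by (simp add: le_Suc_eq)
    qed
    then show ?case using J by blast
  qed
  from this[OF order_refl] obtain B where B: "B \<in> indeps M" "B \<subseteq> X n"
    "\<forall>j\<le>n. card (B \<inter> X j) = rank_of M (X j)" by auto
  then have "card B = rank M" using assms(3) by (auto simp: rank_def Int_absorb2)
  then show ?thesis using that B bases_iff[OF M] by blast
qed

lemma sum_indicat: "finite X \<Longrightarrow> sum (indicat_real B) X = card (B \<inter> X)"
  by (simp add: indicator_def of_bool_def sum.If_cases Int_commute)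

text \<open>The greedy basis attains all the ranks along the chain simultaneously, so the polytope meets a
  system of lower bounds along a chain as soon as each bound is at most the corresponding rank.\<close>

lemma polytope_meets_iff:
  fixes X :: "nat \<Rightarrow> 'a set"
  assumes M: "is_matroid M" and X: "\<And>i j. i \<le> j \<Longrightarrow> j \<le> n \<Longrightarrow> X i \<subseteq> X j" and Xn: "X n = ground M"
  shows "(\<exists>y\<in>base_polytope M. \<forall>j\<le>n. real (\<rho> j) \<le> sum y (X j)) \<longleftrightarrow> (\<forall>j\<le>n. \<rho> j \<le> rank_of M (X j))"
proof
  have sub: "X j \<subseteq> ground M" if "j \<le> n" for j using X[OF that order_refl] Xn by simp
  {
    assume "\<exists>y\<in>base_polytope M. \<forall>j\<le>n. real (\<rho> j) \<le> sum y (X j)"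
    then obtain y where y: "y \<in> base_polytope M" "\<forall>j\<le>n. real (\<rho> j) \<le> sum y (X j)" by auto
    have "sum y (X j) \<le> rank_of M (X j)" if "j \<le> n" for j
      using y(1) sub[OF that] unfolding base_polytope_eq[OF M] by auto
    then have "real (\<rho> j) \<le> real (rank_of M (X j))" if "j \<le> n" for j
      using y(2) that order_trans by blast
    then show "\<forall>j\<le>n. \<rho> j \<le> rank_of M (X j)" by auto
  next
    assume \<rho>: "\<forall>j\<le>n. \<rho> j \<le> rank_of M (X j)"
    obtain B where B: "B \<in> bases M" "\<And>j. j \<le> n \<Longrightarrow> card (B \<inter> X j) = rank_of M (X j)"
      by (rule basis_along_chain[of M n X]) (use M X Xn in auto)
    have "sum (indicat_real B) (X j) = card (B \<inter> X j)" if "j \<le> n" for j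
      using finite_subset[OF sub[OF that] matroid_finite[OF M]] by (rule sum_indicat)
    then have "real (\<rho> j) \<le> sum (indicat_real B) (X j)" if "j \<le> n" for j
      using \<rho> B(2) that by simp
    moreover have "indicat_real B \<in> base_polytope M"
      unfolding base_polytope_def using B(1) by (intro hull_inc) auto
    ultimately show "\<exists>y\<in>base_polytope M. \<forall>j\<le>n. real (\<rho> j) \<le> sum y (X j)" by blast
  }
qed

lemma finite_bases: "is_matroid M \<Longrightarrow> finite (bases M)"
  by (rule finite_subset[of _ "Pow (ground M)"])
    (auto simp: bases_def dest: indep_subset_ground intro: matroid_finite)

text \<open>For each permutation, the permuted polytope is cut with the region where the partial sums are at
  least \<open>\<rho>\<close>. A relation between symmetrized indicators is multiplied by the indicator of that region,
  and \<open>compact_convex_relation\<close> then counts the pairs for which the intersection is nonempty.\<close>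

lemma rank_count_relation:
  fixes L :: "'i \<Rightarrow> nat matroid" and c :: "'i \<Rightarrow> real" and \<rho> :: "nat \<Rightarrow> nat"
  assumes fin: "finite I" and L: "\<And>i. i \<in> I \<Longrightarrow> is_matroid (L i)" "\<And>i. i \<in> I \<Longrightarrow> ground (L i) = {1..n}"
    and rel: "\<And>x. x \<in> coord_space n \<Longrightarrow> (\<Sum>i\<in>I. c i * sym_indicator n (base_polytope (L i)) x) = 0"
  shows "(\<Sum>i\<in>I. c i * (\<Sum>\<sigma> | \<sigma> permutes {1..n}. of_bool (\<forall>j\<le>n. \<rho> j \<le> rank_of (L i) (\<sigma> ` {1..j})))) = 0"
proof -
  let ?P = "{\<sigma>. \<sigma> permutes {1..n}}"
  define Q where "Q = {x :: nat \<Rightarrow> real. \<forall>j\<le>n. real (\<rho> j) \<le> sum x {1..j}}"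
  define K where "K p = {x. x \<circ> snd p \<in> base_polytope (L (fst p))} \<inter> Q" for p :: "'i \<times> (nat \<Rightarrow> nat)"
  have finP: "finite ?P" by (rule finite_permutations) simp
  have off: "y j = 0" if "y \<in> base_polytope (L i)" "i \<in> I" "j \<notin> {1..n}" for y i j
    using that L unfolding base_polytope_eq[OF L(1)[OF that(2)]] by (auto simp: hypersimplex_def)
  have offK: "x j = 0" if x: "x \<in> K p" "p \<in> I \<times> ?P" "j \<notin> {1..n}" for x p j
  proof -
    have \<sigma>: "snd p permutes {1..n}" using x by auto
    have "x \<circ> snd p \<in> base_polytope (L (fst p))" using x(1) by (simp add: K_def)
    moreover have "fst p \<in> I" using x(2) by auto
    ultimately have "(x \<circ> snd p) j = 0" using x(3) by (rule off)
    then show ?thesis using permutes_not_in[OF \<sigma> x(3)] by simp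
  qed
  have "closed Q"
  proof -
    have "closed {x :: nat \<Rightarrow> real. real (\<rho> j) \<le> sum x {1..j}}" for j
      by (intro closed_Collect_le continuous_on_const continuous_on_sum continuous_on_product_coordinates)
    moreover have "Q = (\<Inter>j\<in>{..n}. {x. real (\<rho> j) \<le> sum x {1..j}})" by (auto simp: Q_def)
    ultimately show ?thesis by (auto intro: closed_INT)
  qed
  have "convex Q"
  proof (rule convexI)
    fix x y :: "nat \<Rightarrow> real" and u v :: real
    assume xy: "x \<in> Q" "y \<in> Q" and uv: "0 \<le> u" "0 \<le> v" "u + v = 1"
    have "real (\<rho> j) \<le> sum (u *\<^sub>R x + v *\<^sub>R y) {1..j}" if "j \<le> n" for j
    proof -
      have "sum (u *\<^sub>R x + v *\<^sub>R y) {1..j} = u * sum x {1..j} + v * sum y {1..j}"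
        by (simp add: scaleR_fun_def sum.distrib sum_distrib_left)
      moreover have "u * real (\<rho> j) + v * real (\<rho> j) \<le> u * sum x {1..j} + v * sum y {1..j}"
        using xy uv that by (intro add_mono mult_left_mono) (auto simp: Q_def)
      moreover have "u * real (\<rho> j) + v * real (\<rho> j) = real (\<rho> j)"
        using uv(3) by (simp flip: distrib_right)
      ultimately show ?thesis by simp
    qed
    then show "u *\<^sub>R x + v *\<^sub>R y \<in> Q" by (simp add: Q_def)
  qed
  have cvx: "convex (K p)" if p: "p \<in> I \<times> ?P" for p
    unfolding K_def
  proof (rule convex_Int[OF convexI \<open>convex Q\<close>])
    fix x y :: "nat \<Rightarrow> real" and u v :: real
    assume xy: "x \<in> {x. x \<circ> snd p \<in> base_polytope (L (fst p))}"
      "y \<in> {x. x \<circ> snd p \<in> base_polytope (L (fst p))}" and uv: "0 \<le> u" "0 \<le> v" "u + v = 1"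
    have "(u *\<^sub>R x + v *\<^sub>R y) \<circ> snd p = u *\<^sub>R (x \<circ> snd p) + v *\<^sub>R (y \<circ> snd p)"
      by (auto simp: scaleR_fun_def)
    moreover have "convex (base_polytope (L (fst p)))" by (simp add: base_polytope_def convex_convex_hull)
    ultimately show "u *\<^sub>R x + v *\<^sub>R y \<in> {x. x \<circ> snd p \<in> base_polytope (L (fst p))}"
      using xy uv by (simp add: convexD)
  qed
  have cpt: "compact (K p)" if p: "p \<in> I \<times> ?P" for p
  proof -
    have \<sigma>: "snd p permutes {1..n}" using p by auto
    have "{x. x \<circ> snd p \<in> base_polytope (L (fst p))} = (\<lambda>y. y \<circ> inv (snd p)) ` base_polytope (L (fst p))"
    proof (intro equalityI subsetI)
      fix x assume "x \<in> {x. x \<circ> snd p \<in> base_polytope (L (fst p))}"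
      moreover have "x = (x \<circ> snd p) \<circ> inv (snd p)"
        using permutes_inverses[OF \<sigma>] by auto
      ultimately show "x \<in> (\<lambda>y. y \<circ> inv (snd p)) ` base_polytope (L (fst p))" by blast
    next
      fix x assume "x \<in> (\<lambda>y. y \<circ> inv (snd p)) ` base_polytope (L (fst p))"
      then obtain y where "y \<in> base_polytope (L (fst p))" "x = y \<circ> inv (snd p)" by auto
      moreover then have "x \<circ> snd p = y" using permutes_inverses[OF \<sigma>] by auto
      ultimately show "x \<in> {x. x \<circ> snd p \<in> base_polytope (L (fst p))}" by simp
    qed
    moreover have "compact ((\<lambda>y. y \<circ> inv (snd p)) ` base_polytope (L (fst p)))"
    proof (rule compact_continuous_image)
      show "compact (base_polytope (L (fst p)))"
        unfolding base_polytope_def using finite_bases[of "L (fst p)"] L(1)[of "fst p"] p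
        by (intro compact_convex_hull_finite finite_imageI) auto
      show "continuous_on (base_polytope (L (fst p))) (\<lambda>y. y \<circ> inv (snd p))"
        unfolding o_def
        by (intro continuous_on_coordinatewise_then_product
            continuous_on_subset[OF continuous_on_product_coordinates]) simp
    qed
    ultimately show ?thesis unfolding K_def using \<open>closed Q\<close> by (auto intro: compact_Int_closed)
  qed
  have relK: "(\<Sum>p\<in>I \<times> ?P. c (fst p) * of_bool (x \<in> K p)) = 0" for x
  proof (cases "x \<in> coord_space n \<inter> Q")
    case True
    have eq: "of_bool (x \<in> K (i, \<sigma>)) = indicat_real (base_polytope (L i)) (\<lambda>k. x (\<sigma> k))" for i \<sigma>
      using True by (simp add: K_def indicator_def o_def)
    have "(\<Sum>\<sigma>\<in>?P. c i * of_bool (x \<in> K (i, \<sigma>))) = fact n * (c i * sym_indicator n (base_polytope (L i)) x)" for i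
      unfolding eq sym_indicator_def by (simp add: sum_distrib_left)
    then have "(\<Sum>p\<in>I \<times> ?P. c (fst p) * of_bool (x \<in> K p)) =
        (\<Sum>i\<in>I. fact n * (c i * sym_indicator n (base_polytope (L i)) x))"
      by (simp add: sum.cartesian_product' split_def)
    also have "\<dots> = 0" using rel[of x] True by (simp add: sum_distrib_left[symmetric])
    finally show ?thesis .
  next
    case False
    then have "x \<notin> K p" if "p \<in> I \<times> ?P" for p
      using offK[OF _ that] by (auto simp: coord_space_def K_def)
    then show ?thesis by (intro sum.neutral) auto
  qed
  have ne: "(\<exists>y\<in>K (i, \<sigma>). \<forall>j. j \<notin> {1..n} \<longrightarrow> y j = 0) \<longleftrightarrow>
      (\<forall>j\<le>n. \<rho> j \<le> rank_of (L i) (inv \<sigma> ` {1..j}))" if i: "i \<in> I" and \<sigma>: "\<sigma> permutes {1..n}" for i \<sigma>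
  proof -
    have "(\<exists>y\<in>K (i, \<sigma>). \<forall>j. j \<notin> {1..n} \<longrightarrow> y j = 0) \<longleftrightarrow> (\<exists>x. x \<in> K (i, \<sigma>))"
      using offK[of _ "(i, \<sigma>)"] i \<sigma> by blast
    also have "\<dots> \<longleftrightarrow> (\<exists>y\<in>base_polytope (L i). \<forall>j\<le>n. real (\<rho> j) \<le> sum y (inv \<sigma> ` {1..j}))"
    proof -
      have s: "sum (y \<circ> inv \<sigma>) {1..j} = sum y (inv \<sigma> ` {1..j})" for y :: "nat \<Rightarrow> real" and j
        using sum.reindex[of "inv \<sigma>" "{1..j}" y] permutes_inj[OF permutes_inv[OF \<sigma>]]
        by (metis inj_on_subset subset_UNIV)
      show ?thesis
      proof
        assume "\<exists>x. x \<in> K (i, \<sigma>)"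
        then obtain x where x: "x \<circ> \<sigma> \<in> base_polytope (L i)" "x \<in> Q" by (auto simp: K_def)
        have "x = (x \<circ> \<sigma>) \<circ> inv \<sigma>" using permutes_inverses[OF \<sigma>] by auto
        then have "sum x {1..j} = sum (x \<circ> \<sigma>) (inv \<sigma> ` {1..j})" for j using s by metis
        then show "\<exists>y\<in>base_polytope (L i). \<forall>j\<le>n. real (\<rho> j) \<le> sum y (inv \<sigma> ` {1..j})"
          using x by (intro bexI[of _ "x \<circ> \<sigma>"]) (auto simp: Q_def)
      next
        assume "\<exists>y\<in>base_polytope (L i). \<forall>j\<le>n. real (\<rho> j) \<le> sum y (inv \<sigma> ` {1..j})"
        then obtain y where y: "y \<in> base_polytope (L i)" "\<forall>j\<le>n. real (\<rho> j) \<le> sum y (inv \<sigma> ` {1..j})" by auto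
        have "(y \<circ> inv \<sigma>) \<circ> \<sigma> = y" using permutes_inverses[OF \<sigma>] by auto
        then have "y \<circ> inv \<sigma> \<in> K (i, \<sigma>)" using y s by (simp add: K_def Q_def del: comp_apply)
        then show "\<exists>x. x \<in> K (i, \<sigma>)" by blast
      qed
    qed
    also have "\<dots> \<longleftrightarrow> (\<forall>j\<le>n. \<rho> j \<le> rank_of (L i) (inv \<sigma> ` {1..j}))"
    proof (rule polytope_meets_iff[OF L(1)[OF i]])
      show "inv \<sigma> ` {1..n} = ground (L i)" using L(2)[OF i] permutes_image[OF permutes_inv[OF \<sigma>]] by simp
    qed auto
    finally show ?thesis .
  qed
  have "(\<Sum>p\<in>I \<times> ?P. c (fst p) * of_bool (\<exists>y\<in>K p. \<forall>j. j \<notin> {1..n} \<longrightarrow> y j = (0::real))) = 0"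
    using compact_convex_relation[of "I \<times> ?P" K "\<lambda>p. c (fst p)" "{1..n}" "\<lambda>_. 0"]
      fin finP cpt cvx relK by blast
  moreover have "(\<Sum>p\<in>I \<times> ?P. c (fst p) * of_bool (\<exists>y\<in>K p. \<forall>j. j \<notin> {1..n} \<longrightarrow> y j = (0::real))) =
    (\<Sum>i\<in>I. \<Sum>\<sigma>\<in>?P. c i * of_bool (\<forall>j\<le>n. \<rho> j \<le> rank_of (L i) (inv \<sigma> ` {1..j})))"
    unfolding sum.cartesian_product
  proof (intro sum.cong refl)
    fix p assume "p \<in> I \<times> ?P"
    then obtain i \<sigma> where p: "p = (i, \<sigma>)" "i \<in> I" "\<sigma> permutes {1..n}" by auto
    show "c (fst p) * of_bool (\<exists>y\<in>K p. \<forall>j. j \<notin> {1..n} \<longrightarrow> y j = (0::real)) =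
      (case p of (i, \<sigma>) \<Rightarrow> c i * of_bool (\<forall>j\<le>n. \<rho> j \<le> rank_of (L i) (inv \<sigma> ` {1..j})))"
      unfolding p(1) prod.case fst_conv ne[OF p(2,3)] ..
  qed
  moreover have "(\<Sum>\<sigma>\<in>?P. of_bool (\<forall>j\<le>n. \<rho> j \<le> rank_of (L i) (\<sigma> ` {1..j}))) =
      (\<Sum>\<sigma>\<in>?P. of_bool (\<forall>j\<le>n. \<rho> j \<le> rank_of (L i) (inv \<sigma> ` {1..j})) :: real)" for i
    by (rule sum_permutations_inverse)
  ultimately show ?thesis by (simp add: sum_distrib_left)
qed

text \<open>The ranks of the initial segments of an ordering of the ground set; the sum of all monomials
  labelled by these sequences, over all orderings, is a form of Derksen's invariant. It is
  recorded here by its values on all test functions \<open>\<phi>\<close>, which turns multilinear identities into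
  equalities of iterated sums.\<close>

definition flag_ranks :: "'a matroid \<Rightarrow> 'a list \<Rightarrow> nat list" where
  "flag_ranks M xs = map (\<lambda>j. rank_of M (set (take j xs))) [0..<Suc (length xs)]"

definition flag_sum :: "'a matroid \<Rightarrow> (nat list \<Rightarrow> real) \<Rightarrow> real" where
  "flag_sum M \<phi> = (\<Sum>xs\<in>permutations_of_set (ground M). \<phi> (flag_ranks M xs))"

lemma bij_betw_permutations:
  "bij_betw (\<lambda>\<sigma>. map \<sigma> [1..<Suc n]) {\<sigma>. \<sigma> permutes {1..n}} (permutations_of_set {1..n})"
proof -
  let ?P = "{\<sigma>. \<sigma> permutes {1..n}}" and ?f = "\<lambda>\<sigma>. map \<sigma> [1..<Suc n]"
  have "inj_on ?f ?P"
  proof (rule inj_onI)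
    fix \<sigma> \<tau> assume st: "\<sigma> \<in> ?P" "\<tau> \<in> ?P" "?f \<sigma> = ?f \<tau>"
    then have "\<forall>i\<in>set [1..<Suc n]. \<sigma> i = \<tau> i" by (simp only: map_eq_conv)
    then have "\<sigma> i = \<tau> i" if "i \<in> {1..n}" for i using that by (simp del: upt_Suc)
    moreover have "\<sigma> i = \<tau> i" if "i \<notin> {1..n}" for i
      using permutes_not_in that st(1,2) by (metis mem_Collect_eq)
    ultimately show "\<sigma> = \<tau>" by blast
  qed
  moreover have "?f ` ?P \<subseteq> permutations_of_set {1..n}"
  proof
    fix xs assume "xs \<in> ?f ` ?P"
    then obtain \<sigma> where s: "\<sigma> permutes {1..n}" "xs = ?f \<sigma>" by auto
    have "set [1..<Suc n] = {1..n}" by auto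
    then have "set xs = {1..n}" using permutes_image[OF s(1)] s(2) by (metis set_map)
    moreover have "distinct xs"
      using permutes_inj[OF s(1)] s(2) by (auto simp: distinct_map intro: inj_on_subset)
    ultimately show "xs \<in> permutations_of_set {1..n}" by (auto simp: permutations_of_set_def)
  qed
  moreover have "card ?P = card (permutations_of_set {1..n})"
    using card_permutations[of "{1..n}" n] card_permutations_of_set[of "{1..n}"] by simp
  ultimately show ?thesis
    by (metis bij_betw_def card_image card_subset_eq finite_atLeastAtMost finite_permutations_of_set)
qed

lemma flag_sum_permutes:
  assumes "ground L = {1..n}"
  shows "flag_sum L \<phi> =
    (\<Sum>\<sigma> | \<sigma> permutes {1..n}. \<phi> (map (\<lambda>j. rank_of L (\<sigma> ` {1..j})) [0..<Suc n]))"
proof -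
  have "flag_ranks L (map \<sigma> [1..<Suc n]) = map (\<lambda>j. rank_of L (\<sigma> ` {1..j})) [0..<Suc n]" for \<sigma>
  proof -
    have "set (take j (map \<sigma> [1..<Suc n])) = \<sigma> ` {1..j}" if "j < Suc n" for j
    proof -
      have "take j [1..<Suc n] = [1..<Suc j]" using take_upt[of 1 j "Suc n"] that by (simp del: upt_Suc)
      then show ?thesis by (auto simp: take_map)
    qed
    then show ?thesis by (simp add: flag_ranks_def del: upt_Suc)
  qed
  then show ?thesis
    unfolding flag_sum_def assms
    using sum.reindex_bij_betw[OF bij_betw_permutations, of "\<lambda>xs. \<phi> (flag_ranks L xs)" n] by simp
qed

lemma list_all2_le_sum_list:
  fixes s t :: "nat list"
  assumes "list_all2 (\<le>) s t"
  shows "sum_list s \<le> sum_list t \<and> (sum_list s = sum_list t \<longrightarrow> s = t)"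
  using assms by (induction rule: list_all2_induct) auto

text \<open>The counts of orderings with rank sequence at least \<open>v\<close> satisfy the relation. Passing to the
  sequences equal to \<open>v\<close> is inversion over a finite poset: at a sequence of largest total whose
  coefficient does not vanish, all other summands drop out.\<close>

lemma flag_sum_relation:
  fixes L :: "'i \<Rightarrow> nat matroid" and c :: "'i \<Rightarrow> real"
  assumes fin: "finite I" and L: "\<And>i. i \<in> I \<Longrightarrow> is_matroid (L i)" "\<And>i. i \<in> I \<Longrightarrow> ground (L i) = {1..n}"
    and rel: "\<And>x. x \<in> coord_space n \<Longrightarrow> (\<Sum>i\<in>I. c i * sym_indicator n (base_polytope (L i)) x) = 0"
  shows "(\<Sum>i\<in>I. c i * flag_sum (L i) \<phi>) = 0"
proof -
  let ?O = "permutations_of_set {1..n}"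
  define W where "W = (\<Union>i\<in>I. flag_ranks (L i) ` ?O)"
  define g where "g w = (\<Sum>i\<in>I. c i * flag_sum (L i) (\<lambda>s. of_bool (s = w)))" for w
  have finO: "finite ?O" by simp
  have finW: "finite W" unfolding W_def using fin by simp
  have decomp: "(\<Sum>i\<in>I. c i * flag_sum (L i) \<psi>) = (\<Sum>w\<in>W. g w * \<psi> w)" for \<psi>
  proof -
    have "flag_sum (L i) \<psi> = (\<Sum>w\<in>W. flag_sum (L i) (\<lambda>s. of_bool (s = w)) * \<psi> w)" if i: "i \<in> I" for i
    proof -
      have "\<psi> (flag_ranks (L i) xs) = (\<Sum>w\<in>W. of_bool (flag_ranks (L i) xs = w) * \<psi> w)" if "xs \<in> ?O" for xs
      proof -
        have "flag_ranks (L i) xs \<in> W" using that i by (auto simp: W_def)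
        moreover have "(\<Sum>w\<in>W. of_bool (flag_ranks (L i) xs = w) * \<psi> w) =
            (\<Sum>w\<in>W. if flag_ranks (L i) xs = w then \<psi> w else 0)" by (intro sum.cong) auto
        ultimately show ?thesis using finW by simp
      qed
      then have "flag_sum (L i) \<psi> = (\<Sum>xs\<in>?O. \<Sum>w\<in>W. of_bool (flag_ranks (L i) xs = w) * \<psi> w)"
        unfolding flag_sum_def L(2)[OF i] by (intro sum.cong) auto
      also have "\<dots> = (\<Sum>w\<in>W. \<Sum>xs\<in>?O. of_bool (flag_ranks (L i) xs = w) * \<psi> w)" by (rule sum.swap)
      finally show ?thesis unfolding flag_sum_def L(2)[OF i] by (simp add: sum_distrib_right)
    qed
    then have "(\<Sum>i\<in>I. c i * flag_sum (L i) \<psi>) =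
        (\<Sum>i\<in>I. \<Sum>w\<in>W. c i * flag_sum (L i) (\<lambda>s. of_bool (s = w)) * \<psi> w)"
      by (intro sum.cong) (auto simp: sum_distrib_left mult.assoc)
    also have "\<dots> = (\<Sum>w\<in>W. \<Sum>i\<in>I. c i * flag_sum (L i) (\<lambda>s. of_bool (s = w)) * \<psi> w)" by (rule sum.swap)
    finally show ?thesis by (simp add: g_def sum_distrib_right)
  qed
  have len: "length w = Suc n" if "w \<in> W" for w
    using that by (auto simp: W_def flag_ranks_def length_finite_permutations_of_set)
  have upper: "(\<Sum>w\<in>W. g w * of_bool (list_all2 (\<le>) v w)) = 0" if v: "v \<in> W" for v
  proof -
    have "flag_sum (L i) (\<lambda>w. of_bool (list_all2 (\<le>) v w)) =
        (\<Sum>\<sigma> | \<sigma> permutes {1..n}. of_bool (\<forall>j\<le>n. v ! j \<le> rank_of (L i) (\<sigma> ` {1..j})))" if "i \<in> I" for i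
      unfolding flag_sum_permutes[OF L(2)[OF that]]
      by (rule sum.cong[OF refl]) (simp add: list_all2_conv_all_nth len[OF v] less_Suc_eq_le del: upt_Suc)
    then show ?thesis
      using rank_count_relation[OF fin L rel, of "\<lambda>j. v ! j"] unfolding decomp[symmetric] by simp
  qed
  have "g w = 0" if "w \<in> W" for w
  proof (rule ccontr)
    assume "g w \<noteq> 0"
    let ?N = "{w \<in> W. g w \<noteq> 0}"
    have "finite (sum_list ` ?N)" "sum_list ` ?N \<noteq> {}" using finW \<open>g w \<noteq> 0\<close> that by auto
    then have "Max (sum_list ` ?N) \<in> sum_list ` ?N" by (rule Max_in)
    then obtain v where v: "v \<in> W" "g v \<noteq> 0" "sum_list v = Max (sum_list ` ?N)" by auto
    have "g u * of_bool (list_all2 (\<le>) v u) = (if u = v then g v else 0)" if u: "u \<in> W" for u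
    proof (cases "u = v \<or> \<not> list_all2 (\<le>) v u \<or> g u = 0")
      case False
      then have "sum_list u \<le> sum_list v" using v(3) u \<open>finite (sum_list ` ?N)\<close> by simp
      then show ?thesis using False list_all2_le_sum_list[of v u] by auto
    qed (auto simp: list_all2_refl)
    then have "(\<Sum>u\<in>W. g u * of_bool (list_all2 (\<le>) v u)) = (\<Sum>u\<in>W. if u = v then g v else 0)"
      by (rule sum.cong[OF refl])
    then show False using upper[OF v(1)] v finW by simp
  qed
  then show ?thesis unfolding decomp by simp
qed

section \<open>Flag sums of Schubert matroids\<close>

lemma permutations_of_set_inj_image:
  assumes "inj_on g E"
  shows "bij_betw (map g) (permutations_of_set E) (permutations_of_set (g ` E))"
proof -
  have "inj_on (map g) (permutations_of_set E)"
  proof (rule inj_onI)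
    fix xs ys assume "xs \<in> permutations_of_set E" "ys \<in> permutations_of_set E" "map g xs = map g ys"
    then show "xs = ys"
      using assms by (intro map_inj_on[of g xs ys]) (auto simp: permutations_of_set_def)
  qed
  then show ?thesis
    unfolding bij_betw_def using permutations_of_set_image_inj[OF assms] by simp
qed

lemma flag_sum_relabel:
  assumes M: "is_matroid M" and g: "inj_on g (ground M)"
  shows "flag_sum (relabel g M) \<phi> = flag_sum M \<phi>"
proof -
  have "flag_ranks (relabel g M) (map g xs) = flag_ranks M xs"
    if "xs \<in> permutations_of_set (ground M)" for xs
  proof -
    have "set (take j xs) \<subseteq> ground M" for j
      using that set_take_subset[of j xs] by (auto simp: permutations_of_set_def)
    then have "rank_of (relabel g M) (g ` set (take j xs)) = rank_of M (set (take j xs))" for j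
      using rank_of_relabel[OF M g] by blast
    then show ?thesis by (simp add: flag_ranks_def take_map)
  qed
  then show ?thesis
    unfolding flag_sum_def relabel_sel
    using sum.reindex_bij_betw[OF permutations_of_set_inj_image[OF g], of "\<lambda>xs. \<phi> (flag_ranks (relabel g M) xs)"]
    by simp
qed

lemma flag_sum_isomorphic:
  assumes "is_matroid M" "is_matroid L" "isomorphic M L"
  shows "flag_sum L \<phi> = flag_sum M \<phi>"
  by (metis assms flag_sum_relabel isomorphic_eq_relabel)

definition initial_ranks :: "nat \<Rightarrow> nat set \<Rightarrow> nat list" where
  "initial_ranks n A = map (\<lambda>j. card (A \<inter> {..j})) [0..<Suc n]"

lemma initial_ranks_inject:
  assumes "A \<subseteq> {1..n}" "B \<subseteq> {1..n}" "initial_ranks n A = initial_ranks n B"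
  shows "A = B"
proof -
  have eq: "card (A \<inter> {..j}) = card (B \<inter> {..j})" if "j \<le> n" for j
  proof -
    have "\<forall>j\<in>set [0..<Suc n]. card (A \<inter> {..j}) = card (B \<inter> {..j})"
      using assms(3) unfolding initial_ranks_def by (simp only: map_eq_conv)
    then show ?thesis using that by (simp del: upt_Suc)
  qed
  have step: "card (C \<inter> {..i}) = card (C \<inter> {..i - 1}) + of_bool (i \<in> C)"
    if "C \<subseteq> {1..n}" "1 \<le> i" for C i
  proof -
    have "C \<inter> {..i} = (if i \<in> C then insert i (C \<inter> {..i - 1}) else C \<inter> {..i - 1})"
      using that by (auto simp: le_less intro: Suc_leI)
    then show ?thesis using that finite_subset[OF that(1)] by auto
  qed
  have "i \<in> A \<longleftrightarrow> i \<in> B" if i: "i \<in> {1..n}" for i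
  proof -
    have "card (A \<inter> {..i}) = card (B \<inter> {..i})" "card (A \<inter> {..i - 1}) = card (B \<inter> {..i - 1})"
      using i by (auto intro!: eq)
    then have "of_bool (i \<in> A) = (of_bool (i \<in> B) :: nat)"
      using step[OF assms(1), of i] step[OF assms(2), of i] i by simp
    then show ?thesis by (cases "i \<in> A"; cases "i \<in> B") auto
  qed
  then show ?thesis using assms by blast
qed

lemma flag_ranks_schubert_identity:
  assumes "A \<subseteq> {1..n}"
  shows "flag_ranks (schubert {1..n} A) [1..<Suc n] = initial_ranks n A"
proof -
  have "rank_of (schubert {1..n} A) (set (take j [1..<Suc n])) = card (A \<inter> {..j})" if "j < Suc n" for j
  proof -
    have "take j [1..<Suc n] = [1..<Suc j]" using take_upt[of 1 j "Suc n"] that by (simp del: upt_Suc)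
    then have "set (take j [1..<Suc n]) = {1..n} \<inter> {..j}" using that by (auto simp del: upt_Suc)
    then show ?thesis using rank_of_schubert_initial[of "{1..n}" A j] assms by simp
  qed
  then show ?thesis by (simp add: flag_ranks_def initial_ranks_def del: upt_Suc)
qed

lemma flag_ranks_schubert_ge:
  assumes A: "A \<subseteq> {1..n}" and xs: "xs \<in> permutations_of_set {1..n}"
  shows "list_all2 (\<le>) (initial_ranks n A) (flag_ranks (schubert {1..n} A) xs)"
proof -
  have len: "length xs = n" using length_finite_permutations_of_set[OF xs] by simp
  have "card (A \<inter> {..j}) \<le> rank_of (schubert {1..n} A) (set (take j xs))" if "j < Suc n" for j
  proof -
    have "distinct xs" "set xs = {1..n}" using xs by (auto simp: permutations_of_set_def)
    then have "card (set (take j xs)) = j" "set (take j xs) \<subseteq> {1..n}"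
      using that len set_take_subset[of j xs] distinct_card[of "take j xs"] by auto
    moreover have "A \<inter> {1..j} = A \<inter> {..j}" using A by auto
    ultimately show ?thesis using rank_of_schubert_ge[OF A, of "set (take j xs)"] by simp
  qed
  then show ?thesis
    by (simp add: list_all2_conv_all_nth flag_ranks_def initial_ranks_def len del: upt_Suc)
qed

text \<open>The matrix of multiplicities is triangular: the identity ordering realizes the rank sequence of
  initial segments, and every other ordering gives a sequence that is at least as large.\<close>

lemma schubert_flag_sums_independent:
  assumes \<A>: "\<A> \<subseteq> Pow {1..n}"
    and rel: "\<And>\<phi>. (\<Sum>A\<in>\<A>. c A * flag_sum (schubert {1..n} A) \<phi>) = 0" and "A \<in> \<A>"
  shows "c A = 0"
proof (rule ccontr)
  assume "c A \<noteq> 0"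
  have fin: "finite \<A>" using \<A> finite_subset by (metis finite_Pow_iff finite_atLeastAtMost)
  let ?m = "\<lambda>B. sum_list (initial_ranks n B)"
  obtain B where B: "B \<in> \<A>" "c B \<noteq> 0" and min: "\<And>C. C \<in> \<A> \<Longrightarrow> c C \<noteq> 0 \<Longrightarrow> ?m B \<le> ?m C"
    using ex_has_least_nat[of "\<lambda>B. B \<in> \<A> \<and> c B \<noteq> 0" A ?m] \<open>A \<in> \<A>\<close> \<open>c A \<noteq> 0\<close> by blast
  let ?\<phi> = "\<lambda>s. of_bool (s = initial_ranks n B) :: real"
  have "c C * flag_sum (schubert {1..n} C) ?\<phi> = 0" if C: "C \<in> \<A> - {B}" for C
  proof (cases "c C = 0")
    case False
    have "flag_ranks (schubert {1..n} C) xs \<noteq> initial_ranks n B" if xs: "xs \<in> permutations_of_set {1..n}" for xs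
    proof
      assume eq: "flag_ranks (schubert {1..n} C) xs = initial_ranks n B"
      have sub: "C \<subseteq> {1..n}" "B \<subseteq> {1..n}" using C \<A> B by auto
      have "list_all2 (\<le>) (initial_ranks n C) (initial_ranks n B)"
        using flag_ranks_schubert_ge[OF sub(1) xs] unfolding eq .
      moreover have "?m B \<le> ?m C" using min C False by blast
      ultimately have "initial_ranks n C = initial_ranks n B"
        using list_all2_le_sum_list by (metis le_antisym)
      then show False using initial_ranks_inject[OF sub] C by simp
    qed
    then show ?thesis by (simp add: flag_sum_def)
  qed simp
  then have "(\<Sum>C\<in>\<A>. c C * flag_sum (schubert {1..n} C) ?\<phi>) = c B * flag_sum (schubert {1..n} B) ?\<phi>"
    using fin B(1) by (subst sum.remove[OF fin B(1)]) (simp add: sum.neutral)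
  then have "flag_sum (schubert {1..n} B) ?\<phi> = 0" using rel[of ?\<phi>] B(2) by simp
  moreover have "flag_sum (schubert {1..n} B) ?\<phi> \<ge> ?\<phi> (flag_ranks (schubert {1..n} B) [1..<Suc n])"
    unfolding flag_sum_def schubert_ground
  proof (rule member_le_sum)
    have "set [1..<Suc n] = {1..n}" by auto
    then show "[1..<Suc n] \<in> permutations_of_set {1..n}"
      unfolding permutations_of_set_def using distinct_upt by blast
  qed auto
  ultimately show False
    using flag_ranks_schubert_identity[of B n] B(1) \<A> by (auto simp del: upt_Suc)
qed

lemma schubert_isomorphic_imp_eq:
  assumes "A \<subseteq> {1..n}" "B \<subseteq> {1..n}" "isomorphic (schubert {1..n} A) (schubert {1..n} B)"
  shows "A = B"
proof (rule ccontr)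
  assume ne: "A \<noteq> B"
  let ?c = "\<lambda>C. if C = A then 1 else - 1 :: real"
  have "flag_sum (schubert {1..n} B) \<phi> = flag_sum (schubert {1..n} A) \<phi>" for \<phi>
    by (rule flag_sum_isomorphic[OF is_matroid_schubert is_matroid_schubert assms(3)]) auto
  then have "(\<Sum>C\<in>{A, B}. ?c C * flag_sum (schubert {1..n} C) \<phi>) = 0" for \<phi>
    using ne by simp
  then have "?c A = 0" using schubert_flag_sums_independent[of "{A, B}" n ?c A] assms by blast
  then show False by simp
qed

section \<open>Flag sums of free products\<close>

text \<open>The last equation ends the recursion at the empty pattern; it also supplies a default value when a
  list is too short for its pattern.\<close>

fun merge :: "bool list \<Rightarrow> 'a list \<Rightarrow> 'a list \<Rightarrow> 'a list" where
  "merge (True # p) (x # xs) ys = x # merge p xs ys"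
| "merge (False # p) xs (y # ys) = y # merge p xs ys"
| "merge _ _ _ = []"

text \<open>An ordering of a disjoint union is an ordering of each part together with the pattern that tells
  which part each entry comes from.\<close>

lemma merge_filter: "merge (map P zs) (filter P zs) (filter (\<lambda>z. \<not> P z) zs) = zs"
proof (induction zs)
  case (Cons z zs)
  then show ?case by (cases "P z") auto
qed simp

lemma filter_True_False_empty:
  "filter (\<lambda>b. b) p = [] \<Longrightarrow> filter Not p = [] \<Longrightarrow> p = []"
  by (cases p) (auto split: if_splits)

lemma filter_merge:
  assumes "length xs = length (filter (\<lambda>b. b) p)" "length ys = length (filter (\<lambda>b. \<not> b) p)"
    and "\<forall>x\<in>set xs. P x" "\<forall>y\<in>set ys. \<not> P y"
  shows "filter P (merge p xs ys) = xs" "filter (\<lambda>z. \<not> P z) (merge p xs ys) = ys"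
    "map P (merge p xs ys) = p" "set (merge p xs ys) = set xs \<union> set ys"
    "length (merge p xs ys) = length p"
  using assms by (induction p xs ys rule: merge.induct) (auto split: if_splits dest!: filter_True_False_empty)

definition patterns :: "nat \<Rightarrow> nat \<Rightarrow> bool list set" where
  "patterns n n' = {p. length (filter (\<lambda>b. b) p) = n \<and> length (filter (\<lambda>b. \<not> b) p) = n'}"

lemma sum_permutations_of_Un:
  fixes h :: "bool list \<Rightarrow> 'a list \<Rightarrow> 'a list \<Rightarrow> real"
  assumes fin: "finite E" "finite E'" and dis: "E \<inter> E' = {}"
  shows "(\<Sum>zs\<in>permutations_of_set (E \<union> E'). h (map (\<lambda>z. z \<in> E) zs) (filter (\<lambda>z. z \<in> E) zs) (filter (\<lambda>z. z \<notin> E) zs))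
    = (\<Sum>xs\<in>permutations_of_set E. \<Sum>ys\<in>permutations_of_set E'. \<Sum>p\<in>patterns (card E) (card E'). h p xs ys)"
proof -
  let ?P = "permutations_of_set E" and ?P' = "permutations_of_set E'"
  let ?f = "\<lambda>zs. filter (\<lambda>z. z \<in> E) zs" and ?g = "\<lambda>zs. filter (\<lambda>z. z \<notin> E) zs"
    and ?m = "\<lambda>zs. map (\<lambda>z. z \<in> E) zs"
  let ?pat = "patterns (card E) (card E')"
  have "(\<Sum>zs\<in>permutations_of_set (E \<union> E'). h (?m zs) (?f zs) (?g zs))
    = (\<Sum>t\<in>?P \<times> ?P' \<times> ?pat. h (snd (snd t)) (fst t) (fst (snd t)))"
  proof (rule sum.reindex_bij_witness[of _ "\<lambda>t. merge (snd (snd t)) (fst t) (fst (snd t))"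
        "\<lambda>zs. (?f zs, ?g zs, ?m zs)"])
    fix zs assume "zs \<in> permutations_of_set (E \<union> E')"
    then have zs: "distinct zs" "set zs = E \<union> E'" by (auto simp: permutations_of_set_def)
    show "merge (snd (snd (?f zs, ?g zs, ?m zs)))
        (fst (?f zs, ?g zs, ?m zs))
        (fst (snd (?f zs, ?g zs, ?m zs))) = zs"
      using merge_filter[of "\<lambda>z. z \<in> E" zs] by simp
    have sets: "set (?f zs) = E" "set (?g zs) = E'"
      using zs dis by auto
    then have "length (?f zs) = card E" "length (?g zs) = card E'"
      using zs(1) by (metis distinct_card distinct_filter)+
    then have "?m zs \<in> ?pat"
      by (simp add: patterns_def filter_map o_def)
    then show "(?f zs, ?g zs, ?m zs) \<in> ?P \<times> ?P' \<times> ?pat"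
      using sets zs(1) by (simp add: permutations_of_set_def)
  next
    fix t assume "t \<in> ?P \<times> ?P' \<times> ?pat"
    then obtain xs ys p where t: "t = (xs, ys, p)" "xs \<in> ?P" "ys \<in> ?P'" "p \<in> ?pat" by auto
    have xs: "distinct xs" "set xs = E" "length xs = card E" and ys: "distinct ys" "set ys = E'" "length ys = card E'"
      using t by (auto simp: permutations_of_set_def distinct_card)
    have len: "length xs = length (filter (\<lambda>b. b) p)" "length ys = length (filter (\<lambda>b. \<not> b) p)"
      using t xs ys by (auto simp: patterns_def)
    have ins: "\<forall>x\<in>set xs. x \<in> E" "\<forall>y\<in>set ys. y \<notin> E" using xs ys dis by auto
    note m = filter_merge[OF len, of "\<lambda>z. z \<in> E", OF ins]
    let ?zs = "merge (snd (snd t)) (fst t) (fst (snd t))"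
    show "(?f ?zs, ?g ?zs, ?m ?zs) = t"
      using m t(1) by simp
    have "length p = card E + card E'"
      using len xs ys sum_length_filter_compl[of "\<lambda>b. b" p] by simp
    then have "card (set (merge p xs ys)) = length (merge p xs ys)"
      using m(4,5) xs ys card_Un_disjoint[OF fin dis] by simp
    then have "distinct (merge p xs ys)" by (rule card_distinct)
    then show "merge (snd (snd t)) (fst t) (fst (snd t)) \<in> permutations_of_set (E \<union> E')"
      using m(4) xs ys t(1) by (simp add: permutations_of_set_def)
  qed simp
  also have "\<dots> = (\<Sum>xs\<in>?P. \<Sum>ys\<in>?P'. \<Sum>p\<in>?pat. h p xs ys)"
    by (simp add: sum.cartesian_product split_def)
  finally show ?thesis .
qed

text \<open>The first \<open>j\<close> entries of a merged ordering consist of \<open>k\<close> entries of the first and \<open>j - k\<close> entries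
  of the second ordering; the formula is the rank function of the free product.\<close>

definition product_ranks :: "nat \<Rightarrow> bool list \<Rightarrow> nat list \<Rightarrow> nat list \<Rightarrow> nat list" where
  "product_ranks r p s t = map (\<lambda>j. let k = length (filter (\<lambda>b. b) (take j p))
     in min (s ! k + (j - k)) (r + t ! (j - k))) [0..<Suc (length p)]"

lemma take_length_filter: "take (length (filter P (take j zs))) (filter P zs) = filter P (take j zs)"
proof -
  have "filter P zs = filter P (take j zs) @ filter P (drop j zs)"
    by (metis append_take_drop_id filter_append)
  then show ?thesis by simp
qed

lemma flag_ranks_nth: "k \<le> length xs \<Longrightarrow> flag_ranks M xs ! k = rank_of M (set (take k xs))"
  by (simp add: flag_ranks_def del: upt_Suc)

lemma flag_ranks_free_product:
  assumes M: "is_matroid M" and M': "is_matroid M'" and dis: "ground M \<inter> ground M' = {}"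
    and zs: "zs \<in> permutations_of_set (ground M \<union> ground M')"
  shows "flag_ranks (free_product M M') zs =
    product_ranks (rank M) (map (\<lambda>z. z \<in> ground M) zs)
      (flag_ranks M (filter (\<lambda>z. z \<in> ground M) zs)) (flag_ranks M' (filter (\<lambda>z. z \<notin> ground M) zs))"
proof -
  let ?P = "\<lambda>z. z \<in> ground M" and ?Q = "\<lambda>z. z \<notin> ground M"
  have zs': "distinct zs" "set zs = ground M \<union> ground M'" using zs by (auto simp: permutations_of_set_def)
  have "rank_of (free_product M M') (set (take j zs)) =
      (let k = length (filter (\<lambda>b. b) (take j (map ?P zs)))
     in min (flag_ranks M (filter ?P zs) ! k + (j - k)) (rank M + flag_ranks M' (filter ?Q zs) ! (j - k)))"
    if j: "j \<le> length zs" for j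
  proof -
    let ?Z = "set (take j zs)"
    let ?x = "filter ?P (take j zs)" and ?y = "filter ?Q (take j zs)"
    have sub: "?Z \<subseteq> ground M \<union> ground M'" using zs'(2) set_take_subset[of j zs] by auto
    have k: "length (filter (\<lambda>b. b) (take j (map ?P zs))) = length ?x"
      by (simp add: take_map filter_map o_def)
    have jk: "j - length ?x = length ?y"
      using sum_length_filter_compl[of ?P "take j zs"] j by simp
    have sx: "set ?x = ?Z \<inter> ground M" and sy: "set ?y = ?Z \<inter> ground M'" using sub dis by auto
    have "card (?Z \<inter> ground M') = length ?y"
      using zs'(1) distinct_card[of ?y] unfolding sy[symmetric] by simp
    moreover have "flag_ranks M (filter ?P zs) ! length ?x = rank_of M (?Z \<inter> ground M)"
    proof -
      have "length ?x \<le> length (filter ?P zs)"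
        by (metis take_length_filter length_take min.cobounded1 nat_le_linear min_def)
      then show ?thesis using flag_ranks_nth[of "length ?x" "filter ?P zs" M] sx by (simp add: take_length_filter)
    qed
    moreover have "flag_ranks M' (filter ?Q zs) ! length ?y = rank_of M' (?Z \<inter> ground M')"
    proof -
      have "length ?y \<le> length (filter ?Q zs)"
        by (metis take_length_filter length_take min.cobounded1 nat_le_linear min_def)
      then show ?thesis using flag_ranks_nth[of "length ?y" "filter ?Q zs" M'] sy by (simp add: take_length_filter)
    qed
    ultimately show ?thesis
      using rank_of_free_product[OF M M' dis sub] by (simp add: Let_def k jk)
  qed
  then show ?thesis
    by (simp add: flag_ranks_def[of "free_product M M'"] product_ranks_def del: upt_Suc)
qed

definition merged :: "nat \<Rightarrow> nat \<Rightarrow> nat \<Rightarrow> (nat list \<Rightarrow> real) \<Rightarrow> nat list \<Rightarrow> nat list \<Rightarrow> real" where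
  "merged r n n' \<phi> s t = (\<Sum>p\<in>patterns n n'. \<phi> (product_ranks r p s t))"

text \<open>The rank sequence of a merged ordering depends only on the two rank sequences and the pattern,
  hence the flag sum of the free product is bilinear in those of its factors.\<close>

lemma flag_sum_free_product:
  assumes M: "is_matroid M" and M': "is_matroid M'" and dis: "ground M \<inter> ground M' = {}"
  shows "flag_sum (free_product M M') \<phi> =
    flag_sum M (\<lambda>s. flag_sum M' (merged (rank M) (card (ground M)) (card (ground M')) \<phi> s))"
proof -
  have "flag_sum (free_product M M') \<phi> = (\<Sum>zs\<in>permutations_of_set (ground M \<union> ground M').
      \<phi> (product_ranks (rank M) (map (\<lambda>z. z \<in> ground M) zs)
      (flag_ranks M (filter (\<lambda>z. z \<in> ground M) zs)) (flag_ranks M' (filter (\<lambda>z. z \<notin> ground M) zs))))"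
    unfolding flag_sum_def free_product_sel(1)
    using flag_ranks_free_product[OF M M' dis] by (intro sum.cong) auto
  also have "\<dots> = flag_sum M (\<lambda>s. flag_sum M' (merged (rank M) (card (ground M)) (card (ground M')) \<phi> s))"
    unfolding flag_sum_def merged_def
    by (rule sum_permutations_of_Un[OF matroid_finite[OF M] matroid_finite[OF M'] dis,
          of "\<lambda>p xs ys. \<phi> (product_ranks (rank M) p (flag_ranks M xs) (flag_ranks M' ys))"])
  finally show ?thesis .
qed

text \<open>Concatenation of words, with the second word shifted past the first.\<close>

definition join :: "nat \<Rightarrow> nat set \<Rightarrow> nat set \<Rightarrow> nat set" where
  "join n A A' = A \<union> (+) n ` A'"

lemma schubert_shift:
  assumes "A \<subseteq> {1..n'}"
  shows "relabel ((+) n) (schubert {1..n'} A) = schubert {n + 1..n + n'} ((+) n ` A)"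
proof -
  have img: "(+) n ` {1..n'} = {n + 1..n + n'}" by (simp add: image_add_atLeastAtMost)
  have sub: "(+) n ` A \<subseteq> {n + 1..n + n'}" using image_mono[OF assms, of "(+) n"] unfolding img .
  have c: "card ((+) n ` B \<inter> {..j}) = (if n \<le> j then card (B \<inter> {..j - n}) else 0)"
    if "B \<subseteq> {1..n'}" for B j
  proof (cases "n \<le> j")
    case True
    then have "(+) n ` B \<inter> {..j} = (+) n ` (B \<inter> {..j - n})" by auto
    then show ?thesis using True by (simp add: card_image)
  next
    case False
    then have "(+) n ` B \<inter> {..j} = {}" by auto
    then show ?thesis using False by simp
  qed
  have iff: "(+) n ` I \<in> indeps (schubert {n + 1..n + n'} ((+) n ` A)) \<longleftrightarrow> I \<in> indeps (schubert {1..n'} A)"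
    if I: "I \<subseteq> {1..n'}" for I
  proof -
    have "(\<forall>j. card ((+) n ` I \<inter> {..j}) \<le> card ((+) n ` A \<inter> {..j})) \<longleftrightarrow>
      (\<forall>j. card (I \<inter> {..j}) \<le> card (A \<inter> {..j}))"
    proof
      assume *: "\<forall>j. card ((+) n ` I \<inter> {..j}) \<le> card ((+) n ` A \<inter> {..j})"
      show "\<forall>j. card (I \<inter> {..j}) \<le> card (A \<inter> {..j})"
      proof
        fix j
        show "card (I \<inter> {..j}) \<le> card (A \<inter> {..j})"
          using *[rule_format, of "n + j"] c[OF I, of "n + j"] c[OF assms, of "n + j"] by simp
      qed
    next
      assume "\<forall>j. card (I \<inter> {..j}) \<le> card (A \<inter> {..j})"
      then show "\<forall>j. card ((+) n ` I \<inter> {..j}) \<le> card ((+) n ` A \<inter> {..j})"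
        using c[OF I] c[OF assms] by simp
    qed
    moreover have "(+) n ` I \<subseteq> {n + 1..n + n'}" using image_mono[OF I, of "(+) n"] unfolding img .
    ultimately show ?thesis using I schubert_indeps[OF assms] schubert_indeps[OF sub] by simp
  qed
  have "(`) ((+) n) ` indeps (schubert {1..n'} A) = indeps (schubert {n + 1..n + n'} ((+) n ` A))"
  proof (intro equalityI subsetI)
    fix J assume "J \<in> (`) ((+) n) ` indeps (schubert {1..n'} A)"
    then obtain I where I: "I \<in> indeps (schubert {1..n'} A)" "J = (+) n ` I" by blast
    then have "I \<subseteq> {1..n'}" using schubert_indeps[OF assms] by blast
    then show "J \<in> indeps (schubert {n + 1..n + n'} ((+) n ` A))" using iff I by blast
  next
    fix J assume J: "J \<in> indeps (schubert {n + 1..n + n'} ((+) n ` A))"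
    then have "J \<subseteq> (+) n ` {1..n'}" using schubert_indeps[OF sub] unfolding img by blast
    then obtain I where "I \<subseteq> {1..n'}" "J = (+) n ` I" by (meson subset_imageE)
    then show "J \<in> (`) ((+) n) ` indeps (schubert {1..n'} A)" using iff J by blast
  qed
  then show ?thesis using img by (intro matroid.equality) simp_all
qed

text \<open>On Schubert matroids the bilinear operation of \<open>flag_sum_free_product\<close> is concatenation.\<close>

lemma flag_sum_schubert_join:
  assumes A: "A \<subseteq> {1..n}" and A': "A' \<subseteq> {1..n'}"
  shows "flag_sum (schubert {1..n + n'} (join n A A')) \<phi> =
    flag_sum (schubert {1..n} A) (\<lambda>s. flag_sum (schubert {1..n'} A') (merged (card A) n n' \<phi> s))"
proof -
  let ?M = "schubert {1..n} A" and ?S = "schubert {1..n'} A'"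
  let ?M' = "relabel ((+) n) ?S"
  have inj: "inj_on ((+) n) (ground ?S)" by simp
  have S: "is_matroid ?S" and M: "is_matroid ?M" by (simp_all add: is_matroid_schubert)
  note M' = is_matroid_relabel[OF S inj]
  have M'eq: "?M' = schubert {n + 1..n + n'} ((+) n ` A')" by (rule schubert_shift[OF A'])
  have sub: "(+) n ` A' \<subseteq> {n + 1..n + n'}" using A' by force
  have "free_product ?M ?M' = schubert ({1..n} \<union> {n + 1..n + n'}) (A \<union> (+) n ` A')"
    unfolding M'eq by (rule free_product_schubert) (use A sub in auto)
  moreover have "{1..n} \<union> {n + 1..n + n'} = {1..n + n'}" by auto
  ultimately have eq: "schubert {1..n + n'} (join n A A') = free_product ?M ?M'" by (simp add: join_def)
  have dis: "ground ?M \<inter> ground ?M' = {}" unfolding M'eq by auto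
  have "flag_sum (free_product ?M ?M') \<phi> =
    flag_sum ?M (\<lambda>s. flag_sum ?M' (merged (rank ?M) (card (ground ?M)) (card (ground ?M')) \<phi> s))"
    by (rule flag_sum_free_product[OF M M' dis])
  moreover have "rank ?M = card A" using rank_schubert A by simp
  moreover have "card (ground ?M) = n" by simp
  moreover have "card (ground ?M') = n'" unfolding M'eq by simp
  ultimately show ?thesis unfolding eq by (simp only: flag_sum_relabel[OF S inj])
qed

section \<open>Invariance of symmetrized indicators under isomorphism\<close>

text \<open>Permuting the coordinates is linear and maps vertices to vertices.\<close>

lemma base_polytope_relabel:
  fixes A :: "nat matroid"
  assumes A: "is_matroid A" and \<tau>: "\<tau> permutes {1..n}"
  shows "x \<in> base_polytope (relabel \<tau> A) \<longleftrightarrow> x \<circ> \<tau> \<in> base_polytope A"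
proof -
  let ?f = "\<lambda>y :: nat \<Rightarrow> real. y \<circ> inv \<tau>"
  have inj: "inj_on \<tau> (ground A)" using permutes_inj[OF \<tau>] by (rule inj_on_subset) simp
  have "linear ?f" by (rule linearI) (auto simp: scaleR_fun_def)
  have "indicat_real (\<tau> ` B) = ?f (indicat_real B)" for B
    using permutes_inverses[OF \<tau>] by (auto simp: fun_eq_iff indicator_def image_iff of_bool_def)
  then have "indicat_real ` bases (relabel \<tau> A) = ?f ` indicat_real ` bases A"
    unfolding bases_relabel[OF A inj] image_image by simp
  then have P: "base_polytope (relabel \<tau> A) = ?f ` base_polytope A"
    unfolding base_polytope_def by (simp only: convex_hull_linear_image[OF \<open>linear ?f\<close>])
  show ?thesis
  proof
    assume "x \<in> base_polytope (relabel \<tau> A)"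
    then obtain y where "y \<in> base_polytope A" "x = ?f y" unfolding P by auto
    moreover have "?f y \<circ> \<tau> = y" for y using permutes_inverses[OF \<tau>] by auto
    ultimately show "x \<circ> \<tau> \<in> base_polytope A" by metis
  next
    assume "x \<circ> \<tau> \<in> base_polytope A"
    moreover have "x = ?f (x \<circ> \<tau>)" using permutes_inverses[OF \<tau>] by auto
    ultimately show "x \<in> base_polytope (relabel \<tau> A)" unfolding P by blast
  qed
qed

lemma sym_indicator_isomorphic:
  fixes A B :: "nat matroid"
  assumes A: "is_matroid A" "ground A = {1..n}" and B: "is_matroid B" "ground B = {1..n}"
    and iso: "isomorphic A B"
  shows "sym_indicator n (base_polytope B) x = sym_indicator n (base_polytope A) x"
proof -
  obtain g where g: "inj_on g {1..n}" "B = relabel g A"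
    using isomorphic_eq_relabel[OF A(1) B(1) iso] A(2) by metis
  define \<tau> where "\<tau> i = (if i \<in> {1..n} then g i else i)" for i
  have img: "g ` {1..n} = {1..n}" using B(2) g(2) A(2) by simp
  have bij: "bij_betw \<tau> {1..n} {1..n}"
  proof -
    have "bij_betw \<tau> {1..n} {1..n} = bij_betw g {1..n} {1..n}"
      by (rule bij_betw_cong) (simp add: \<tau>_def)
    then show ?thesis using g(1) img by (simp add: bij_betw_def)
  qed
  have \<tau>: "\<tau> permutes {1..n}" by (rule bij_imp_permutes[OF bij]) (simp only: \<tau>_def if_False)
  have B\<tau>: "B = relabel \<tau> A"
    unfolding g(2) by (rule relabel_cong[OF A(1)]) (simp add: \<tau>_def A(2))
  have "(\<Sum>\<sigma> | \<sigma> permutes {1..n}. indicat_real (base_polytope B) (\<lambda>i. x (\<sigma> i))) =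
      (\<Sum>\<sigma> | \<sigma> permutes {1..n}. indicat_real (base_polytope A) (\<lambda>i. x ((\<sigma> \<circ> \<tau>) i)))"
    unfolding B\<tau> using base_polytope_relabel[OF A(1) \<tau>]
    by (intro sum.cong) (auto simp: indicator_def o_def)
  also have "\<dots> = (\<Sum>\<sigma> | \<sigma> permutes {1..n}. indicat_real (base_polytope A) (\<lambda>i. x (\<sigma> i)))"
    by (rule sum_permutations_compose_right[OF \<tau>, symmetric])
  finally show ?thesis by (simp add: sym_indicator_def)
qed

lemma polytope_indicator_eq:
  assumes M: "is_matroid M" and L: "is_matroid L" "ground L = {1..card (ground M)}" and iso: "isomorphic M L"
  shows "polytope_indicator M = sym_indicator (card (ground M)) (base_polytope L)"
proof
  fix x
  note c = labelled_copy[OF M]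
  have "isomorphic L (labelled_copy M)"
    using isomorphic_trans[OF L(1) M c(1) isomorphic_sym[OF M L(1) iso] c(3)] .
  then show "polytope_indicator M x = sym_indicator (card (ground M)) (base_polytope L) x"
    unfolding polytope_indicator_def by (rule sym_indicator_isomorphic[OF L c(1,2)])
qed

lemma isomorphic_refl: "isomorphic M M"
  unfolding isomorphic_def by (intro exI[of _ id]) auto

section \<open>Nested coordinates\<close>

definition subsets_of_size :: "nat \<Rightarrow> nat \<Rightarrow> nat set set" where
  "subsets_of_size n r = {A. A \<subseteq> {1..n} \<and> card A = r}"

lemma finite_subsets_of_size: "finite (subsets_of_size n r)"
  by (rule finite_subset[of _ "Pow {1..n}"]) (auto simp: subsets_of_size_def)

text \<open>The position of a Schubert matroid in the given enumeration of nested matroids. It is a bijection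
  onto all positions because there are as many words as positions and distinct words give
  nonisomorphic matroids.\<close>

definition schubert_index :: "(nat \<Rightarrow> nat \<Rightarrow> nat \<Rightarrow> nat matroid) \<Rightarrow> nat \<Rightarrow> nat \<Rightarrow> nat set \<Rightarrow> nat" where
  "schubert_index N r n A = (THE i. i \<in> {1..n choose r} \<and> isomorphic (schubert {1..n} A) (N r n i))"

lemma join_subset:
  assumes "A \<in> subsets_of_size n r" "A' \<in> subsets_of_size n' r'"
  shows "join n A A' \<in> subsets_of_size (n + n') (r + r')"
proof -
  have sub: "A \<subseteq> {1..n}" "(+) n ` A' \<subseteq> {n + 1..n + n'}"
    using assms by (force simp: subsets_of_size_def)+
  then have "A \<inter> (+) n ` A' = {}" by fastforce
  moreover have "finite A" "finite A'" using assms finite_subset by (auto simp: subsets_of_size_def)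
  ultimately have "card (join n A A') = r + r'"
    using assms by (simp add: join_def card_Un_disjoint card_image subsets_of_size_def)
  then show ?thesis using sub by (auto simp: join_def subsets_of_size_def)
qed

lemma join_inject:
  assumes "A \<in> subsets_of_size n r" "B \<in> subsets_of_size n r"
    and "join n A A' = join n B B'" "A' \<in> subsets_of_size n' r'" "B' \<in> subsets_of_size n' r'"
  shows "A = B \<and> A' = B'"
proof -
  have l: "join n C C' \<inter> {..n} = C" if "C \<subseteq> {1..n}" "C' \<subseteq> {1..n'}" for C C'
    using that by (force simp: join_def)
  have r: "join n C C' - {..n} = (+) n ` C'" if "C \<subseteq> {1..n}" "C' \<subseteq> {1..n'}" for C C'
    using that by (force simp: join_def)
  have sub: "A \<subseteq> {1..n}" "B \<subseteq> {1..n}" "A' \<subseteq> {1..n'}" "B' \<subseteq> {1..n'}"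
    using assms by (auto simp: subsets_of_size_def)
  have "A = B" using l[OF sub(1,3)] l[OF sub(2,4)] assms(3) by simp
  moreover have "(+) n ` A' = (+) n ` B'" using r[OF sub(1,3)] r[OF sub(2,4)] assms(3) by simp
  then have "A' = B'" by (simp add: inj_image_eq_iff)
  ultimately show ?thesis by simp
qed

locale enumerated =
  fixes N :: "nat \<Rightarrow> nat \<Rightarrow> nat \<Rightarrow> nat matroid"
  assumes enum: "nested_enumeration N"
begin

lemma N_matroid:
  assumes "i \<in> {1..n choose r}"
  shows "is_matroid (N r n i)" "ground (N r n i) = {1..n}" "rank (N r n i) = r"
  using enum assms unfolding nested_enumeration_def matroids_on_def by auto

lemma polytope_indicator_N:
  assumes "i \<in> {1..n choose r}"
  shows "polytope_indicator (N r n i) = sym_indicator n (base_polytope (N r n i))"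
  using polytope_indicator_eq[OF N_matroid(1)[OF assms] N_matroid(1)[OF assms] _ isomorphic_refl]
    N_matroid(2)[OF assms] by simp

lemma nested_index:
  assumes "K \<in> matroids_on {1..n} r" "nested K"
  shows "\<exists>!i. i \<in> {1..n choose r} \<and> isomorphic K (N r n i)"
  using enum assms unfolding nested_enumeration_def by blast

lemma schubert_index:
  assumes A: "A \<in> subsets_of_size n r"
  shows "schubert_index N r n A \<in> {1..n choose r}"
    "isomorphic (schubert {1..n} A) (N r n (schubert_index N r n A))"
proof -
  have "schubert {1..n} A \<in> matroids_on {1..n} r"
    using A rank_schubert[of "{1..n}" A] by (simp add: matroids_on_def is_matroid_schubert subsets_of_size_def)
  from theI'[OF nested_index[OF this nested_schubert]]
  show "schubert_index N r n A \<in> {1..n choose r}"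
    "isomorphic (schubert {1..n} A) (N r n (schubert_index N r n A))"
    by (simp_all add: schubert_index_def)
qed

lemma bij_betw_schubert_index:
  "bij_betw (schubert_index N r n) (subsets_of_size n r) {1..n choose r}"
proof -
  have "inj_on (schubert_index N r n) (subsets_of_size n r)"
  proof (rule inj_onI)
    fix A B assume A: "A \<in> subsets_of_size n r" and B: "B \<in> subsets_of_size n r"
      and eq: "schubert_index N r n A = schubert_index N r n B"
    let ?N = "N r n (schubert_index N r n B)"
    have M: "is_matroid (schubert {1..n} A)" "is_matroid (schubert {1..n} B)" "is_matroid ?N"
      using N_matroid(1)[OF schubert_index(1)[OF B]] by (simp_all add: is_matroid_schubert)
    have "isomorphic (schubert {1..n} A) (schubert {1..n} B)"
      using isomorphic_trans[OF M(1,3,2)] schubert_index(2)[OF A] eq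
        isomorphic_sym[OF M(2,3) schubert_index(2)[OF B]] by simp
    then show "A = B"
      using A B by (intro schubert_isomorphic_imp_eq) (auto simp: subsets_of_size_def)
  qed
  moreover have "schubert_index N r n ` subsets_of_size n r \<subseteq> {1..n choose r}"
    using schubert_index(1) by auto
  moreover have "card (subsets_of_size n r) = n choose r"
    using n_subsets[of "{1..n}" r] by (simp add: subsets_of_size_def)
  ultimately show ?thesis
    by (metis bij_betw_def card_atLeastAtMost card_image card_subset_eq diff_Suc_1 finite_atLeastAtMost)
qed

lemma flag_sum_schubert_index:
  assumes "A \<in> subsets_of_size n r"
  shows "flag_sum (N r n (schubert_index N r n A)) \<phi> = flag_sum (schubert {1..n} A) \<phi>"
  using flag_sum_isomorphic[OF is_matroid_schubert N_matroid(1)[OF schubert_index(1)[OF assms]]]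
    schubert_index(2)[OF assms] by blast

lemma sum_over_N:
  "(\<Sum>i = 1..n choose r. a i * flag_sum (N r n i) \<phi>) =
    (\<Sum>A\<in>subsets_of_size n r. a (schubert_index N r n A) * flag_sum (schubert {1..n} A) \<phi>)"
proof -
  have "(\<Sum>i = 1..n choose r. a i * flag_sum (N r n i) \<phi>) = (\<Sum>A\<in>subsets_of_size n r.
      a (schubert_index N r n A) * flag_sum (N r n (schubert_index N r n A)) \<phi>)"
    by (rule sum.reindex_bij_betw[OF bij_betw_schubert_index, symmetric])
  then show ?thesis by (simp add: flag_sum_schubert_index cong: sum.cong)
qed

text \<open>The property that singles out the coordinate vector of a matroid.\<close>

definition represents :: "(nat \<Rightarrow> real) \<Rightarrow> 'a matroid \<Rightarrow> bool" where
  "represents a M \<longleftrightarrow> a \<in> coord_space (card (ground M) choose rank M) \<and> (\<forall>i. a i \<in> \<int>) \<and>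
     (\<forall>x\<in>coord_space (card (ground M)). polytope_indicator M x =
        (\<Sum>i = 1..card (ground M) choose rank M.
           a i * polytope_indicator (N (rank M) (card (ground M)) i) x))"

lemma sum_add_at:
  fixes a f :: "nat \<Rightarrow> real"
  assumes "i \<in> {1..m}"
  shows "(\<Sum>j = 1..m. (a(i := a i + t)) j * f j) = (\<Sum>j = 1..m. a j * f j) + t * f i"
proof -
  have "(\<Sum>j = 1..m. (a(i := a i + t)) j * f j) = (\<Sum>j = 1..m. a j * f j + (if j = i then t * f i else 0))"
    by (rule sum.cong) (auto simp: distrib_right)
  then show ?thesis using assms by (simp add: sum.distrib)
qed

lemma int_span_represented:
  assumes "g \<in> int_span ((\<lambda>S. indicat_real (base_polytope S)) ` {S \<in> matroids_on {1..n} r. nested S})"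
  shows "\<exists>a\<in>coord_space (n choose r). (\<forall>i. a i \<in> \<int>) \<and>
    (\<forall>x. 1 / fact n * (\<Sum>\<sigma> | \<sigma> permutes {1..n}. g (\<lambda>i. x (\<sigma> i))) =
       (\<Sum>i = 1..n choose r. a i * polytope_indicator (N r n i) x))"
  using assms
proof (induction rule: int_span.induct)
  case int_span_zero
  then show ?case by (intro bexI[of _ "\<lambda>_. 0"]) (auto simp: coord_space_def)
next
  let ?B = "(\<lambda>S. indicat_real (base_polytope S)) ` {S \<in> matroids_on {1..n} r. nested S}"
  let ?p = "\<lambda>i. polytope_indicator (N r n i)"
  let ?avg = "\<lambda>g x. 1 / fact n * (\<Sum>\<sigma> | \<sigma> permutes {1..n}. g (\<lambda>i. x (\<sigma> i)))"
  have base: "\<exists>i\<in>{1..n choose r}. \<forall>x. ?avg b x = ?p i x" if b: "b \<in> ?B" for b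
  proof -
    obtain S where S: "b = indicat_real (base_polytope S)" "S \<in> matroids_on {1..n} r" "nested S"
      using b by auto
    then have S': "is_matroid S" "ground S = {1..n}" by (auto simp: matroids_on_def)
    obtain i where i: "i \<in> {1..n choose r}" "isomorphic S (N r n i)" using nested_index[OF S(2,3)] by blast
    have "polytope_indicator (N r n i) x = sym_indicator n (base_polytope S) x" for x
      unfolding polytope_indicator_N[OF i(1)]
      by (rule sym_indicator_isomorphic[OF S' N_matroid(1,2)[OF i(1)] i(2)])
    then show ?thesis using i(1) S(1) by (intro bexI[of _ i]) (auto simp: sym_indicator_def)
  qed
  have add: "\<exists>a\<in>coord_space (n choose r). (\<forall>i. a i \<in> \<int>) \<and>
    (\<forall>x. 1 / fact n * (\<Sum>\<sigma> | \<sigma> permutes {1..n}. g (\<lambda>i. x (\<sigma> i)) + t * b (\<lambda>i. x (\<sigma> i))) =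
       (\<Sum>i = 1..n choose r. a i * ?p i x))"
    if IH: "\<exists>a\<in>coord_space (n choose r). (\<forall>i. a i \<in> \<int>) \<and>
        (\<forall>x. ?avg g x = (\<Sum>i = 1..n choose r. a i * ?p i x))"
      and b: "b \<in> ?B" and t: "t \<in> \<int>" for g b t
  proof -
    obtain a where a: "a \<in> coord_space (n choose r)" "\<forall>i. a i \<in> \<int>"
      "\<And>x. ?avg g x = (\<Sum>i = 1..n choose r. a i * ?p i x)" using IH by blast
    obtain i where i: "i \<in> {1..n choose r}" "\<And>x. ?avg b x = ?p i x" using base[OF b] by blast
    have "1 / fact n * (\<Sum>\<sigma> | \<sigma> permutes {1..n}. g (\<lambda>i. x (\<sigma> i)) + t * b (\<lambda>i. x (\<sigma> i))) =
        ?avg g x + t * ?avg b x" for x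
      by (simp add: sum.distrib distrib_left sum_distrib_left mult.left_commute)
    then have "1 / fact n * (\<Sum>\<sigma> | \<sigma> permutes {1..n}. g (\<lambda>i. x (\<sigma> i)) + t * b (\<lambda>i. x (\<sigma> i))) =
        (\<Sum>j = 1..n choose r. (a(i := a i + t)) j * ?p j x)" for x
      unfolding sum_add_at[where a = a and f = "\<lambda>j. ?p j x", OF i(1)] a(3) i(2) .
    moreover have "a(i := a i + t) \<in> coord_space (n choose r)" using a(1) i(1) by (auto simp: coord_space_def)
    moreover have "\<forall>j. (a(i := a i + t)) j \<in> \<int>" using a(2) t by simp
    ultimately show ?thesis by blast
  qed
  {
    case (int_span_plus g b)
    show ?case using add[OF int_span_plus.IH int_span_plus.hyps(2), of 1] by simp
  next
    case (int_span_minus g b)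
    show ?case using add[OF int_span_minus.IH int_span_minus.hyps(2), of "- 1"] by simp
  }
qed

lemma representation_exists:
  assumes M: "is_matroid M"
  shows "\<exists>a. represents a M"
proof -
  let ?n = "card (ground M)" and ?L = "labelled_copy M"
  note L = labelled_copy[OF M]
  have r: "rank ?L = rank M" using isomorphic_rank_card[OF M L(1,3)] by simp
  have "indicat_real (base_polytope ?L) \<in>
      int_span ((\<lambda>S. indicat_real (base_polytope S)) ` {S \<in> matroids_on {1..?n} (rank M). nested S})"
    using base_polytope_in_int_span[OF L(1)] unfolding L(2) r .
  from int_span_represented[OF this] show ?thesis
    unfolding represents_def polytope_indicator_def sym_indicator_def by blast
qed

text \<open>The relation between \<open>M\<close> and the nested matroids is put into the form of a vanishing sum, with
  \<open>M\<close> at index 0 and coefficient \<open>-1\<close>.\<close>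

lemma flag_sum_of_represents:
  assumes M: "is_matroid M" and a: "represents a M"
  defines "n \<equiv> card (ground M)" and "r \<equiv> rank M"
  shows "flag_sum M \<phi> = (\<Sum>A\<in>subsets_of_size n r. a (schubert_index N r n A) * flag_sum (schubert {1..n} A) \<phi>)"
proof -
  let ?m = "n choose r"
  define L where "L i = (if i = 0 then labelled_copy M else N r n i)" for i :: nat
  define c where "c i = (if i = 0 then - 1 else a i)" for i :: nat
  note copy = labelled_copy[OF M]
  have split: "(\<Sum>i\<in>{0..?m}. c i * f (L i)) = - f (labelled_copy M) + (\<Sum>i = 1..?m. a i * f (N r n i))"
    for f :: "nat matroid \<Rightarrow> real"
  proof -
    have "(\<Sum>i\<in>{0..?m}. c i * f (L i)) = c 0 * f (L 0) + (\<Sum>i = 1..?m. c i * f (L i))"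
      by (simp add: sum.atLeast_Suc_atMost)
    also have "(\<Sum>i = 1..?m. c i * f (L i)) = (\<Sum>i = 1..?m. a i * f (N r n i))"
      by (rule sum.cong) (auto simp: c_def L_def)
    finally show ?thesis by (simp add: c_def L_def)
  qed
  have "(\<Sum>i\<in>{0..?m}. c i * flag_sum (L i) \<phi>) = 0"
  proof (rule flag_sum_relation)
    show "is_matroid (L i)" "ground (L i) = {1..n}" if "i \<in> {0..?m}" for i
      using copy N_matroid[of i n r] that by (auto simp: L_def n_def)
    fix x assume x: "x \<in> coord_space n"
    have "polytope_indicator M x = (\<Sum>i = 1..?m. a i * polytope_indicator (N r n i) x)"
      using a x unfolding represents_def n_def r_def by blast
    also have "\<dots> = (\<Sum>i = 1..?m. a i * sym_indicator n (base_polytope (N r n i)) x)"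
      using polytope_indicator_N by (intro sum.cong) auto
    finally show "(\<Sum>i\<in>{0..?m}. c i * sym_indicator n (base_polytope (L i)) x) = 0"
      unfolding split[of "\<lambda>L. sym_indicator n (base_polytope L) x"] by (simp add: polytope_indicator_def n_def)
  qed simp
  then have "flag_sum (labelled_copy M) \<phi> = (\<Sum>i = 1..?m. a i * flag_sum (N r n i) \<phi>)"
    unfolding split[of "\<lambda>L. flag_sum L \<phi>"] by simp
  then show ?thesis unfolding sum_over_N flag_sum_isomorphic[OF M copy(1,3)] .
qed

lemma flag_expansion_unique:
  assumes "\<And>\<phi>. (\<Sum>A\<in>subsets_of_size n r. c A * flag_sum (schubert {1..n} A) \<phi>) =
      (\<Sum>A\<in>subsets_of_size n r. d A * flag_sum (schubert {1..n} A) \<phi>)"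
    and "A \<in> subsets_of_size n r"
  shows "c A = d A"
proof -
  have "(\<Sum>A\<in>subsets_of_size n r. (c A - d A) * flag_sum (schubert {1..n} A) \<phi>) = 0" for \<phi>
    using assms(1)[of \<phi>] by (simp add: left_diff_distrib sum_subtractf)
  then have "c A - d A = 0"
    using schubert_flag_sums_independent[of "subsets_of_size n r" n "\<lambda>A. c A - d A" A] assms(2)
    by (auto simp: subsets_of_size_def)
  then show ?thesis by simp
qed

lemma coord_space_eqI:
  assumes "a \<in> coord_space (n choose r)" "b \<in> coord_space (n choose r)"
    and "\<And>A. A \<in> subsets_of_size n r \<Longrightarrow> a (schubert_index N r n A) = b (schubert_index N r n A)"
  shows "a = b"
proof
  fix i
  show "a i = b i"
  proof (cases "i \<in> {1..n choose r}")
    case True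
    then obtain A where "A \<in> subsets_of_size n r" "i = schubert_index N r n A"
      using bij_betw_imp_surj_on[OF bij_betw_schubert_index, of r n] by blast
    then show ?thesis using assms(3) by simp
  qed (use assms(1,2) in \<open>simp add: coord_space_def\<close>)
qed

text \<open>Existence is the chain expansion; uniqueness holds because the coordinates determine, and by
  independence are determined by, the flag sum.\<close>

lemma nested_coords_represents:
  assumes M: "is_matroid M"
  shows "represents (nested_coords N M) M"
proof -
  have "\<exists>!a. represents a M"
  proof (rule ex_ex1I)
    show "\<exists>a. represents a M" using representation_exists[OF M] .
    fix a b assume ab: "represents a M" "represents b M"
    show "a = b"
    proof (rule coord_space_eqI)
      show "a \<in> coord_space (card (ground M) choose rank M)" "b \<in> coord_space (card (ground M) choose rank M)"
        using ab by (auto simp: represents_def)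
      fix A assume "A \<in> subsets_of_size (card (ground M)) (rank M)"
      then show "a (schubert_index N (rank M) (card (ground M)) A) = b (schubert_index N (rank M) (card (ground M)) A)"
        using flag_sum_of_represents[OF M ab(1)] flag_sum_of_represents[OF M ab(2)]
        by (intro flag_expansion_unique[where n = "card (ground M)" and r = "rank M"
              and c = "\<lambda>A. a (schubert_index N (rank M) (card (ground M)) A)"
              and d = "\<lambda>A. b (schubert_index N (rank M) (card (ground M)) A)"]) simp_all
    qed
  qed
  moreover have "nested_coords N M = (THE a. represents a M)"
    by (simp add: nested_coords_def represents_def Let_def)
  ultimately show ?thesis using theI' by metis
qed

lemma nested_coords_isomorphic:
  assumes M: "is_matroid M" and L: "is_matroid L" and iso: "isomorphic M L"
  shows "nested_coords N L = nested_coords N M"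
proof -
  note rc = isomorphic_rank_card[OF M L iso]
  note cL = labelled_copy[OF L]
  have "polytope_indicator M = polytope_indicator L"
    unfolding polytope_indicator_def[of L] rc(2)
    using cL rc(2) isomorphic_trans[OF M L cL(1) iso cL(3)] by (intro polytope_indicator_eq[OF M]) auto
  then show ?thesis unfolding nested_coords_def rc by simp
qed

section \<open>Coordinates of free products and extremality\<close>

text \<open>The tensor product of two coordinate vectors, indexed by words, where a pair of words is embedded as
  its concatenation.\<close>

definition tensor :: "nat \<Rightarrow> nat \<Rightarrow> nat \<Rightarrow> nat \<Rightarrow> (nat \<Rightarrow> real) \<Rightarrow> (nat \<Rightarrow> real) \<Rightarrow> nat \<Rightarrow> real" where
  "tensor r n r' n' a b k = (\<Sum>A\<in>subsets_of_size n r. \<Sum>A'\<in>subsets_of_size n' r'.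
     a (schubert_index N r n A) * b (schubert_index N r' n' A') *
     of_bool (k = schubert_index N (r + r') (n + n') (join n A A')))"

lemma tensor_join:
  assumes "A \<in> subsets_of_size n r" "A' \<in> subsets_of_size n' r'"
  shows "tensor r n r' n' a b (schubert_index N (r + r') (n + n') (join n A A')) =
    a (schubert_index N r n A) * b (schubert_index N r' n' A')"
proof -
  let ?S = "subsets_of_size n r" and ?S' = "subsets_of_size n' r'"
  have "schubert_index N (r + r') (n + n') (join n A A') = schubert_index N (r + r') (n + n') (join n B B')
      \<longleftrightarrow> B = A \<and> B' = A'" if "B \<in> ?S" "B' \<in> ?S'" for B B'
    using inj_on_eq_iff[OF bij_betw_imp_inj_on[OF bij_betw_schubert_index] join_subset[OF assms] join_subset[OF that]]
      join_inject[OF that(1) assms(1) _ that(2) assms(2)] by metis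
  then have "tensor r n r' n' a b (schubert_index N (r + r') (n + n') (join n A A')) =
      (\<Sum>B\<in>?S. \<Sum>B'\<in>?S'. if B = A \<and> B' = A' then a (schubert_index N r n A) * b (schubert_index N r' n' A') else 0)"
    unfolding tensor_def by (intro sum.cong) auto
  also have "\<dots> = (\<Sum>B\<in>?S. if B = A then a (schubert_index N r n A) * b (schubert_index N r' n' A') else 0)"
    using assms(2) finite_subsets_of_size by (intro sum.cong) auto
  finally show ?thesis using assms(1) finite_subsets_of_size by simp
qed

lemma tensor_in_coord_space: "tensor r n r' n' a b \<in> coord_space ((n + n') choose (r + r'))"
proof -
  have "tensor r n r' n' a b k = 0" if "k \<notin> {1..(n + n') choose (r + r')}" for k
    unfolding tensor_def
  proof (intro sum.neutral ballI)
    fix A A' assume "A \<in> subsets_of_size n r" "A' \<in> subsets_of_size n' r'"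
    then have "k \<noteq> schubert_index N (r + r') (n + n') (join n A A')"
      using schubert_index(1)[OF join_subset] that by metis
    then show "a (schubert_index N r n A) * b (schubert_index N r' n' A') *
     of_bool (k = schubert_index N (r + r') (n + n') (join n A A')) = 0" by simp
  qed
  then show ?thesis by (simp add: coord_space_def)
qed

lemma linear_tensor_left: "linear (\<lambda>a. tensor r n r' n' a b)"
  by (rule linearI) (auto simp: tensor_def scaleR_fun_def fun_eq_iff distrib_right sum.distrib
      sum_distrib_left mult.assoc)

lemma linear_tensor_right: "linear (tensor r n r' n' a)"
  by (rule linearI) (auto simp: tensor_def scaleR_fun_def fun_eq_iff distrib_left distrib_right sum.distrib
      sum_distrib_left mult.assoc mult.left_commute)

lemma flag_sum_linear:
  "flag_sum L (\<lambda>s. \<Sum>i\<in>I. c i * f i s) = (\<Sum>i\<in>I. c i * flag_sum L (f i))"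
  unfolding flag_sum_def by (subst sum.swap) (simp add: sum_distrib_left)

text \<open>Both sides expand the flag sum of the free product in the flag sums of Schubert matroids.\<close>

lemma nested_coords_free_product:
  assumes M: "is_matroid M" and M': "is_matroid M'" and dis: "ground M \<inter> ground M' = {}"
  shows "nested_coords N (free_product M M') =
    tensor (rank M) (card (ground M)) (rank M') (card (ground M')) (nested_coords N M) (nested_coords N M')"
proof -
  let ?P = "free_product M M'"
  define r n r' n' where defs: "r = rank M" "n = card (ground M)" "r' = rank M'" "n' = card (ground M')"
  define v v' where vdefs: "v = nested_coords N M" "v' = nested_coords N M'"
  let ?S = "subsets_of_size n r" and ?S' = "subsets_of_size n' r'" and ?T = "subsets_of_size (n + n') (r + r')"
  let ?i = "schubert_index N r n" and ?i' = "schubert_index N r' n'" and ?k = "schubert_index N (r + r') (n + n')"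
  note P = is_matroid_free_product[OF M M' dis]
  have rP: "rank ?P = r + r'" and nP: "card (ground ?P) = n + n'"
    using rank_free_product[OF M M' dis] card_free_product[OF M M' dis] by (simp_all add: defs)
  have expM: "flag_sum M \<phi> = (\<Sum>A\<in>?S. v (?i A) * flag_sum (schubert {1..n} A) \<phi>)" for \<phi>
    using flag_sum_of_represents[OF M nested_coords_represents[OF M]] by (simp add: defs vdefs)
  have expM': "flag_sum M' \<phi> = (\<Sum>A'\<in>?S'. v' (?i' A') * flag_sum (schubert {1..n'} A') \<phi>)" for \<phi>
    using flag_sum_of_represents[OF M' nested_coords_represents[OF M']] by (simp add: defs vdefs)
  have join: "flag_sum (schubert {1..n} A) (\<lambda>s. flag_sum (schubert {1..n'} A') (merged r n n' \<phi> s)) =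
      flag_sum (schubert {1..n + n'} (join n A A')) \<phi>" if "A \<in> ?S" "A' \<in> ?S'" for A A' \<phi>
    using flag_sum_schubert_join[of A n A' n' \<phi>] that by (simp add: subsets_of_size_def)
  have expP: "flag_sum ?P \<phi> = (\<Sum>A\<in>?S. \<Sum>A'\<in>?S'. v (?i A) * v' (?i' A') *
      flag_sum (schubert {1..n + n'} (join n A A')) \<phi>)" for \<phi>
  proof -
    have "flag_sum ?P \<phi> = flag_sum M (\<lambda>s. flag_sum M' (merged r n n' \<phi> s))"
      using flag_sum_free_product[OF M M' dis] by (simp add: defs)
    also have "\<dots> = (\<Sum>A\<in>?S. v (?i A) *
        flag_sum (schubert {1..n} A) (\<lambda>s. flag_sum M' (merged r n n' \<phi> s)))" by (rule expM)
    also have "\<dots> = (\<Sum>A\<in>?S. v (?i A) * (\<Sum>A'\<in>?S'. v' (?i' A') *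
        flag_sum (schubert {1..n} A) (\<lambda>s. flag_sum (schubert {1..n'} A') (merged r n n' \<phi> s))))"
      unfolding expM' flag_sum_linear ..
    also have "\<dots> = (\<Sum>A\<in>?S. \<Sum>A'\<in>?S'. v (?i A) * v' (?i' A') *
        flag_sum (schubert {1..n} A) (\<lambda>s. flag_sum (schubert {1..n'} A') (merged r n n' \<phi> s)))"
      by (simp add: sum_distrib_left mult.assoc)
    finally show ?thesis using join by simp
  qed
  have expT: "(\<Sum>A\<in>?S. \<Sum>A'\<in>?S'. v (?i A) * v' (?i' A') * flag_sum (schubert {1..n + n'} (join n A A')) \<phi>) =
      (\<Sum>C\<in>?T. tensor r n r' n' v v' (?k C) * flag_sum (schubert {1..n + n'} C) \<phi>)" for \<phi>
  proof -
    have pick: "(\<Sum>C\<in>?T. of_bool (?k C = ?k (join n A A')) * flag_sum (schubert {1..n + n'} C) \<phi>) =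
        flag_sum (schubert {1..n + n'} (join n A A')) \<phi>" if "A \<in> ?S" "A' \<in> ?S'" for A A'
    proof -
      have "(\<Sum>C\<in>?T. of_bool (?k C = ?k (join n A A')) * flag_sum (schubert {1..n + n'} C) \<phi>) =
          (\<Sum>C\<in>?T. if C = join n A A' then flag_sum (schubert {1..n + n'} C) \<phi> else 0)"
        using inj_on_eq_iff[OF bij_betw_imp_inj_on[OF bij_betw_schubert_index] _ join_subset[OF that]]
        by (intro sum.cong) auto
      then show ?thesis using join_subset[OF that] finite_subsets_of_size by simp
    qed
    have "(\<Sum>C\<in>?T. tensor r n r' n' v v' (?k C) * flag_sum (schubert {1..n + n'} C) \<phi>) =
      (\<Sum>C\<in>?T. \<Sum>A\<in>?S. \<Sum>A'\<in>?S'. v (?i A) * v' (?i' A') *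
         (of_bool (?k C = ?k (join n A A')) * flag_sum (schubert {1..n + n'} C) \<phi>))"
      unfolding tensor_def by (simp add: sum_distrib_right mult.assoc)
    also have "\<dots> = (\<Sum>A\<in>?S. \<Sum>C\<in>?T. \<Sum>A'\<in>?S'. v (?i A) * v' (?i' A') *
         (of_bool (?k C = ?k (join n A A')) * flag_sum (schubert {1..n + n'} C) \<phi>))"
      by (rule sum.swap)
    also have "\<dots> = (\<Sum>A\<in>?S. \<Sum>A'\<in>?S'. \<Sum>C\<in>?T. v (?i A) * v' (?i' A') *
         (of_bool (?k C = ?k (join n A A')) * flag_sum (schubert {1..n + n'} C) \<phi>))"
      by (intro sum.cong refl sum.swap)
    also have "\<dots> = (\<Sum>A\<in>?S. \<Sum>A'\<in>?S'. v (?i A) * v' (?i' A') *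
         flag_sum (schubert {1..n + n'} (join n A A')) \<phi>)"
      by (intro sum.cong refl) (simp only: sum_distrib_left[symmetric] pick)
    finally show ?thesis ..
  qed
  have repP: "represents (nested_coords N ?P) ?P" by (rule nested_coords_represents[OF P])
  have "nested_coords N ?P = tensor r n r' n' v v'"
  proof (rule coord_space_eqI)
    show "nested_coords N ?P \<in> coord_space (n + n' choose (r + r'))"
      using repP by (simp add: represents_def rP nP)
    show "tensor r n r' n' v v' \<in> coord_space (n + n' choose (r + r'))" by (rule tensor_in_coord_space)
    fix C assume C: "C \<in> ?T"
    have "flag_sum ?P \<phi> = (\<Sum>C\<in>?T. nested_coords N ?P (?k C) * flag_sum (schubert {1..n + n'} C) \<phi>)" for \<phi>
      using flag_sum_of_represents[OF P repP] unfolding rP nP .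
    then show "nested_coords N ?P (?k C) = tensor r n r' n' v v' (?k C)"
      using expP expT
      by (intro flag_expansion_unique[OF _ C, where c = "\<lambda>C. nested_coords N ?P (?k C)"
            and d = "\<lambda>C. tensor r n r' n' v v' (?k C)"]) metis
  qed
  then show ?thesis by (simp add: defs vdefs)
qed

text \<open>The flag sum of the constant 1 counts all orderings of the ground set.\<close>

lemma nested_coords_nonzero:
  assumes M: "is_matroid M"
  obtains A where "A \<in> subsets_of_size (card (ground M)) (rank M)"
    "nested_coords N M (schubert_index N (rank M) (card (ground M)) A) \<noteq> 0"
proof (rule ccontr)
  assume "\<not> thesis"
  then have "\<forall>A\<in>subsets_of_size (card (ground M)) (rank M).
      nested_coords N M (schubert_index N (rank M) (card (ground M)) A) = 0" using that by blast
  then have "flag_sum M (\<lambda>_. 1) = 0"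
    using flag_sum_of_represents[OF M nested_coords_represents[OF M]] by simp
  moreover have "flag_sum M (\<lambda>_. 1) = fact (card (ground M))"
    using matroid_finite[OF M] by (simp add: flag_sum_def card_permutations_of_set)
  ultimately show False by simp
qed

lemma nested_coords_labelled:
  assumes M: "is_matroid M"
  obtains L where "L \<in> matroids_on {1..card (ground M)} (rank M)" "isomorphic M L"
    "nested_coords N L = nested_coords N M"
  using labelled_copy[OF M] isomorphic_rank_card[OF M labelled_copy(1,3)[OF M]]
    nested_coords_isomorphic[OF M labelled_copy(1,3)[OF M]]
  by (intro that[of "labelled_copy M"]) (auto simp: matroids_on_def)

lemma nested_coords_in_generators:
  "is_matroid M \<Longrightarrow> nested_coords N M \<in> nested_coords N ` matroids_on {1..card (ground M)} (rank M)"
  by (rule nested_coords_labelled[of M]) (auto intro!: image_eqI)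

lemma nested_coords_in_coord_space:
  assumes "a \<in> Omega N r n"
  shows "a \<in> coord_space (n choose r)"
proof -
  have "Omega N r n \<subseteq> coord_space (n choose r)"
    unfolding Omega_def
  proof (rule hull_minimal)
    show "nested_coords N ` matroids_on {1..n} r \<subseteq> coord_space (n choose r)"
      using nested_coords_represents by (fastforce simp: matroids_on_def represents_def)
    show "convex (coord_space (n choose r))"
      by (rule convexI) (auto simp: coord_space_def scaleR_fun_def)
  qed
  then show ?thesis using assms by blast
qed

text \<open>The tensor product is realized by the free product with a copy of the second matroid on the
  following integers.\<close>

lemma tensor_in_generators:
  assumes "K \<in> matroids_on {1..n} r" "K' \<in> matroids_on {1..n'} r'"
  shows "tensor r n r' n' (nested_coords N K) (nested_coords N K') \<in>
    nested_coords N ` matroids_on {1..n + n'} (r + r')"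
proof -
  have K: "is_matroid K" "ground K = {1..n}" "rank K = r" and K': "is_matroid K'" "ground K' = {1..n'}" "rank K' = r'"
    using assms by (auto simp: matroids_on_def)
  let ?K = "relabel ((+) n) K'"
  have inj: "inj_on ((+) n) (ground K')" by simp
  note R = is_matroid_relabel[OF K'(1) inj]
  have "ground K \<inter> ground ?K = {}" using K(2) K'(2) by auto
  note P = is_matroid_free_product[OF K(1) R this] and coords = nested_coords_free_product[OF K(1) R this]
    and rk = rank_free_product[OF K(1) R this] and cd = card_free_product[OF K(1) R this]
  have "rank ?K = r'" "card (ground ?K) = n'"
    using rank_relabel[OF K'(1) inj] K' by (simp_all add: card_image)
  moreover have "nested_coords N ?K = nested_coords N K'"
    by (rule nested_coords_isomorphic[OF K'(1) R isomorphic_relabel[OF K'(1) inj]])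
  ultimately have "tensor r n r' n' (nested_coords N K) (nested_coords N K') = nested_coords N (free_product K ?K)"
    "card (ground (free_product K ?K)) = n + n'" "rank (free_product K ?K) = r + r'"
    using coords rk cd K by simp_all
  then show ?thesis using nested_coords_in_generators[OF P] by simp
qed

end

text \<open>An injective linear map carries a proper segment around \<open>x\<close> to a proper segment around \<open>T x\<close>.\<close>

lemma extreme_point_of_linear_preimage:
  fixes T :: "'a::real_vector \<Rightarrow> 'b::real_vector"
  assumes T: "linear T" and inj: "inj_on T S" and sub: "T ` S \<subseteq> S'" and x: "x \<in> S"
    and ext: "T x extreme_point_of S'"
  shows "x extreme_point_of S"
  unfolding extreme_point_of_def
proof (intro conjI x ballI notI)
  fix a b assume ab: "a \<in> S" "b \<in> S" "x \<in> open_segment a b"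
  then obtain u where u: "a \<noteq> b" "0 < u" "u < 1" "x = (1 - u) *\<^sub>R a + u *\<^sub>R b"
    unfolding in_segment by auto
  have "T x = (1 - u) *\<^sub>R T a + u *\<^sub>R T b"
    unfolding u(4) by (simp add: linear_add[OF T] linear_scale[OF T])
  moreover have "T a \<noteq> T b" using inj ab u(1) by (auto simp: inj_on_def)
  ultimately have "T x \<in> open_segment (T a) (T b)" unfolding in_segment using u by auto
  then show False using ext ab sub by (auto simp: extreme_point_of_def)
qed

theorem theorem3p4:
  fixes M M' :: "'a matroid"
    and N :: "nat \<Rightarrow> nat \<Rightarrow> nat \<Rightarrow> nat matroid"
  assumes "nested_enumeration N"
    and "is_matroid M" and "is_matroid M'"
    and "ground M \<inter> ground M' = {}"
    and "\<nexists>e. is_coloop M e"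
    and "\<nexists>e. is_loop M' e"
    and "extremal N (free_product M M')"
  shows "extremal N M \<and> extremal N M'"
proof -
  interpret enumerated N by unfold_locales (rule assms(1))
  note M = assms(2) and M' = assms(3) and dis = assms(4)
  define r n r' n' where defs: "r = rank M" "n = card (ground M)" "r' = rank M'" "n' = card (ground M')"
  define v v' where vdefs: "v = nested_coords N M" "v' = nested_coords N M'"
  let ?V = "nested_coords N ` matroids_on {1..n} r" and ?V' = "nested_coords N ` matroids_on {1..n'} r'"
  let ?W = "nested_coords N ` matroids_on {1..n + n'} (r + r')"
  have ext: "tensor r n r' n' v v' extreme_point_of Omega N (r + r') (n + n')"
    using assms(7) unfolding extremal_def nested_coords_free_product[OF M M' dis]
      rank_free_product[OF M M' dis] card_free_product[OF M M' dis] defs vdefs .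
  have v: "v \<in> ?V" "v' \<in> ?V'"
    using nested_coords_in_generators[OF M] nested_coords_in_generators[OF M'] by (simp_all add: defs vdefs)
  then have vO: "v \<in> Omega N r n" "v' \<in> Omega N r' n'" by (auto simp: Omega_def intro: hull_inc)
  obtain A where A: "A \<in> subsets_of_size n r" "v (schubert_index N r n A) \<noteq> 0"
    using nested_coords_nonzero[OF M] unfolding defs vdefs by metis
  obtain A' where A': "A' \<in> subsets_of_size n' r'" "v' (schubert_index N r' n' A') \<noteq> 0"
    using nested_coords_nonzero[OF M'] unfolding defs vdefs by metis
  have "v extreme_point_of Omega N r n"
  proof (rule extreme_point_of_linear_preimage[where T = "\<lambda>a. tensor r n r' n' a v'", OF linear_tensor_left])
    show "v \<in> Omega N r n" by (rule vO(1))
    show "tensor r n r' n' v v' extreme_point_of Omega N (r + r') (n + n')" by (rule ext)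
    show "inj_on (\<lambda>a. tensor r n r' n' a v') (Omega N r n)"
    proof (rule inj_onI)
      fix a b assume ab: "a \<in> Omega N r n" "b \<in> Omega N r n" "tensor r n r' n' a v' = tensor r n r' n' b v'"
      show "a = b"
      proof (rule coord_space_eqI[OF nested_coords_in_coord_space[OF ab(1)] nested_coords_in_coord_space[OF ab(2)]])
        fix B assume "B \<in> subsets_of_size n r"
        then show "a (schubert_index N r n B) = b (schubert_index N r n B)"
          using tensor_join[OF _ A'(1), of B n r a v'] tensor_join[OF _ A'(1), of B n r b v'] ab(3) A'(2) by simp
      qed
    qed
    have "(\<lambda>a. tensor r n r' n' a v') ` ?V \<subseteq> ?W" using v(2) tensor_in_generators by auto
    then show "(\<lambda>a. tensor r n r' n' a v') ` Omega N r n \<subseteq> Omega N (r + r') (n + n')"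
      unfolding Omega_def convex_hull_linear_image[OF linear_tensor_left] by (rule hull_mono)
  qed
  moreover have "v' extreme_point_of Omega N r' n'"
  proof (rule extreme_point_of_linear_preimage[where T = "tensor r n r' n' v", OF linear_tensor_right])
    show "v' \<in> Omega N r' n'" by (rule vO(2))
    show "tensor r n r' n' v v' extreme_point_of Omega N (r + r') (n + n')" by (rule ext)
    show "inj_on (tensor r n r' n' v) (Omega N r' n')"
    proof (rule inj_onI)
      fix a b assume ab: "a \<in> Omega N r' n'" "b \<in> Omega N r' n'" "tensor r n r' n' v a = tensor r n r' n' v b"
      show "a = b"
      proof (rule coord_space_eqI[OF nested_coords_in_coord_space[OF ab(1)] nested_coords_in_coord_space[OF ab(2)]])
        fix B assume "B \<in> subsets_of_size n' r'"
        then show "a (schubert_index N r' n' B) = b (schubert_index N r' n' B)"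
          using tensor_join[OF A(1), of B n' r' v a] tensor_join[OF A(1), of B n' r' v b] ab(3) A(2) by simp
      qed
    qed
    have "tensor r n r' n' v ` ?V' \<subseteq> ?W" using v(1) tensor_in_generators by auto
    then show "tensor r n r' n' v ` Omega N r' n' \<subseteq> Omega N (r + r') (n + n')"
      unfolding Omega_def convex_hull_linear_image[OF linear_tensor_right] by (rule hull_mono)
  qed
  ultimately show ?thesis unfolding extremal_def by (simp add: defs vdefs)
qed

end
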